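(* Let $k$ be a commutative ring, $A\to B$ a homomorphism of $k$-algebras, and $I$ a two-sided ideal of $A$ mapped isomorphically to a two-sided ideal of $B$ (also denoted $I$). Then the following conditions are equivalent: (i) $\{\operatorname{Tor}_n^A(A/I^r,A/I^r)\}_r=0$ for all $n>0$. (ii) $\{\operatorname{Tor}_n^B(B/I^r,B/I^r)\}_r=0$ for all $n>0$. (iii) $\{\operatorname{Tor}_n^{k\ltimes I^r}(k,k)\}_r=0$ for all $n>0$. (iv) $I$ is pro Tor-unital, i.e., $\{\operatorname{Tor}_n^{\mathbb Z\ltimes I^r}(\mathbb Z,\mathbb Z)\}_r=0$ for all $n>0$.
   Context: Rings and algebras are associative and unital (not necessarily commutative) unless stated to be non-unital; ideals are two-sided. For a commutative ring $k$ and a non-unital $k$-algebra $J$, $k\ltimes J$ denotes the unital $k$-algebra $k\oplus J$ with multiplication $(a,x)(b,y)=(ab,\,ay+bx+xy)$; $k$ is a left and right $k\ltimes J$-module via the projection $k\ltimes J\to k$. $\{X_r\}_r$ denotes the pro abelian group given by an inverse system $\cdots\to X_2\to X_1$, here with the transition maps induced by $I^{r+1}\subseteq I^r$. Morphisms of pro objects are $\operatorname{Hom}(\{X_r\}_r,\{Y_s\}_s)=\varprojlim_s\varinjlim_r\operatorname{Hom}(X_r,Y_s)$. In particular $\{X_r\}_r=0$ means: for each $r\ge1$ there is $s\ge r$ such that the transition map $X_s\to X_r$ is zero. *)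

theory Defs
  imports
    "HOL-Algebra.IntRing"
    "HOL-Algebra.Module"
    "HOL-Algebra.Ideal_Product"
    "HOL-Algebra.QuotRing"
    "HOL-Algebra.Free_Abelian_Groups"
    "HOL-Algebra.Generated_Groups"
begin

text \<open>The locale \<^locale>\<open>algebra\<close> of the library requires commutativity; here only
  \<open>k\<close> is commutative.\<close>

locale nc_algebra = module + ring M +
  assumes smult_mult_left:
      "\<lbrakk>a \<in> carrier R; x \<in> carrier M; y \<in> carrier M\<rbrakk> \<Longrightarrow>
        (a \<odot>\<^bsub>M\<^esub> x) \<otimes>\<^bsub>M\<^esub> y = a \<odot>\<^bsub>M\<^esub> (x \<otimes>\<^bsub>M\<^esub> y)"
    and smult_mult_right:
      "\<lbrakk>a \<in> carrier R; x \<in> carrier M; y \<in> carrier M\<rbrakk> \<Longrightarrow>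
        x \<otimes>\<^bsub>M\<^esub> (a \<odot>\<^bsub>M\<^esub> y) = a \<odot>\<^bsub>M\<^esub> (x \<otimes>\<^bsub>M\<^esub> y)"

definition nc_algebra_hom :: "('k, 'y) ring_scheme \<Rightarrow> ('k, 'a) module \<Rightarrow> ('k, 'b) module \<Rightarrow> ('a \<Rightarrow> 'b) set"
  where "nc_algebra_hom k A B =
    {f \<in> ring_hom A B. \<forall>c\<in>carrier k. \<forall>x\<in>carrier A. f (c \<odot>\<^bsub>A\<^esub> x) = c \<odot>\<^bsub>B\<^esub> f x}"

primrec ideal_power :: "('a, 'z) ring_scheme \<Rightarrow> 'a set \<Rightarrow> nat \<Rightarrow> 'a set" where
  "ideal_power R I 0 = carrier R"
| "ideal_power R I (Suc r) = ideal_power R I r \<cdot>\<^bsub>R\<^esub> I"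

text \<open>\<open>k \<ltimes> J\<close>. A non-unital \<open>k\<close>-algebra \<open>J\<close> is given by a \<^typ>\<open>('k, 'a) module\<close> record whose
  field \<^const>\<open>monoid.one\<close> is ignored.\<close>

definition semidirect :: "('k, 'y) ring_scheme \<Rightarrow> ('k, 'a) module \<Rightarrow> ('k \<times> 'a) ring"
  where "semidirect k J =
    \<lparr>carrier = carrier k \<times> carrier J,
     monoid.mult = (\<lambda>(a, x) (b, y). (a \<otimes>\<^bsub>k\<^esub> b, (a \<odot>\<^bsub>J\<^esub> y \<oplus>\<^bsub>J\<^esub> b \<odot>\<^bsub>J\<^esub> x) \<oplus>\<^bsub>J\<^esub> x \<otimes>\<^bsub>J\<^esub> y)),
     monoid.one = (\<one>\<^bsub>k\<^esub>, \<zero>\<^bsub>J\<^esub>),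
     ring.zero = (\<zero>\<^bsub>k\<^esub>, \<zero>\<^bsub>J\<^esub>),
     add = (\<lambda>(a, x) (b, y). (a \<oplus>\<^bsub>k\<^esub> b, x \<oplus>\<^bsub>J\<^esub> y))\<rparr>"

definition as_int_algebra :: "('a, 'z) ring_scheme \<Rightarrow> (int, 'a) module"
  where "as_int_algebra A =
    \<lparr>carrier = carrier A, monoid.mult = monoid.mult A, monoid.one = \<one>\<^bsub>A\<^esub>, ring.zero = \<zero>\<^bsub>A\<^esub>, add = add A,
     smult = (\<lambda>c x. [c] \<cdot>\<^bsub>A\<^esub> x)\<rparr>"

text \<open>Both left and right modules over a ring of type \<open>'r\<close> are \<^typ>\<open>('r, 'm) module\<close> records (the
  fields \<^const>\<open>monoid.mult\<close> and \<^const>\<open>monoid.one\<close> are irrelevant). For a right module \<open>M\<close>, the term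
  \<open>r \<odot>\<^bsub>M\<^esub> m\<close> stands for the product \<open>m r\<close>.\<close>

definition left_via :: "('q, 'z) ring_scheme \<Rightarrow> ('r \<Rightarrow> 'q) \<Rightarrow> ('r, 'q) module"
  where "left_via Q \<pi> =
    \<lparr>carrier = carrier Q, monoid.mult = monoid.mult Q, monoid.one = \<one>\<^bsub>Q\<^esub>, ring.zero = \<zero>\<^bsub>Q\<^esub>, add = add Q,
     smult = (\<lambda>r x. \<pi> r \<otimes>\<^bsub>Q\<^esub> x)\<rparr>"

definition right_via :: "('q, 'z) ring_scheme \<Rightarrow> ('r \<Rightarrow> 'q) \<Rightarrow> ('r, 'q) module"
  where "right_via Q \<pi> =
    \<lparr>carrier = carrier Q, monoid.mult = monoid.mult Q, monoid.one = \<one>\<^bsub>Q\<^esub>, ring.zero = \<zero>\<^bsub>Q\<^esub>, add = add Q,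
     smult = (\<lambda>r x. x \<otimes>\<^bsub>Q\<^esub> \<pi> r)\<rparr>"

definition tensor_relations ::
  "('r, 'y) ring_scheme \<Rightarrow> ('r, 'm) module \<Rightarrow> ('r, 'n) module \<Rightarrow> ('m \<times> 'n \<Rightarrow>\<^sub>0 int) set"
  where "tensor_relations R M N =
    generate (free_Abelian_group (carrier M \<times> carrier N))
     ({frag_of (m \<oplus>\<^bsub>M\<^esub> m', n) - frag_of (m, n) - frag_of (m', n) | m m' n.
         m \<in> carrier M \<and> m' \<in> carrier M \<and> n \<in> carrier N} \<union>
      {frag_of (m, n \<oplus>\<^bsub>N\<^esub> n') - frag_of (m, n) - frag_of (m, n') | m n n'.
         m \<in> carrier M \<and> n \<in> carrier N \<and> n' \<in> carrier N} \<union>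
      {frag_of (r \<odot>\<^bsub>M\<^esub> m, n) - frag_of (m, r \<odot>\<^bsub>N\<^esub> n) | r m n.
         r \<in> carrier R \<and> m \<in> carrier M \<and> n \<in> carrier N})"

definition tensor ::
  "('r, 'y) ring_scheme \<Rightarrow> ('r, 'm) module \<Rightarrow> ('r, 'n) module \<Rightarrow> ('m \<times> 'n \<Rightarrow>\<^sub>0 int) set monoid"
  where "tensor R M N =
    free_Abelian_group (carrier M \<times> carrier N) Mod tensor_relations R M N"

text \<open>If \<open>h\<close> is a homomorphism into \<open>G\<close> that maps the subgroup \<open>H'\<close> of its domain into the
  subgroup \<open>H\<close> of \<open>G\<close>, then this is the induced homomorphism into \<open>G Mod H\<close> on the cosets
  of \<open>H'\<close>: it maps the coset of \<open>x\<close> to the coset of \<open>h x\<close>.\<close>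

definition induced_map :: "('h, 'z) monoid_scheme \<Rightarrow> 'h set \<Rightarrow> ('g \<Rightarrow> 'h) \<Rightarrow> 'g set \<Rightarrow> 'h set"
  where "induced_map G H h X = H <#>\<^bsub>G\<^esub> (h ` X)"

text \<open>The homomorphism \<open>f \<otimes> g\<close> into \<open>M \<otimes>\<^sub>R N\<close>. Its domain may be a tensor product
  over another ring, as long as \<open>f\<close> and \<open>g\<close> are semilinear.\<close>

definition tensor_map ::
  "('r, 'y) ring_scheme \<Rightarrow> ('r, 'm) module \<Rightarrow> ('r, 'n) module \<Rightarrow> ('m' \<Rightarrow> 'm) \<Rightarrow> ('n' \<Rightarrow> 'n) \<Rightarrow>
    ('m' \<times> 'n' \<Rightarrow>\<^sub>0 int) set \<Rightarrow> ('m \<times> 'n \<Rightarrow>\<^sub>0 int) set"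
  where "tensor_map R M N f g =
    induced_map (free_Abelian_group (carrier M \<times> carrier N)) (tensor_relations R M N)
      (frag_extend (\<lambda>(m, n). frag_of (f m, g n)))"

definition free_module :: "('r, 'y) ring_scheme \<Rightarrow> 'x set \<Rightarrow> ('r, 'x \<Rightarrow> 'r) module"
  where "free_module R X =
    \<lparr>carrier = {v. (\<forall>x\<in>X. v x \<in> carrier R) \<and> (\<forall>x. x \<notin> X \<longrightarrow> v x = \<zero>\<^bsub>R\<^esub>) \<and>
                   finite {x. v x \<noteq> \<zero>\<^bsub>R\<^esub>}},
     monoid.mult = undefined, monoid.one = undefined,
     ring.zero = (\<lambda>_. \<zero>\<^bsub>R\<^esub>),
     add = (\<lambda>v w x. v x \<oplus>\<^bsub>R\<^esub> w x),
     smult = (\<lambda>r v x. r \<otimes>\<^bsub>R\<^esub> v x)\<rparr>"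

definition basis_vector :: "('r, 'y) ring_scheme \<Rightarrow> 'x \<Rightarrow> 'x \<Rightarrow> 'r"
  where "basis_vector R x = (\<lambda>y. if y = x then \<one>\<^bsub>R\<^esub> else \<zero>\<^bsub>R\<^esub>)"

text \<open>The vector \<open>r\<^sub>1 e\<^bsub>x\<^sub>1\<^esub> + \<dots> + r\<^sub>m e\<^bsub>x\<^sub>m\<^esub>\<close> given by the list of pairs
  \<open>(r\<^sub>i, x\<^sub>i)\<close>, in which an \<open>x\<^sub>i\<close> may be repeated.\<close>

primrec lin_comb :: "('r, 'y) ring_scheme \<Rightarrow> ('r \<times> 'x) list \<Rightarrow> 'x \<Rightarrow> 'r" where
  "lin_comb R [] = (\<lambda>_. \<zero>\<^bsub>R\<^esub>)"
| "lin_comb R (p # l) = (lin_comb R l)(snd p := fst p \<oplus>\<^bsub>R\<^esub> lin_comb R l (snd p))"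

text \<open>The map from a free \<open>R\<close>-module to \<open>Q\<close> that is semilinear over \<open>\<phi>\<close> and sends the basis
  vector of \<open>x\<close> to \<open>u x\<close>.\<close>

definition free_lift ::
  "('r, 'y) ring_scheme \<Rightarrow> ('r \<Rightarrow> 's) \<Rightarrow> ('s, 'q) module \<Rightarrow> ('x \<Rightarrow> 'q) \<Rightarrow> ('x \<Rightarrow> 'r) \<Rightarrow> 'q"
  where "free_lift R \<phi> Q u v = (\<Oplus>\<^bsub>Q\<^esub>x\<in>{x. v x \<noteq> \<zero>\<^bsub>R\<^esub>}. \<phi> (v x) \<odot>\<^bsub>Q\<^esub> u x)"

text \<open>The standard resolution \<open>\<dots> \<rightarrow> P\<^sub>1 \<rightarrow> P\<^sub>0 \<rightarrow> N\<close> of a left module \<open>N\<close>: the module \<open>P\<^sub>0\<close> is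
  free on the elements of \<open>N\<close>, and \<open>P\<^bsub>n+1\<^esub>\<close> is free on all expressions for
  elements of the kernel of the preceding map, that is, on all lists whose \<^const>\<open>lin_comb\<close> lies
  in this kernel. Using lists instead of the elements of the kernel keeps all the bases in a
  single type, and it is compatible with change of rings.\<close>

datatype (dead 'r, 'm) cell = Gen (gen_elem: 'm) | Syz (syz_list: "('r \<times> ('r, 'm) cell) list")

definition syzygies ::
  "('r, 'y) ring_scheme \<Rightarrow> ('r, 'm) cell set \<Rightarrow> ('r, 'q) module \<Rightarrow> (('r, 'm) cell \<Rightarrow> 'q) \<Rightarrow>
    ('r, 'm) cell set"
  where "syzygies R X Q u =
    {Syz l | l. set l \<subseteq> carrier R \<times> X \<and> free_lift R id Q u (lin_comb R l) = \<zero>\<^bsub>Q\<^esub>}"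

fun res_basis :: "('r, 'y) ring_scheme \<Rightarrow> ('r, 'm) module \<Rightarrow> nat \<Rightarrow> ('r, 'm) cell set" where
  "res_basis R N 0 = Gen ` carrier N"
| "res_basis R N (Suc 0) = syzygies R (res_basis R N 0) N gen_elem"
| "res_basis R N (Suc (Suc n)) =
     syzygies R (res_basis R N (Suc n)) (free_module R (res_basis R N n))
       (\<lambda>x. lin_comb R (syz_list x))"

definition res :: "('r, 'y) ring_scheme \<Rightarrow> ('r, 'm) module \<Rightarrow> nat \<Rightarrow> ('r, ('r, 'm) cell \<Rightarrow> 'r) module"
  where "res R N n = free_module R (res_basis R N n)"

text \<open>The differential \<open>P\<^bsub>n+1\<^esub> \<rightarrow> P\<^sub>n\<close>.\<close>

definition res_diff ::
  "('r, 'y) ring_scheme \<Rightarrow> ('r, 'm) module \<Rightarrow> nat \<Rightarrow> (('r, 'm) cell \<Rightarrow> 'r) \<Rightarrow> ('r, 'm) cell \<Rightarrow> 'r"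
  where "res_diff R N n = free_lift R id (res R N n) (\<lambda>x. lin_comb R (syz_list x))"

primrec cell_map :: "('r \<Rightarrow> 's) \<Rightarrow> ('m \<Rightarrow> 'n) \<Rightarrow> ('r, 'm) cell \<Rightarrow> ('s, 'n) cell" where
  "cell_map \<phi> g (Gen m) = Gen (g m)"
| "cell_map \<phi> g (Syz l) = Syz (map (map_prod \<phi> (cell_map \<phi> g)) l)"

text \<open>For a ring homomorphism \<open>\<phi> : R \<rightarrow> S\<close> and a map \<open>g\<close> from the \<open>R\<close>-module \<open>N\<close> to the
  \<open>S\<close>-module \<open>N'\<close> that is semilinear over \<open>\<phi>\<close>, this is the lift of \<open>g\<close> to the resolutions.\<close>

definition res_map ::
  "('r, 'y) ring_scheme \<Rightarrow> ('s, 'z) ring_scheme \<Rightarrow> ('s, 'n) module \<Rightarrow> ('r \<Rightarrow> 's) \<Rightarrow> ('m \<Rightarrow> 'n) \<Rightarrow> nat \<Rightarrow>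
    (('r, 'm) cell \<Rightarrow> 'r) \<Rightarrow> ('s, 'n) cell \<Rightarrow> 's"
  where "res_map R S N' \<phi> g n =
    free_lift R \<phi> (res S N' n) (\<lambda>x. basis_vector S (cell_map \<phi> g x))"

text \<open>For a right module \<open>M\<close> and a left module \<open>N\<close> over \<open>R\<close>, the group \<open>Tor\<^sub>n\<^sup>R(M, N)\<close> is
  the \<open>n\<close>-th homology of the complex \<open>M \<otimes>\<^sub>R P\<^sub>*\<close>.\<close>

definition tor_diff where
  "tor_diff R M N n = tensor_map R M (res R N n) id (res_diff R N n)"

definition tor_boundaries where
  "tor_boundaries R M N n = tor_diff R M N n ` carrier (tensor R M (res R N (Suc n)))"

primrec tor_cycles where
  "tor_cycles R M N 0 = carrier (tensor R M (res R N 0))"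
| "tor_cycles R M N (Suc n) =
     kernel (tensor R M (res R N (Suc n))) (tensor R M (res R N n)) (tor_diff R M N n)"

definition tor ::
  "('r, 'y) ring_scheme \<Rightarrow> ('r, 'm) module \<Rightarrow> ('r, 'n) module \<Rightarrow> nat \<Rightarrow>
    ('m \<times> (('r, 'n) cell \<Rightarrow> 'r) \<Rightarrow>\<^sub>0 int) set set monoid"
  where "tor R M N n =
    (tensor R M (res R N n))\<lparr>carrier := tor_cycles R M N n\<rparr> Mod tor_boundaries R M N n"

text \<open>The map \<open>Tor\<^sub>n\<^sup>R(M, N) \<rightarrow> Tor\<^sub>n\<^sup>S(M', N')\<close> induced by a ring
  homomorphism \<open>\<phi> : R \<rightarrow> S\<close> and maps \<open>f : M \<rightarrow> M'\<close>, \<open>g : N \<rightarrow> N'\<close> semilinear over \<open>\<phi>\<close>.\<close>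

definition tor_map where
  "tor_map R S M' N' \<phi> f g n =
    induced_map (tensor S M' (res S N' n)) (tor_boundaries S M' N' n)
      (tensor_map S M' (res S N' n) f (res_map R S N' \<phi> g n))"

text \<open>\<open>t s r\<close> is the transition homomorphism \<open>X s \<rightarrow> X r\<close> for \<open>1 \<le> r \<le> s\<close>.\<close>

definition pro_zero :: "(nat \<Rightarrow> ('x, 'z) monoid_scheme) \<Rightarrow> (nat \<Rightarrow> nat \<Rightarrow> 'x \<Rightarrow> 'x) \<Rightarrow> bool"
  where "pro_zero X t \<longleftrightarrow>
    (\<forall>r\<ge>1. \<exists>s\<ge>r. \<forall>x\<in>carrier (X s). t s r x = \<one>\<^bsub>X r\<^esub>)"

text \<open>\<open>{Tor\<^sub>n\<^sup>A(A/I\<^sup>r, A/I\<^sup>r)}\<^sub>r = 0\<close>. The projection \<open>A/I\<^sup>s \<rightarrow> A/I\<^sup>r\<close> maps the coset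
  \<open>X\<close> to \<open>I\<^sup>r + X\<close>.\<close>

definition pro_tor_quot_zero :: "('a, 'z) ring_scheme \<Rightarrow> 'a set \<Rightarrow> nat \<Rightarrow> bool"
  where "pro_tor_quot_zero A I n \<longleftrightarrow>
    (let J = ideal_power A I;
         Rt = (\<lambda>r. right_via (A Quot J r) (\<lambda>a. J r +>\<^bsub>A\<^esub> a));
         Lt = (\<lambda>r. left_via (A Quot J r) (\<lambda>a. J r +>\<^bsub>A\<^esub> a));
         p = (\<lambda>r X. J r <+>\<^bsub>A\<^esub> X)
     in pro_zero (\<lambda>r. tor A (Rt r) (Lt r) n)
          (\<lambda>s r. tor_map A A (Rt r) (Lt r) id (p r) (p r) n))"

text \<open>\<open>{Tor\<^sub>n\<^bsup>k \<ltimes> I\<^sup>r\<^esup>(k, k)}\<^sub>r = 0\<close> for an ideal \<open>I\<close> of the \<open>k\<close>-algebra \<open>A\<close>. The transition maps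
  are induced by the inclusions \<open>k \<ltimes> I\<^sup>s \<rightarrow> k \<ltimes> I\<^sup>r\<close> and the identity of \<open>k\<close>.\<close>

definition pro_tor_semidirect_zero ::
  "('k, 'y) ring_scheme \<Rightarrow> ('k, 'a) module \<Rightarrow> 'a set \<Rightarrow> nat \<Rightarrow> bool"
  where "pro_tor_semidirect_zero k A I n \<longleftrightarrow>
    (let E = (\<lambda>r. semidirect k (A\<lparr>carrier := ideal_power A I r\<rparr>));
         Rt = right_via k fst;
         Lt = left_via k fst
     in pro_zero (\<lambda>r. tor (E r) Rt Lt n)
          (\<lambda>s r. tor_map (E s) (E r) Rt Lt id id id n))"

definition pro_tor_unital :: "('a, 'z) ring_scheme \<Rightarrow> 'a set \<Rightarrow> bool"
  where "pro_tor_unital A I \<longleftrightarrow> (\<forall>n>0. pro_tor_semidirect_zero \<Z> (as_int_algebra A) I n)"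

end

theory Submission
  imports Defs
begin

text \<open>Let \<open>J\<^sub>r\<close> be the kernel of \<open>A\<^sub>r \<rightarrow> Q\<^sub>r\<close>, and let \<open>P\<^sub>*\<close> be the standard resolution of \<open>Q\<^sub>r\<close>.
  As \<open>Q\<^sub>r \<otimes> P\<^sub>n = P\<^sub>n / J\<^sub>r P\<^sub>n\<close>, all \<open>Tor\<^sub>n\<close> with \<open>n > 0\<close> are pro-zero iff for all \<open>N\<close> and \<open>r\<close> there are an
  \<open>s \<ge> r\<close> and \<open>A\<^sub>s\<close>-linear maps \<open>P\<^sub>n(s) \<rightarrow> J\<^sub>r P\<^sub>n(r)\<close> for \<open>0 < n \<le> N\<close> that form a chain map over the
  inclusion \<open>J\<^sub>s \<rightarrow> J\<^sub>r\<close>: such a map can be constructed degree by degree if Tor vanishes, and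
  conversely it is chain homotopic to the transition map but becomes zero modulo \<open>J\<^sub>r\<close>.

  Now let \<open>B\<^sub>r\<close> be another tower with the same kernels \<open>J\<^sub>r\<close>. If Tor vanishes for \<open>A\<close>, then the complexes
  \<open>J\<^sub>r P\<^sub>n\<close> for \<open>A\<close> are pro-exact, and they consist of \<open>B\<^sub>r\<close>-modules, so the free resolution for \<open>B\<close>
  maps to them. In the other direction, composing the differential with the contractions above gives
  matrices with entries in \<open>J\<^sub>r\<close>. These make sense over \<open>B\<close> and define complexes of free \<open>B\<close>-modules, which
  map to the resolution for \<open>B\<close>. The composite is the required chain map for \<open>B\<close>. It
  remains to observe that all the rings in the theorem share the ideals \<open>I\<^sup>r\<close>, compatibly with multiplication.\<close>

section \<open>Modules and free modules\<close>

text \<open>The groups Tor over \<open>A\<close> and over \<open>B\<close> are never compared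
  directly; only the kernels are common, so whatever crosses from one ring to the other is a left
  module structure on \<open>J P\<close>. It is respected by linear maps because these multiply
  coefficient vectors by a matrix from the right, and b(ja) = (bj)a.

  The obstacle is that \<open>J P\<close> is not free over \<open>B\<close>: a map out of it cannot
  be prescribed on basis vectors. A contraction inserted after the differential d replaces d e_x by
  a vector with coefficients in \<open>J\<close>. The value on j e_x is then \<sigma>(j) times an
  element that does not depend on j, and such a map extends to the free \<open>B\<close>-module on
  the same basis.

  Every extension by one degree may use up a transition map. Hence all families of maps stop at a
  given degree N, and the level at which they start depends on N.

  The standard resolution begins with the free module on all elements of \<open>Q\<close>, not with
  the ring. The maps \<alpha>, \<kappa> and \<open>e\<close> mediate between its lowest degrees and
  the inclusion of \<open>J\<close> in the ring.\<close>

locale lmodule = R: ring R + M: abelian_group M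
  for R :: "('r, 'y) ring_scheme" and M :: "('r, 'm) module" +
  assumes smult_closed [simp, intro]:
      "\<lbrakk>a \<in> carrier R; x \<in> carrier M\<rbrakk> \<Longrightarrow> a \<odot>\<^bsub>M\<^esub> x \<in> carrier M"
    and smult_l_distr:
      "\<lbrakk>a \<in> carrier R; b \<in> carrier R; x \<in> carrier M\<rbrakk> \<Longrightarrow>
        (a \<oplus>\<^bsub>R\<^esub> b) \<odot>\<^bsub>M\<^esub> x = a \<odot>\<^bsub>M\<^esub> x \<oplus>\<^bsub>M\<^esub> b \<odot>\<^bsub>M\<^esub> x"
    and smult_r_distr:
      "\<lbrakk>a \<in> carrier R; x \<in> carrier M; y \<in> carrier M\<rbrakk> \<Longrightarrow>
        a \<odot>\<^bsub>M\<^esub> (x \<oplus>\<^bsub>M\<^esub> y) = a \<odot>\<^bsub>M\<^esub> x \<oplus>\<^bsub>M\<^esub> a \<odot>\<^bsub>M\<^esub> y"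
    and smult_assoc:
      "\<lbrakk>a \<in> carrier R; b \<in> carrier R; x \<in> carrier M\<rbrakk> \<Longrightarrow>
        (a \<otimes>\<^bsub>R\<^esub> b) \<odot>\<^bsub>M\<^esub> x = a \<odot>\<^bsub>M\<^esub> (b \<odot>\<^bsub>M\<^esub> x)"
    and smult_one [simp]: "x \<in> carrier M \<Longrightarrow> \<one>\<^bsub>R\<^esub> \<odot>\<^bsub>M\<^esub> x = x"
begin

lemma smult_l_null [simp]: "x \<in> carrier M \<Longrightarrow> \<zero>\<^bsub>R\<^esub> \<odot>\<^bsub>M\<^esub> x = \<zero>\<^bsub>M\<^esub>"
  by (metis M.add.l_cancel_one R.add.l_cancel_one R.zero_closed smult_closed smult_l_distr)

lemma smult_r_null [simp]: "a \<in> carrier R \<Longrightarrow> a \<odot>\<^bsub>M\<^esub> \<zero>\<^bsub>M\<^esub> = \<zero>\<^bsub>M\<^esub>"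
  by (metis M.add.l_cancel_one M.zero_closed smult_closed smult_r_distr)

end

text \<open>The scalars form a bare set, so that one map can be read as linear over
  \<open>carrier (A s)\<close> although its target is a module over \<open>A r\<close>, as linear
  over a smaller ring, or, with the empty set, as merely additive.\<close>

definition linear_on :: "'r set \<Rightarrow> ('r, 'm) module \<Rightarrow> ('r, 'n) module \<Rightarrow> ('m \<Rightarrow> 'n) \<Rightarrow> bool"
  where "linear_on C M N g \<longleftrightarrow> g \<in> carrier M \<rightarrow> carrier N \<and>
    (\<forall>x\<in>carrier M. \<forall>y\<in>carrier M. g (x \<oplus>\<^bsub>M\<^esub> y) = g x \<oplus>\<^bsub>N\<^esub> g y) \<and>
    (\<forall>a\<in>C. \<forall>x\<in>carrier M. g (a \<odot>\<^bsub>M\<^esub> x) = a \<odot>\<^bsub>N\<^esub> g x)"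

lemma linear_onI:
  assumes "\<And>x. x \<in> carrier M \<Longrightarrow> g x \<in> carrier N"
    and "\<And>x y. \<lbrakk>x \<in> carrier M; y \<in> carrier M\<rbrakk> \<Longrightarrow> g (x \<oplus>\<^bsub>M\<^esub> y) = g x \<oplus>\<^bsub>N\<^esub> g y"
    and "\<And>a x. \<lbrakk>a \<in> C; x \<in> carrier M\<rbrakk> \<Longrightarrow> g (a \<odot>\<^bsub>M\<^esub> x) = a \<odot>\<^bsub>N\<^esub> g x"
  shows "linear_on C M N g"
  using assms by (auto simp: linear_on_def)

lemma linear_on_closed: "linear_on C M N g \<Longrightarrow> x \<in> carrier M \<Longrightarrow> g x \<in> carrier N"
  by (auto simp: linear_on_def)

lemma linear_on_add:
  "linear_on C M N g \<Longrightarrow> x \<in> carrier M \<Longrightarrow> y \<in> carrier M \<Longrightarrow> g (x \<oplus>\<^bsub>M\<^esub> y) = g x \<oplus>\<^bsub>N\<^esub> g y"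
  by (auto simp: linear_on_def)

lemma linear_on_smult:
  "linear_on C M N g \<Longrightarrow> a \<in> C \<Longrightarrow> x \<in> carrier M \<Longrightarrow> g (a \<odot>\<^bsub>M\<^esub> x) = a \<odot>\<^bsub>N\<^esub> g x"
  by (auto simp: linear_on_def)

lemma linear_on_subset: "linear_on C M N g \<Longrightarrow> C' \<subseteq> C \<Longrightarrow> linear_on C' M N g"
  by (auto simp: linear_on_def)

lemma linear_on_compose:
  "linear_on C M N g \<Longrightarrow> linear_on C N P h \<Longrightarrow> linear_on C M P (\<lambda>x. h (g x))"
  by (auto simp: linear_on_def Pi_iff)

lemma linear_on_zero:
  assumes "linear_on C M N g" "abelian_group M" "abelian_group N"
  shows "g \<zero>\<^bsub>M\<^esub> = \<zero>\<^bsub>N\<^esub>"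
proof -
  interpret M: abelian_group M by fact
  interpret N: abelian_group N by fact
  have c: "g \<zero>\<^bsub>M\<^esub> \<in> carrier N" using linear_on_closed[OF assms(1)] by simp
  have "g \<zero>\<^bsub>M\<^esub> \<oplus>\<^bsub>N\<^esub> g \<zero>\<^bsub>M\<^esub> = g \<zero>\<^bsub>M\<^esub>"
    using linear_on_add[OF assms(1), of "\<zero>\<^bsub>M\<^esub>" "\<zero>\<^bsub>M\<^esub>"] by simp
  then show ?thesis using c N.add.l_cancel_one by blast
qed

lemma linear_on_minus:
  assumes "linear_on C M N g" "abelian_group M" "abelian_group N" "x \<in> carrier M"
  shows "g (\<ominus>\<^bsub>M\<^esub> x) = \<ominus>\<^bsub>N\<^esub> g x"
proof -
  interpret M: abelian_group M by fact
  interpret N: abelian_group N by fact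
  have "g x \<oplus>\<^bsub>N\<^esub> g (\<ominus>\<^bsub>M\<^esub> x) = \<zero>\<^bsub>N\<^esub>"
    using linear_on_add[OF assms(1), of x "\<ominus>\<^bsub>M\<^esub> x"] linear_on_zero[OF assms(1-3)] assms(4)
    by (simp add: M.r_neg)
  then show ?thesis
    using linear_on_closed[OF assms(1)] assms(4) N.minus_equality N.add.m_comm
    by (metis M.a_inv_closed)
qed

lemma linear_on_diff:
  assumes "linear_on C M N g" "abelian_group M" "abelian_group N" "x \<in> carrier M" "y \<in> carrier M"
  shows "g (x \<ominus>\<^bsub>M\<^esub> y) = g x \<ominus>\<^bsub>N\<^esub> g y"
proof -
  interpret M: abelian_group M by fact
  show ?thesis
    using linear_on_add[OF assms(1), of x "\<ominus>\<^bsub>M\<^esub> y"] linear_on_minus[OF assms(1-3)] assms(4,5)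
    by (simp add: a_minus_def)
qed

lemma linear_on_sum:
  assumes "linear_on C M N g" "linear_on C M N h" "lmodule R N" "C \<subseteq> carrier R" "abelian_group M"
  shows "linear_on C M N (\<lambda>x. g x \<oplus>\<^bsub>N\<^esub> h x)"
proof -
  interpret lmodule R N by fact
  show ?thesis
    using assms(4) linear_on_closed[OF assms(1)] linear_on_closed[OF assms(2)]
    by (intro linear_onI)
      (auto simp: linear_on_add[OF assms(1)] linear_on_add[OF assms(2)] linear_on_smult[OF assms(1)]
         linear_on_smult[OF assms(2)] smult_r_distr M.add.m_ac subset_iff)
qed

lemma linear_on_uminus:
  assumes "linear_on C M N g" "lmodule R N" "C \<subseteq> carrier R" "abelian_group M"
  shows "linear_on C M N (\<lambda>x. \<ominus>\<^bsub>N\<^esub> g x)"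
proof -
  interpret lmodule R N by fact
  have neg: "\<ominus>\<^bsub>N\<^esub> (a \<odot>\<^bsub>N\<^esub> x) = a \<odot>\<^bsub>N\<^esub> \<ominus>\<^bsub>N\<^esub> x" if "a \<in> carrier R" "x \<in> carrier N" for a x
    using that smult_r_distr[of a x "\<ominus>\<^bsub>N\<^esub> x"] M.minus_equality[of "a \<odot>\<^bsub>N\<^esub> \<ominus>\<^bsub>N\<^esub> x" "a \<odot>\<^bsub>N\<^esub> x"]
    by (simp add: M.r_neg M.add.m_comm)
  show ?thesis
    using assms(3) linear_on_closed[OF assms(1)]
    by (intro linear_onI)
      (auto simp: linear_on_add[OF assms(1)] linear_on_smult[OF assms(1)] neg M.minus_add subset_iff)
qed

lemma linear_on_minus_fun:
  assumes "linear_on C M N g" "linear_on C M N h" "lmodule R N" "C \<subseteq> carrier R" "abelian_group M"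
  shows "linear_on C M N (\<lambda>x. g x \<ominus>\<^bsub>N\<^esub> h x)"
  using linear_on_sum[OF assms(1) linear_on_uminus[OF assms(2-5)] assms(3-5)] by (simp add: a_minus_def)

text \<open>The coefficients lie in a subgroup \<open>J\<close> of \<open>R\<close>, on which a second ring acts by \<open>\<rho>\<close>. This makes
  \<open>J P\<close> a module over every ring that contains \<open>J\<close> as an ideal.\<close>

definition coeff_module ::
  "('r, 'y) ring_scheme \<Rightarrow> 'x set \<Rightarrow> 'r set \<Rightarrow> ('s \<Rightarrow> 'r \<Rightarrow> 'r) \<Rightarrow> ('s, 'x \<Rightarrow> 'r) module"
  where "coeff_module R X J \<rho> =
    \<lparr>carrier = {v. (\<forall>x. v x \<in> J) \<and> (\<forall>x. x \<notin> X \<longrightarrow> v x = \<zero>\<^bsub>R\<^esub>) \<and> finite {x. v x \<noteq> \<zero>\<^bsub>R\<^esub>}},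
     monoid.mult = undefined, monoid.one = undefined,
     ring.zero = (\<lambda>_. \<zero>\<^bsub>R\<^esub>),
     add = (\<lambda>v w x. v x \<oplus>\<^bsub>R\<^esub> w x),
     smult = (\<lambda>s v x. \<rho> s (v x))\<rparr>"

text \<open>The rank one case of \<open>coeff_module\<close>. The laws of an action \<rho> on
  \<open>J\<close> are stated once, as an \<open>lmodule\<close> fact about this record, and
  \<open>coeff_lmodule\<close> lifts them to all coordinates.\<close>

definition action_module ::
  "('r, 'y) ring_scheme \<Rightarrow> 'r set \<Rightarrow> ('s \<Rightarrow> 'r \<Rightarrow> 'r) \<Rightarrow> ('s, 'r) module"
  where "action_module R J \<rho> =
    \<lparr>carrier = J, monoid.mult = monoid.mult R, monoid.one = \<one>\<^bsub>R\<^esub>, ring.zero = \<zero>\<^bsub>R\<^esub>, add = add R,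
     smult = \<rho>\<rparr>"

lemmas action_module_simps [simp] = action_module_def

lemma left_via_eq: "left_via Q \<pi> = action_module Q (carrier Q) (\<lambda>r x. \<pi> r \<otimes>\<^bsub>Q\<^esub> x)"
  by (simp add: left_via_def)

text \<open>Outside \<open>X\<close> the value is zero, which lies in the carrier anyway. Thus free
  modules are the coefficient modules with \<open>J\<close> the whole ring, and facts about the
  latter cover both.\<close>

lemma free_module_eq:
  assumes "ring R"
  shows "free_module R X = coeff_module R X (carrier R) (monoid.mult R)"
proof -
  interpret ring R by fact
  have "(\<forall>x\<in>X. v x \<in> carrier R) \<and> (\<forall>x. x \<notin> X \<longrightarrow> v x = \<zero>\<^bsub>R\<^esub>) \<and> F \<longleftrightarrow>
    (\<forall>x. v x \<in> carrier R) \<and> (\<forall>x. x \<notin> X \<longrightarrow> v x = \<zero>\<^bsub>R\<^esub>) \<and> F" for v F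
    using zero_closed by metis
  then have "{v. (\<forall>x\<in>X. v x \<in> carrier R) \<and> (\<forall>x. x \<notin> X \<longrightarrow> v x = \<zero>\<^bsub>R\<^esub>) \<and> finite {x. v x \<noteq> \<zero>\<^bsub>R\<^esub>}} =
    {v. (\<forall>x. v x \<in> carrier R) \<and> (\<forall>x. x \<notin> X \<longrightarrow> v x = \<zero>\<^bsub>R\<^esub>) \<and> finite {x. v x \<noteq> \<zero>\<^bsub>R\<^esub>}}"
    by simp
  then show ?thesis by (simp add: free_module_def coeff_module_def)
qed

text \<open>A multiple of a basis vector, written without the basis vector: with coefficients in
  \<open>J\<close> these lie in \<open>J P\<close>, while the basis vectors in general do
  not.\<close>

definition single :: "('r, 'y) ring_scheme \<Rightarrow> 'r \<Rightarrow> 'x \<Rightarrow> 'x \<Rightarrow> 'r"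
  where "single R a x = (\<lambda>y. if y = x then a else \<zero>\<^bsub>R\<^esub>)"

lemma basis_vector_eq: "basis_vector R x = single R \<one>\<^bsub>R\<^esub> x"
  by (simp add: basis_vector_def single_def)

lemma coeff_module_carrier:
  "v \<in> carrier (coeff_module R X J \<rho>) \<longleftrightarrow>
    (\<forall>x. v x \<in> J) \<and> (\<forall>x. x \<notin> X \<longrightarrow> v x = \<zero>\<^bsub>R\<^esub>) \<and> finite {x. v x \<noteq> \<zero>\<^bsub>R\<^esub>}"
  by (simp add: coeff_module_def)

lemma coeff_module_ops [simp]:
  "\<zero>\<^bsub>coeff_module R X J \<rho>\<^esub> = (\<lambda>_. \<zero>\<^bsub>R\<^esub>)"
  "v \<oplus>\<^bsub>coeff_module R X J \<rho>\<^esub> w = (\<lambda>x. v x \<oplus>\<^bsub>R\<^esub> w x)"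
  "s \<odot>\<^bsub>coeff_module R X J \<rho>\<^esub> v = (\<lambda>x. \<rho> s (v x))"
  by (simp_all add: coeff_module_def)

context
  fixes R :: "('r, 'y) ring_scheme" and J :: "'r set"
  assumes ring_R: "ring R" and J: "additive_subgroup J R"
begin

interpretation ring R by (rule ring_R)
interpretation additive_subgroup J R by (rule J)

lemma coeff_single: "a \<in> J \<Longrightarrow> x \<in> X \<Longrightarrow> single R a x \<in> carrier (coeff_module R X J \<rho>)"
  by (auto simp: coeff_module_carrier single_def)

lemma coeff_add:
  assumes "v \<in> carrier (coeff_module R X J \<rho>)" "w \<in> carrier (coeff_module R X J \<rho>)"
  shows "(\<lambda>x. v x \<oplus>\<^bsub>R\<^esub> w x) \<in> carrier (coeff_module R X J \<rho>)"
proof -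
  have "{x. v x \<oplus>\<^bsub>R\<^esub> w x \<noteq> \<zero>\<^bsub>R\<^esub>} \<subseteq> {x. v x \<noteq> \<zero>\<^bsub>R\<^esub>} \<union> {x. w x \<noteq> \<zero>\<^bsub>R\<^esub>}" by auto
  then show ?thesis
    using assms by (auto simp: coeff_module_carrier intro: finite_subset)
qed

text \<open>Induction on the size of the support, splitting off one coordinate. It does for
  \<open>J P\<close> what a basis does for free modules.\<close>

lemma coeff_induct:
  assumes "v \<in> carrier (coeff_module R X J \<rho>)"
    and "P (\<lambda>_. \<zero>\<^bsub>R\<^esub>)"
    and step: "\<And>a x w. \<lbrakk>a \<in> J; x \<in> X; w \<in> carrier (coeff_module R X J \<rho>); P w\<rbrakk> \<Longrightarrow>
      P (\<lambda>y. single R a x y \<oplus>\<^bsub>R\<^esub> w y)"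
  shows "P v"
  using assms(1)
proof (induction "card {x. v x \<noteq> \<zero>\<^bsub>R\<^esub>}" arbitrary: v)
  case 0
  then have "v = (\<lambda>_. \<zero>\<^bsub>R\<^esub>)" by (auto simp: coeff_module_carrier)
  then show ?case using assms(2) by simp
next
  case (Suc n)
  then obtain x where x: "v x \<noteq> \<zero>\<^bsub>R\<^esub>"
    by (metis (mono_tags, lifting) Collect_empty_eq card.empty nat.distinct(1))
  let ?w = "v(x := \<zero>\<^bsub>R\<^esub>)"
  have eq: "{y. ?w y \<noteq> \<zero>\<^bsub>R\<^esub>} = {y. v y \<noteq> \<zero>\<^bsub>R\<^esub>} - {x}" by auto
  have fin: "finite {y. v y \<noteq> \<zero>\<^bsub>R\<^esub>}" using Suc.prems by (auto simp: coeff_module_carrier)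
  have w: "?w \<in> carrier (coeff_module R X J \<rho>)"
    using Suc.prems fin by (auto simp: coeff_module_carrier eq simp del: fun_upd_apply) auto
  have "n = card {y. ?w y \<noteq> \<zero>\<^bsub>R\<^esub>}" unfolding eq using Suc.hyps(2) fin x by simp
  then have "P ?w" using Suc.hyps(1) w by blast
  moreover have "v x \<in> J" "x \<in> X" using Suc.prems x by (auto simp: coeff_module_carrier)
  ultimately have "P (\<lambda>y. single R (v x) x y \<oplus>\<^bsub>R\<^esub> ?w y)" using step w by blast
  moreover have "(\<lambda>y. single R (v x) x y \<oplus>\<^bsub>R\<^esub> ?w y) = v"
    using Suc.prems by (auto simp: single_def coeff_module_carrier)
  ultimately show ?case by simp
qed

text \<open>The single-entry vectors with all coefficients from \<open>J\<close> generate the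
  additive group. Therefore additivity is all that is asked of the two maps, as the empty set of
  scalars says.\<close>

lemma coeff_eqI:
  assumes "linear_on {} (coeff_module R X J \<rho>) N f" "linear_on {} (coeff_module R X J \<rho>) N g"
    and "abelian_group (coeff_module R X J \<rho>)" "abelian_group N"
    and "\<And>a x. a \<in> J \<Longrightarrow> x \<in> X \<Longrightarrow> f (single R a x) = g (single R a x)"
    and "v \<in> carrier (coeff_module R X J \<rho>)"
  shows "f v = g v"
proof (rule coeff_induct[OF assms(6), where P = "\<lambda>v. f v = g v"])
  show "f (\<lambda>_. \<zero>\<^bsub>R\<^esub>) = g (\<lambda>_. \<zero>\<^bsub>R\<^esub>)"
    using linear_on_zero[OF assms(1,3,4)] linear_on_zero[OF assms(2,3,4)] by simp
next
  fix a x w assume "a \<in> J" "x \<in> X" "w \<in> carrier (coeff_module R X J \<rho>)" "f w = g w"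
  then show "f (\<lambda>y. single R a x y \<oplus>\<^bsub>R\<^esub> w y) = g (\<lambda>y. single R a x y \<oplus>\<^bsub>R\<^esub> w y)"
    using linear_on_add[OF assms(1), of "single R a x" w] linear_on_add[OF assms(2), of "single R a x" w]
      assms(5) by (simp add: coeff_single)
qed

lemma coeff_lmodule:
  assumes "lmodule S (action_module R J \<rho>)"
  shows "lmodule S (coeff_module R X J \<rho>)"
proof -
  interpret A: lmodule S "action_module R J \<rho>" by fact
  have z: "\<rho> s \<zero>\<^bsub>R\<^esub> = \<zero>\<^bsub>R\<^esub>" if "s \<in> carrier S" for s using A.smult_r_null that by simp
  have sm: "(\<lambda>x. \<rho> s (v x)) \<in> carrier (coeff_module R X J \<rho>)"
    if "s \<in> carrier S" "v \<in> carrier (coeff_module R X J \<rho>)" for s v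
  proof -
    have "{x. \<rho> s (v x) \<noteq> \<zero>\<^bsub>R\<^esub>} \<subseteq> {x. v x \<noteq> \<zero>\<^bsub>R\<^esub>}" using z that by auto
    then show ?thesis
      using that A.smult_closed z by (auto simp: coeff_module_carrier intro: finite_subset)
  qed
  have neg: "(\<lambda>x. \<ominus>\<^bsub>R\<^esub> v x) \<in> carrier (coeff_module R X J \<rho>)"
    if "v \<in> carrier (coeff_module R X J \<rho>)" for v
  proof -
    have "{x. \<ominus>\<^bsub>R\<^esub> v x \<noteq> \<zero>\<^bsub>R\<^esub>} \<subseteq> {x. v x \<noteq> \<zero>\<^bsub>R\<^esub>}" by auto
    then show ?thesis
      using that a_inv_closed by (auto simp: coeff_module_carrier intro: finite_subset)
  qed
  have J': "v x \<in> J" "v x \<in> carrier R" if "v \<in> carrier (coeff_module R X J \<rho>)" for v x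
    using that by (auto simp: coeff_module_carrier)
  show ?thesis
  proof (intro lmodule.intro lmodule_axioms.intro abelian_groupI)
    show "ring S" by (rule A.R.ring_axioms)
    show "\<exists>y\<in>carrier (coeff_module R X J \<rho>). y \<oplus>\<^bsub>coeff_module R X J \<rho>\<^esub> x = \<zero>\<^bsub>coeff_module R X J \<rho>\<^esub>"
      if "x \<in> carrier (coeff_module R X J \<rho>)" for x
      using neg[OF that] J'(2)[OF that] by (intro bexI[of _ "\<lambda>y. \<ominus>\<^bsub>R\<^esub> x y"]) (auto simp: l_neg)
  qed (auto simp: coeff_add sm J' a_assoc a_comm A.smult_l_distr[simplified] A.smult_r_distr[simplified]
       A.smult_assoc[simplified] A.smult_one[simplified], auto simp: coeff_module_carrier fun_eq_iff a_comm a_lcomm)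
qed

end

lemma (in lmodule) finsum_smult:
  assumes "finite S" "a \<in> carrier R" "f \<in> S \<rightarrow> carrier M"
  shows "a \<odot>\<^bsub>M\<^esub> finsum M f S = finsum M (\<lambda>x. a \<odot>\<^bsub>M\<^esub> f x) S"
  using assms(1,3)
proof (induction S)
  case (insert x S)
  then have "f \<in> S \<rightarrow> carrier M" "f x \<in> carrier M" by auto
  with insert assms(2) show ?case
    by (simp add: M.finsum_insert smult_r_distr Pi_iff)
qed (use assms(2) in simp)

text \<open>Restriction of scalars to a subring of the same type. It turns modules of level
  \<open>r\<close> of a tower into modules over the ring of a higher level.\<close>

lemma lmodule_restrict:
  assumes "lmodule S N" "id \<in> ring_hom R S" "ring R"
  shows "lmodule R N"
proof -
  interpret lmodule S N by fact
  have "\<one>\<^bsub>R\<^esub> = \<one>\<^bsub>S\<^esub>" using ring_hom_one[OF assms(2)] by simp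
  moreover have "a \<in> carrier S" if "a \<in> carrier R" for a
    using ring_hom_closed[OF assms(2) that] by simp
  moreover have "a \<oplus>\<^bsub>R\<^esub> b = a \<oplus>\<^bsub>S\<^esub> b" "a \<otimes>\<^bsub>R\<^esub> b = a \<otimes>\<^bsub>S\<^esub> b" if "a \<in> carrier R" "b \<in> carrier R" for a b
    using ring_hom_add[OF assms(2) that] ring_hom_mult[OF assms(2) that] by simp_all
  ultimately show ?thesis
    using assms(3) M.abelian_group_axioms
    by (intro lmodule.intro lmodule_axioms.intro) (simp_all add: smult_l_distr smult_r_distr smult_assoc)
qed

lemma id_ring_hom_zero:
  assumes "id \<in> ring_hom R S" "ring R" "ring S"
  shows "\<zero>\<^bsub>S\<^esub> = \<zero>\<^bsub>R\<^esub>"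
proof -
  interpret ring_hom_ring R S id using assms by (intro ring_hom_ringI2)
  show ?thesis using hom_zero by simp
qed

lemma self_lmodule:
  assumes "ring R"
  shows "lmodule R (action_module R (carrier R) (monoid.mult R))"
proof -
  interpret ring R by fact
  show ?thesis
    by (intro lmodule.intro lmodule_axioms.intro abelian_groupI)
      (auto simp: a_ac l_distr r_distr m_assoc ring_axioms intro: bexI[of _ "\<ominus>\<^bsub>R\<^esub> x" for x] l_neg)
qed

section \<open>Free modules: bases, linear combinations and projectivity\<close>

context ring
begin

lemma carrier_additive_subgroup: "additive_subgroup (carrier R) R"
  using add.subgroup_self by (rule additive_subgroup.intro)

lemma free_lmodule: "lmodule R (free_module R X)"
  unfolding free_module_eq[OF ring_axioms]
  by (rule coeff_lmodule[OF ring_axioms carrier_additive_subgroup self_lmodule[OF ring_axioms]])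

lemma free_abelian_group: "abelian_group (free_module R X)"
  by (rule lmodule.axioms(2)[OF free_lmodule])

lemma single_closed: "a \<in> carrier R \<Longrightarrow> x \<in> X \<Longrightarrow> single R a x \<in> carrier (free_module R X)"
  unfolding free_module_eq[OF ring_axioms]
  by (rule coeff_single[OF ring_axioms carrier_additive_subgroup])

lemma basis_closed: "x \<in> X \<Longrightarrow> basis_vector R x \<in> carrier (free_module R X)"
  by (simp add: basis_vector_eq single_closed)

lemma single_smult:
  assumes "a \<in> carrier R" shows "single R a x = a \<odot>\<^bsub>free_module R X\<^esub> basis_vector R x"
  using assms by (auto simp: single_def basis_vector_def free_module_def)

lemma free_ops [simp]:
  "\<zero>\<^bsub>free_module R X\<^esub> = (\<lambda>_. \<zero>)"
  "v \<oplus>\<^bsub>free_module R X\<^esub> w = (\<lambda>x. v x \<oplus> w x)"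
  "a \<odot>\<^bsub>free_module R X\<^esub> v = (\<lambda>x. a \<otimes> v x)"
  by (simp_all add: free_module_def)

lemma free_linear_eqI:
  assumes "linear_on (carrier R) (free_module R X) N f" "linear_on (carrier R) (free_module R X) N g"
    and "abelian_group N" and eq: "\<And>x. x \<in> X \<Longrightarrow> f (basis_vector R x) = g (basis_vector R x)"
    and "v \<in> carrier (free_module R X)"
  shows "f v = g v"
proof -
  have "f (single R a x) = g (single R a x)" if "a \<in> carrier R" "x \<in> X" for a x
    using that linear_on_smult[OF assms(1), of a "basis_vector R x"]
      linear_on_smult[OF assms(2), of a "basis_vector R x"] eq
    by (simp add: single_smult[of _ _ X] basis_closed del: free_ops)
  then show ?thesis
    using coeff_eqI[OF ring_axioms carrier_additive_subgroup, of X "(\<otimes>)" N f g v] assms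
      linear_on_subset[OF assms(1)] linear_on_subset[OF assms(2)] free_abelian_group[of X]
    by (simp add: free_module_eq[OF ring_axioms])
qed

lemma
  assumes N: "lmodule R N" and u: "\<And>x. x \<in> X \<Longrightarrow> u x \<in> carrier N"
  shows free_lift_linear: "linear_on (carrier R) (free_module R X) N (free_lift R id N u)"
    and free_lift_basis: "x \<in> X \<Longrightarrow> free_lift R id N u (basis_vector R x) = u x"
proof -
  interpret N: lmodule R N by fact
  \<comment> \<open>The sum may run over any finite set that contains the support; for additivity
    the sums of \<open>v\<close>, \<open>w\<close> and \<open>v + w\<close> need a common index
    set.\<close>
  have ext: "free_lift R id N u v = (\<Oplus>\<^bsub>N\<^esub>x\<in>S. v x \<odot>\<^bsub>N\<^esub> u x)"
    if "v \<in> carrier (free_module R X)" "finite S" "{x. v x \<noteq> \<zero>} \<subseteq> S" "S \<subseteq> X" for v S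
    unfolding free_lift_def id_apply
    using that u
    by (intro N.M.add.finprod_mono_neutral_cong_left) (auto simp: free_module_def subset_iff)
  have supp: "finite {x. v x \<noteq> \<zero>}" "{x. v x \<noteq> \<zero>} \<subseteq> X" if "v \<in> carrier (free_module R X)" for v
    using that by (auto simp: free_module_def)
  have val: "v x \<in> carrier R" if "v \<in> carrier (free_module R X)" for v x
    using that by (auto simp: free_module_eq[OF ring_axioms] coeff_module_carrier)
  interpret F: lmodule R "free_module R X" by (rule free_lmodule)
  show "linear_on (carrier R) (free_module R X) N (free_lift R id N u)"
  proof (rule linear_onI)
    fix v assume v: "v \<in> carrier (free_module R X)"
    show "free_lift R id N u v \<in> carrier N"
      unfolding ext[OF v supp(1)[OF v] order.refl supp(2)[OF v]]
      using v supp(2)[OF v] u val by (intro N.M.finsum_closed) auto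
  next
    fix v w assume v: "v \<in> carrier (free_module R X)" and w: "w \<in> carrier (free_module R X)"
    let ?S = "{x. v x \<noteq> \<zero>} \<union> {x. w x \<noteq> \<zero>}"
    have S: "finite ?S" "?S \<subseteq> X" using supp[OF v] supp[OF w] by auto
    have vw: "v \<oplus>\<^bsub>free_module R X\<^esub> w \<in> carrier (free_module R X)" using v w F.M.a_closed by blast
    have "free_lift R id N u (v \<oplus>\<^bsub>free_module R X\<^esub> w) =
      (\<Oplus>\<^bsub>N\<^esub>x\<in>?S. v x \<odot>\<^bsub>N\<^esub> u x \<oplus>\<^bsub>N\<^esub> w x \<odot>\<^bsub>N\<^esub> u x)"
      unfolding ext[OF vw S(1) _ S(2), simplified] using S(2) val[OF v] val[OF w] u
      by (subst ext[OF vw S(1) _ S(2)]) (auto intro!: N.M.finsum_cong' simp: N.smult_l_distr)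
    also have "\<dots> = free_lift R id N u v \<oplus>\<^bsub>N\<^esub> free_lift R id N u w"
      using S val[OF v] val[OF w] u
      by (subst N.M.finsum_addf) (auto simp: ext[OF v S(1) _ S(2)] ext[OF w S(1) _ S(2)])
    finally show "free_lift R id N u (v \<oplus>\<^bsub>free_module R X\<^esub> w) =
      free_lift R id N u v \<oplus>\<^bsub>N\<^esub> free_lift R id N u w" .
  next
    fix a v assume a: "a \<in> carrier R" and v: "v \<in> carrier (free_module R X)"
    let ?S = "{x. v x \<noteq> \<zero>}"
    have av: "a \<odot>\<^bsub>free_module R X\<^esub> v \<in> carrier (free_module R X)" using a v by (simp del: free_ops)
    have "free_lift R id N u (a \<odot>\<^bsub>free_module R X\<^esub> v) = (\<Oplus>\<^bsub>N\<^esub>x\<in>?S. a \<odot>\<^bsub>N\<^esub> (v x \<odot>\<^bsub>N\<^esub> u x))"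
      using a supp[OF v] val[OF v] u
      by (subst ext[OF av supp(1)[OF v] _ supp(2)[OF v]])
        (auto intro!: N.M.finsum_cong' simp: N.smult_assoc subset_iff)
    also have "\<dots> = a \<odot>\<^bsub>N\<^esub> free_lift R id N u v"
      using a supp[OF v] val[OF v] u
      by (subst ext[OF v supp(1)[OF v] order.refl supp(2)[OF v]], subst N.finsum_smult) auto
    finally show "free_lift R id N u (a \<odot>\<^bsub>free_module R X\<^esub> v) = a \<odot>\<^bsub>N\<^esub> free_lift R id N u v" .
  qed
  assume x: "x \<in> X"
  show "free_lift R id N u (basis_vector R x) = u x"
    using u[OF x] x by (subst ext[OF basis_closed[OF x], of "{x}"]) (auto simp: basis_vector_def N.M.finsum_singleton)
qed

lemma lin_comb_Cons:
  assumes "fst p \<in> carrier R" "lin_comb R l \<in> carrier (free_module R X)"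
  shows "lin_comb R (p # l) = single R (fst p) (snd p) \<oplus>\<^bsub>free_module R X\<^esub> lin_comb R l"
proof -
  have "lin_comb R l x \<in> carrier R" for x
    using assms(2) by (auto simp: free_module_eq[OF ring_axioms] coeff_module_carrier)
  then show ?thesis using assms(1) by (auto simp: single_def fun_eq_iff)
qed

lemma lin_comb_closed:
  assumes "set l \<subseteq> carrier R \<times> X"
  shows "lin_comb R l \<in> carrier (free_module R X)"
  using assms
proof (induction l)
  case Nil
  then show ?case by (auto simp: free_module_def)
next
  case (Cons p l)
  interpret F: lmodule R "free_module R X" by (rule free_lmodule)
  have "lin_comb R l \<in> carrier (free_module R X)" "fst p \<in> carrier R" "snd p \<in> X" using Cons by auto
  then show ?case
    using lin_comb_Cons single_closed F.M.a_closed by metis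
qed

text \<open>Each single-entry summand becomes one more pair of the list. Because of this, cells
  built from lists are enough to generate every kernel.\<close>

lemma lin_comb_exists:
  assumes "v \<in> carrier (free_module R X)"
  shows "\<exists>l. set l \<subseteq> carrier R \<times> X \<and> lin_comb R l = v"
proof (rule coeff_induct[OF ring_axioms carrier_additive_subgroup,
      of v X "(\<otimes>)" "\<lambda>v. \<exists>l. set l \<subseteq> carrier R \<times> X \<and> lin_comb R l = v"])
  show "v \<in> carrier (coeff_module R X (carrier R) (\<otimes>))"
    using assms by (simp add: free_module_eq[OF ring_axioms])
  show "\<exists>l. set l \<subseteq> carrier R \<times> X \<and> lin_comb R l = (\<lambda>_. \<zero>)" by (intro exI[of _ "[]"]) simp
  fix a x w assume *: "a \<in> carrier R" "x \<in> X" "\<exists>l. set l \<subseteq> carrier R \<times> X \<and> lin_comb R l = w"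
  then obtain l where l: "set l \<subseteq> carrier R \<times> X" "lin_comb R l = w" by blast
  then have "lin_comb R ((a, x) # l) = (\<lambda>y. single R a x y \<oplus> w y)"
    using lin_comb_Cons[of "(a, x)" l X] lin_comb_closed[OF l(1)] * by (simp del: lin_comb.simps)
  then show "\<exists>l. set l \<subseteq> carrier R \<times> X \<and> lin_comb R l = (\<lambda>y. single R a x y \<oplus> w y)"
    using l(1) * by (intro exI[of _ "(a, x) # l"]) (simp del: lin_comb.simps)
qed

lemma free_extend:
  assumes "lmodule R N" and "\<And>x. x \<in> X \<Longrightarrow> \<exists>y\<in>carrier N. P x y"
  shows "\<exists>g. linear_on (carrier R) (free_module R X) N g \<and> (\<forall>x\<in>X. P x (g (basis_vector R x)))"
proof -
  obtain u where "\<forall>x\<in>X. u x \<in> carrier N \<and> P x (u x)" using assms(2) by metis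
  then show ?thesis
    using free_lift_linear[OF assms(1), of X u] free_lift_basis[OF assms(1), of X u]
    by (intro exI[of _ "free_lift R id N u"]) auto
qed

text \<open>Preimages are required for the images of basis vectors only, because in the applications
  \<open>d\<close> is a differential and reaches just the cycles. They are chosen there and extended
  linearly.\<close>

lemma free_projective:
  assumes N: "lmodule R N" "abelian_group N'" and d: "linear_on (carrier R) N N' d"
    and f: "linear_on (carrier R) (free_module R X) N' f"
    and ex: "\<And>x. x \<in> X \<Longrightarrow> \<exists>y\<in>carrier N. d y = f (basis_vector R x)"
  shows "\<exists>g. linear_on (carrier R) (free_module R X) N g \<and> (\<forall>v\<in>carrier (free_module R X). d (g v) = f v)"
proof -
  obtain g where g: "linear_on (carrier R) (free_module R X) N g"
    and gx: "\<And>x. x \<in> X \<Longrightarrow> d (g (basis_vector R x)) = f (basis_vector R x)"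
    using free_extend[OF N(1), of X "\<lambda>x y. d y = f (basis_vector R x)"] ex by blast
  have "d (g v) = f v" if "v \<in> carrier (free_module R X)" for v
    using free_linear_eqI[OF linear_on_compose[OF g d] f N(2) gx that] .
  then show ?thesis using g by blast
qed

end

section \<open>The standard resolution\<close>

text \<open>The augmentation takes the place of the differential in degree 0. With this convention
  the next basis is described uniformly by \<open>res_basis_Suc\<close>, although
  \<open>res_basis\<close> has three clauses.\<close>

primrec res_cycle ::
  "('r, 'y) ring_scheme \<Rightarrow> ('r, 'm) module \<Rightarrow> nat \<Rightarrow> (('r, 'm) cell \<Rightarrow> 'r) \<Rightarrow> bool" where
  "res_cycle R N 0 v \<longleftrightarrow> free_lift R id N gen_elem v = \<zero>\<^bsub>N\<^esub>"
| "res_cycle R N (Suc n) v \<longleftrightarrow> res_diff R N n v = (\<lambda>_. \<zero>\<^bsub>R\<^esub>)"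

lemma res_basis_Suc:
  "res_basis R N (Suc n) =
    {Syz l | l. set l \<subseteq> carrier R \<times> res_basis R N n \<and> res_cycle R N n (lin_comb R l)}"
  by (cases n) (simp_all add: syzygies_def res_diff_def res_def free_module_def)

lemma zero_res: "\<zero>\<^bsub>res R N n\<^esub> = (\<lambda>_. \<zero>\<^bsub>R\<^esub>)"
  by (simp add: res_def free_module_def)

context lmodule
begin

lemma res_lmodule: "lmodule R (res R M n)"
  unfolding res_def by (rule R.free_lmodule)

lemma res_abelian_group: "abelian_group (res R M n)"
  by (rule lmodule.axioms(2)[OF res_lmodule])

lemmas res_zero [simp] = zero_res

lemma basis_in_res: "x \<in> res_basis R M n \<Longrightarrow> basis_vector R x \<in> carrier (res R M n)"
  unfolding res_def by (rule R.basis_closed)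

lemma res_augmentation_linear: "linear_on (carrier R) (res R M 0) M (free_lift R id M gen_elem)"
  unfolding res_def by (rule R.free_lift_linear[OF lmodule_axioms]) auto

lemma res_augmentation_basis:
  "q \<in> carrier M \<Longrightarrow> free_lift R id M gen_elem (basis_vector R (Gen q :: ('r, 'm) cell)) = q"
proof -
  assume q: "q \<in> carrier M"
  have "free_lift R id M gen_elem (basis_vector R (Gen q :: ('r, 'm) cell)) = gen_elem (Gen q :: ('r, 'm) cell)"
    by (rule R.free_lift_basis[OF lmodule_axioms, where X = "res_basis R M 0"]) (use q in auto)
  then show ?thesis by simp
qed

lemma lin_comb_in_res: "set l \<subseteq> carrier R \<times> res_basis R M n \<Longrightarrow> lin_comb R l \<in> carrier (res R M n)"
  unfolding res_def by (rule R.lin_comb_closed)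

lemma res_diff_linear: "linear_on (carrier R) (res R M (Suc n)) (res R M n) (res_diff R M n)"
  unfolding res_diff_def res_def[of R M "Suc n"]
  by (rule R.free_lift_linear[OF res_lmodule]) (auto simp only: res_basis_Suc cell.sel intro: lin_comb_in_res)

lemma res_diff_basis:
  "x \<in> res_basis R M (Suc n) \<Longrightarrow> res_diff R M n (basis_vector R x) = lin_comb R (syz_list x)"
  unfolding res_diff_def
  by (rule R.free_lift_basis[OF res_lmodule, of "res_basis R M (Suc n)"])
    (auto simp only: res_basis_Suc cell.sel intro: lin_comb_in_res)

text \<open>Exactness holds by construction: a list \<open>l\<close> that expresses the cycle
  \<open>v\<close> yields a generator \<open>Syz l\<close>, whose differential is
  \<open>v\<close>.\<close>

lemma res_exact:
  assumes "v \<in> carrier (res R M n)" "res_cycle R M n v"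
  shows "\<exists>w\<in>carrier (res R M (Suc n)). res_diff R M n w = v"
proof -
  obtain l where l: "set l \<subseteq> carrier R \<times> res_basis R M n" "lin_comb R l = v"
    using R.lin_comb_exists[of v "res_basis R M n"] assms(1) by (auto simp: res_def)
  then have "Syz l \<in> res_basis R M (Suc n)" using assms(2) by (auto simp: res_basis_Suc simp del: res_basis.simps)
  then show ?thesis
    using l(2) res_diff_basis basis_in_res by (intro bexI[of _ "basis_vector R (Syz l)"]) auto
qed

text \<open>On a generator \<open>Syz l\<close> the differential gives \<open>lin_comb R l\<close>,
  a cycle by the membership condition of the basis; linearity does the rest. The two cases are those
  of \<open>res_cycle\<close>.\<close>

lemma res_cycle_diff:
  assumes "w \<in> carrier (res R M (Suc n))"
  shows "res_cycle R M n (res_diff R M n w)"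
proof (cases n)
  case 0
  have "linear_on (carrier R) (free_module R (res_basis R M 1)) M
    (\<lambda>w. free_lift R id M gen_elem (res_diff R M 0 w))"
    using linear_on_compose[OF res_diff_linear[of 0] res_augmentation_linear] by (simp add: res_def)
  moreover have "linear_on (carrier R) (free_module R (res_basis R M 1)) M (\<lambda>_. \<zero>\<^bsub>M\<^esub>)"
    by (intro linear_onI) auto
  ultimately have "free_lift R id M gen_elem (res_diff R M 0 w) = \<zero>\<^bsub>M\<^esub>"
  proof (rule R.free_linear_eqI)
    show "abelian_group M" by (rule M.abelian_group_axioms)
    show "w \<in> carrier (free_module R (res_basis R M 1))" using assms 0 by (simp add: res_def)
    fix x assume "x \<in> res_basis R M 1"
    then show "free_lift R id M gen_elem (res_diff R M 0 (basis_vector R x)) = \<zero>\<^bsub>M\<^esub>"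
      using res_diff_basis[of x 0] res_basis_Suc[of R M 0] by (auto simp del: res_basis.simps)
  qed
  with 0 show ?thesis by simp
next
  case (Suc m)
  have "linear_on (carrier R) (free_module R (res_basis R M (Suc n))) (res R M m)
    (\<lambda>w. res_diff R M m (res_diff R M n w))"
    using linear_on_compose[OF res_diff_linear res_diff_linear, of m] Suc by (simp add: res_def)
  moreover have "linear_on (carrier R) (free_module R (res_basis R M (Suc n))) (res R M m) (\<lambda>_. \<zero>\<^bsub>res R M m\<^esub>)"
  proof -
    interpret P: lmodule R "res R M m" by (rule res_lmodule)
    show ?thesis by (intro linear_onI) (auto simp del: res_zero)
  qed
  ultimately have "res_diff R M m (res_diff R M n w) = \<zero>\<^bsub>res R M m\<^esub>"
  proof (rule R.free_linear_eqI)
    show "abelian_group (res R M m)" by (rule res_abelian_group)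
    show "w \<in> carrier (free_module R (res_basis R M (Suc n)))" using assms by (simp add: res_def)
    fix x assume "x \<in> res_basis R M (Suc n)"
    then show "res_diff R M m (res_diff R M n (basis_vector R x)) = \<zero>\<^bsub>res R M m\<^esub>"
      using res_diff_basis[of x n] res_basis_Suc[of R M n] Suc by (auto simp del: res_basis.simps)
  qed
  with Suc show ?thesis by simp
qed

lemma res_projective:
  assumes "lmodule R N" "abelian_group N'" "linear_on (carrier R) N N' d"
    and "linear_on (carrier R) (res R M n) N' f"
    and "\<And>x. x \<in> res_basis R M n \<Longrightarrow> \<exists>y\<in>carrier N. d y = f (basis_vector R x)"
  shows "\<exists>g. linear_on (carrier R) (res R M n) N g \<and> (\<forall>v\<in>carrier (res R M n). d (g v) = f v)"
  using R.free_projective[OF assms(1-3), of "res_basis R M n" f] assms(4,5) by (simp add: res_def)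

end

section \<open>Functoriality of the standard resolution\<close>

locale semilinear_pair = source: lmodule R N + target: lmodule S N'
  for R :: "('r, 'y) ring_scheme" and N :: "('r, 'm) module"
    and S :: "('r, 'z) ring_scheme" and N' :: "('r, 'n) module" +
  fixes g :: "'m \<Rightarrow> 'n"
  assumes incl: "id \<in> ring_hom R S"
    and g_linear: "linear_on (carrier R) N N' g"
begin

abbreviation cmap where "cmap \<equiv> cell_map id g"
abbreviation rmap where "rmap \<equiv> res_map R S N' id g"

lemma carrier_incl: "a \<in> carrier R \<Longrightarrow> a \<in> carrier S"
  using ring_hom_closed[OF incl] by simp

text \<open>The ring homomorphism is the identity function of a common type, so a semilinear map is
  an \<open>R\<close>-linear map into a module with restricted scalars. This brings
  \<open>res_map\<close> under the lemmas on \<open>free_lift R id\<close>.\<close>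

lemma target_res_lmodule: "lmodule R (res S N' n)"
  by (rule lmodule_restrict[OF target.res_lmodule incl source.R.ring_axioms])

lemma target_aug_linear: "linear_on (carrier R) (res S N' 0) N' (free_lift S id N' gen_elem)"
  by (rule linear_on_subset[OF target.res_augmentation_linear]) (auto intro: carrier_incl)

lemma target_diff_linear: "linear_on (carrier R) (res S N' (Suc n)) (res S N' n) (res_diff S N' n)"
  by (rule linear_on_subset[OF target.res_diff_linear]) (auto intro: carrier_incl)

text \<open>Facts about a single degree, under the hypothesis that \<open>cmap\<close> preserves the
  bases in that degree. The hypothesis cannot be settled beforehand, since in the next degree it
  depends on these facts.\<close>

context
  fixes n
  assumes basis: "\<And>x. x \<in> res_basis R N n \<Longrightarrow> cmap x \<in> res_basis S N' n"
begin

lemma rmap_linear': "linear_on (carrier R) (res R N n) (res S N' n) (rmap n)"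
  unfolding res_map_def res_def[of R]
  by (rule source.R.free_lift_linear[OF target_res_lmodule]) (rule target.basis_in_res[OF basis])

lemma rmap_basis': "x \<in> res_basis R N n \<Longrightarrow> rmap n (basis_vector R x) = basis_vector S (cmap x)"
  unfolding res_map_def
  by (rule source.R.free_lift_basis[OF target_res_lmodule]) (rule target.basis_in_res[OF basis])

lemma rmap_lin_comb':
  assumes "set l \<subseteq> carrier R \<times> res_basis R N n"
  shows "rmap n (lin_comb R l) = lin_comb S (map (map_prod id cmap) l)"
  using assms
proof (induction l)
  case Nil
  then show ?case
    using linear_on_zero[OF rmap_linear' source.res_abelian_group target.res_abelian_group]
    by (simp only: list.map lin_comb.simps source.res_zero target.res_zero)
next
  case (Cons p l)
  let ?F = "free_module R (res_basis R N n)" and ?F' = "free_module S (res_basis S N' n)"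
  obtain a x where p: "p = (a, x)" by (cases p)
  have ax: "a \<in> carrier R" "x \<in> res_basis R N n" using Cons.prems p by auto
  have l: "lin_comb R l \<in> carrier ?F" using Cons.prems by (intro source.R.lin_comb_closed) auto
  have l': "lin_comb S (map (map_prod id cmap) l) \<in> carrier ?F'"
    using Cons.prems basis by (intro target.R.lin_comb_closed) (force intro: carrier_incl)
  have "rmap n (single R a x) = single S a (cmap x)"
    using linear_on_smult[OF rmap_linear', of a "basis_vector R x"] ax rmap_basis'
      source.basis_in_res[OF ax(2)] carrier_incl
    unfolding source.R.single_smult[OF ax(1), of x "res_basis R N n"]
      target.R.single_smult[OF carrier_incl[OF ax(1)], of "cmap x" "res_basis S N' n"]
    by (simp add: res_def del: source.R.free_ops target.R.free_ops)
  then have "rmap n (lin_comb R (p # l)) = single S a (cmap x) \<oplus>\<^bsub>?F'\<^esub> lin_comb S (map (map_prod id cmap) l)"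
    using linear_on_add[OF rmap_linear', of "single R a x" "lin_comb R l"] source.R.lin_comb_Cons[of p l] l p ax
      Cons source.R.single_closed[OF ax]
    by (simp add: res_def del: source.R.free_ops target.R.free_ops lin_comb.simps add: id_def)
  also have "\<dots> = lin_comb S (map (map_prod id cmap) (p # l))"
    using target.R.lin_comb_Cons[OF _ l', of "(a, cmap x)"] ax carrier_incl p
    by (simp del: target.R.free_ops lin_comb.simps)
  finally show ?case .
qed

end

text \<open>The three claims need each other. \<open>Syz l\<close> goes to a basis cell only if the
  mapped list still expresses a cycle, which is \<open>rmap_cycle\<close> one degree lower; and in
  positive degrees \<open>rmap_cycle\<close> rests on the commutation of the lift with the
  differential.\<close>

lemma cell_map_basis: "x \<in> res_basis R N n \<Longrightarrow> cmap x \<in> res_basis S N' n"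
  and rmap_cycle: "v \<in> carrier (res R N n) \<Longrightarrow> res_cycle R N n v \<Longrightarrow> res_cycle S N' n (rmap n v)"
  and rmap_diff': "n = Suc m \<Longrightarrow> v \<in> carrier (res R N n) \<Longrightarrow>
    res_diff S N' m (rmap n v) = rmap m (res_diff R N m v)"
proof (induction n arbitrary: x v m)
  case 0
  have b: "cmap x \<in> res_basis S N' 0" if "x \<in> res_basis R N 0" for x
    using that linear_on_closed[OF g_linear] by auto
  {
    case 1
    then show ?case by (rule b)
  next
    case 2
    have "free_lift S id N' gen_elem (rmap 0 v) = g (free_lift R id N gen_elem v)"
    proof (rule source.R.free_linear_eqI[where f = "\<lambda>v. free_lift S id N' gen_elem (rmap 0 v)"
          and g = "\<lambda>v. g (free_lift R id N gen_elem v)"])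
      show "linear_on (carrier R) (free_module R (res_basis R N 0)) N'
          (\<lambda>v. free_lift S id N' gen_elem (rmap 0 v))"
        using linear_on_compose[OF rmap_linear'[OF b] target_aug_linear] by (simp add: res_def)
      show "linear_on (carrier R) (free_module R (res_basis R N 0)) N'
          (\<lambda>v. g (free_lift R id N gen_elem v))"
        using linear_on_compose[OF source.res_augmentation_linear g_linear] by (simp add: res_def)
      show "abelian_group N'" by (rule target.M.abelian_group_axioms)
      show "v \<in> carrier (free_module R (res_basis R N 0))" using 2 by (simp add: res_def)
      fix x assume "x \<in> res_basis R N 0"
      then show "free_lift S id N' gen_elem (rmap 0 (basis_vector R x)) =
          g (free_lift R id N gen_elem (basis_vector R x))"
        using rmap_basis'[OF b, of x] linear_on_closed[OF g_linear]
        by (auto simp: source.res_augmentation_basis target.res_augmentation_basis)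
    qed
    then show ?case
      using 2 linear_on_zero[OF g_linear source.M.abelian_group_axioms target.M.abelian_group_axioms]
      by (simp add: id_def)
  next
    case 3
    then show ?case by simp
  }
next
  case (Suc n)
  have b: "cmap x \<in> res_basis S N' (Suc n)" if x: "x \<in> res_basis R N (Suc n)" for x
  proof -
    obtain l where l: "x = Syz l" "set l \<subseteq> carrier R \<times> res_basis R N n" "res_cycle R N n (lin_comb R l)"
      using x unfolding res_basis_Suc by blast
    have "res_cycle S N' n (lin_comb S (map (map_prod id cmap) l))"
      using Suc.IH(2)[OF _ l(3)] source.lin_comb_in_res[OF l(2)] rmap_lin_comb'[OF Suc.IH(1) l(2)]
      by (simp add: id_def)
    moreover have "set (map (map_prod id cmap) l) \<subseteq> carrier S \<times> res_basis S N' n"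
    proof -
      have "map_prod id cmap p \<in> carrier S \<times> res_basis S N' n" if "p \<in> set l" for p
        using l(2) that Suc.IH(1)[of "snd p"] carrier_incl[of "fst p"] by (cases p) (auto simp: id_def)
      then show ?thesis by auto
    qed
    ultimately show ?thesis
      using l(1) by (auto simp: res_basis_Suc simp del: res_basis.simps)
  qed
  have d: "res_diff S N' n (rmap (Suc n) v) = rmap n (res_diff R N n v)"
    if "v \<in> carrier (res R N (Suc n))" for v
  proof (rule source.R.free_linear_eqI[where f = "\<lambda>v. res_diff S N' n (rmap (Suc n) v)"
        and g = "\<lambda>v. rmap n (res_diff R N n v)"])
    show "linear_on (carrier R) (free_module R (res_basis R N (Suc n))) (res S N' n)
        (\<lambda>v. res_diff S N' n (rmap (Suc n) v))"
      using linear_on_compose[OF rmap_linear'[OF b] target_diff_linear] by (simp add: res_def)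
    show "linear_on (carrier R) (free_module R (res_basis R N (Suc n))) (res S N' n)
        (\<lambda>v. rmap n (res_diff R N n v))"
      using linear_on_compose[OF source.res_diff_linear rmap_linear'[OF Suc.IH(1)]] by (simp add: res_def)
    show "abelian_group (res S N' n)" by (rule target.res_abelian_group)
    show "v \<in> carrier (free_module R (res_basis R N (Suc n)))" using that by (simp add: res_def)
    fix x assume x: "x \<in> res_basis R N (Suc n)"
    then obtain l where l: "x = Syz l" "set l \<subseteq> carrier R \<times> res_basis R N n"
      unfolding res_basis_Suc by blast
    show "res_diff S N' n (rmap (Suc n) (basis_vector R x)) = rmap n (res_diff R N n (basis_vector R x))"
      using rmap_basis'[OF b x] target.res_diff_basis[OF b[OF x]] source.res_diff_basis[OF x]
        rmap_lin_comb'[OF Suc.IH(1) l(2)] l(1) by simp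
  qed
  {
    case 1
    then show ?case by (rule b)
  next
    case 2
    then show ?case
      using d[of v] linear_on_zero[OF rmap_linear'[OF Suc.IH(1)] source.res_abelian_group target.res_abelian_group]
      by (simp add: id_def)
  next
    case 3
    then show ?case using d by (simp add: id_def)
  }
qed

lemma rmap_linear: "linear_on (carrier R) (res R N n) (res S N' n) (rmap n)"
  by (rule rmap_linear') (rule cell_map_basis)

lemma rmap_basis: "x \<in> res_basis R N n \<Longrightarrow> rmap n (basis_vector R x) = basis_vector S (cmap x)"
  by (rule rmap_basis') (rule cell_map_basis)

lemma rmap_diff:
  "v \<in> carrier (res R N (Suc n)) \<Longrightarrow> res_diff S N' n (rmap (Suc n) v) = rmap n (res_diff R N n v)"
  by (rule rmap_diff') simp_all

end

section \<open>Towers of rings\<close>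

lemma coeff_module_carrier_eq:
  "carrier (coeff_module R X J \<rho>) = carrier (coeff_module R X J \<rho>')"
  by (simp add: coeff_module_def)

text \<open>In coordinates \<open>g\<close> is right multiplication by a matrix: the image of
  \<open>a e_x\<close> has entries \<open>a\<close> times elements of \<open>R'\<close>, and these
  stay in the ideal \<open>K'\<close>, which contains \<open>a\<close>.\<close>

lemma linear_maps_coeff:
  assumes g: "linear_on (carrier R) (free_module R Y) (free_module R' Z) g"
    and ring: "ring R" "ring R'"
    and K: "additive_subgroup K R" and K': "ideal K' R'" and sub: "K \<subseteq> K'"
    and v: "v \<in> carrier (coeff_module R Y K \<rho>)"
  shows "g v \<in> carrier (coeff_module R' Z K' \<rho>')"
proof -
  interpret s: ring R by fact
  interpret r: ring R' by fact
  interpret K: additive_subgroup K R by fact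
  interpret K': ideal K' R' by fact
  note zero = linear_on_zero[OF g s.free_abelian_group r.free_abelian_group]
  show ?thesis
  proof (rule coeff_induct[OF s.ring_axioms K v, where P = "\<lambda>v. g v \<in> _"])
    show "g (\<lambda>_. \<zero>\<^bsub>R\<^esub>) \<in> carrier (coeff_module R' Z K' \<rho>')"
      using zero by (simp add: coeff_module_carrier)
    fix a x w
    assume a: "a \<in> K" and x: "x \<in> Y" and w: "w \<in> carrier (coeff_module R Y K \<rho>)"
      and gw: "g w \<in> carrier (coeff_module R' Z K' \<rho>')"
    have aR: "a \<in> carrier R" using a by simp
    have aK: "a \<in> K'" using a sub by blast
    have b: "basis_vector R x \<in> carrier (free_module R Y)" by (rule s.basis_closed[OF x])
    have gb: "g (basis_vector R x) \<in> carrier (free_module R' Z)" by (rule linear_on_closed[OF g b])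
    have "g (single R a x) = (\<lambda>z. a \<otimes>\<^bsub>R'\<^esub> g (basis_vector R x) z)"
      using linear_on_smult[OF g aR b] s.single_smult[OF aR, of x Y] by simp
    moreover have "(\<lambda>z. a \<otimes>\<^bsub>R'\<^esub> g (basis_vector R x) z) \<in> carrier (coeff_module R' Z K' \<rho>')"
    proof -
      have "{z. a \<otimes>\<^bsub>R'\<^esub> g (basis_vector R x) z \<noteq> \<zero>\<^bsub>R'\<^esub>} \<subseteq> {z. g (basis_vector R x) z \<noteq> \<zero>\<^bsub>R'\<^esub>}"
        using aK by auto
      then show ?thesis
        using gb K'.I_r_closed[OF aK] K'.a_Hcarr[OF aK] finite_subset
        unfolding free_module_eq[OF r.ring_axioms] by (auto simp: coeff_module_carrier)
    qed
    ultimately have ga: "g (single R a x) \<in> carrier (coeff_module R' Z K' \<rho>')" by simp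
    have "w \<in> carrier (free_module R Y)"
      using w unfolding free_module_eq[OF s.ring_axioms] by (simp add: coeff_module_carrier)
    then have "g (\<lambda>y. single R a x y \<oplus>\<^bsub>R\<^esub> w y) = (\<lambda>z. g (single R a x) z \<oplus>\<^bsub>R'\<^esub> g w z)"
      using linear_on_add[OF g, of "single R a x" w] s.single_closed[OF aR x] by simp
    then show "g (\<lambda>y. single R a x y \<oplus>\<^bsub>R\<^esub> w y) \<in> carrier (coeff_module R' Z K' \<rho>')"
      using coeff_add[OF r.ring_axioms K'.additive_subgroup_axioms ga gw] by simp
  qed
qed

lemma ideal_lmodule:
  assumes "ideal K R"
  shows "lmodule R (action_module R K (monoid.mult R))"
proof -
  interpret ideal K R by fact
  show ?thesis
  proof (intro lmodule.intro lmodule_axioms.intro abelian_groupI, goal_cases)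
    case (7 x)
    then show ?case by (intro bexI[of _ "\<ominus>\<^bsub>R\<^esub> x"]) (auto simp: l_neg)
  qed (auto simp: a_ac l_distr r_distr m_assoc ring_axioms I_l_closed I_r_closed)
qed

text \<open>Two families are instances: the constant ring \<open>A\<close> with quotients
  \<open>A/I^r\<close>, and \<open>k \<ltimes> I^r\<close> with constant quotient \<open>k\<close>.
  Levels start at 1, as the zeroth power of an ideal is the whole ring, where towers over two rings
  no longer have the same kernel.\<close>

locale tower =
  fixes A :: "nat \<Rightarrow> ('a, 'y) ring_scheme" and Q :: "nat \<Rightarrow> ('q, 'z) ring_scheme"
    and \<pi> :: "nat \<Rightarrow> 'a \<Rightarrow> 'q" and p :: "nat \<Rightarrow> 'q \<Rightarrow> 'q"
  assumes ring_A: "1 \<le> r \<Longrightarrow> ring (A r)"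
    and ring_Q: "1 \<le> r \<Longrightarrow> ring (Q r)"
    and proj_hom: "1 \<le> r \<Longrightarrow> \<pi> r \<in> ring_hom (A r) (Q r)"
    and proj_surj: "1 \<le> r \<Longrightarrow> \<pi> r ` carrier (A r) = carrier (Q r)"
    and incl_hom: "1 \<le> r \<Longrightarrow> r \<le> s \<Longrightarrow> id \<in> ring_hom (A s) (A r)"
    and trans_hom: "1 \<le> r \<Longrightarrow> r \<le> s \<Longrightarrow> p r \<in> ring_hom (Q s) (Q r)"
    and trans_proj: "1 \<le> r \<Longrightarrow> r \<le> s \<Longrightarrow> a \<in> carrier (A s) \<Longrightarrow> p r (\<pi> s a) = \<pi> r a"
begin

abbreviation "L r \<equiv> left_via (Q r) (\<pi> r)"
definition J :: "nat \<Rightarrow> 'a set" where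
  "J r = a_kernel (A r) (Q r) (\<pi> r)"

abbreviation "X r n \<equiv> res_basis (A r) (L r) n"
abbreviation "P r n \<equiv> res (A r) (L r) n"
abbreviation "D r n \<equiv> res_diff (A r) (L r) n"
abbreviation "cyc r n \<equiv> res_cycle (A r) (L r) n"
abbreviation "\<tau> s r n \<equiv> res_map (A s) (A r) (L r) id (p r) n"
abbreviation "S r \<equiv> action_module (A r) (carrier (A r)) (monoid.mult (A r))"
abbreviation "lin r \<equiv> linear_on (carrier (A r))"
abbreviation "bas r \<equiv> basis_vector (A r)"
abbreviation "JPm r n \<equiv> coeff_module (A r) (X r n) (J r) (monoid.mult (A r))"
abbreviation "JP r n \<equiv> carrier (JPm r n)"

lemma proj_ring_hom_ring: "1 \<le> r \<Longrightarrow> ring_hom_ring (A r) (Q r) (\<pi> r)"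
  by (intro ring_hom_ringI2 ring_A ring_Q proj_hom)

lemma J_iff: "a \<in> J r \<longleftrightarrow> a \<in> carrier (A r) \<and> \<pi> r a = \<zero>\<^bsub>Q r\<^esub>"
  by (simp add: J_def a_kernel_def kernel_def)

lemma L_lmodule:
  assumes "1 \<le> r" shows "lmodule (A r) (L r)"
proof -
  interpret ring_hom_ring "A r" "Q r" "\<pi> r" by (rule proj_ring_hom_ring[OF assms])
  show ?thesis
    unfolding left_via_eq
    by (intro lmodule.intro lmodule_axioms.intro abelian_groupI)
      (auto simp: S.a_ac S.l_distr S.r_distr S.m_assoc R.ring_axioms intro: bexI[of _ "\<ominus>\<^bsub>Q r\<^esub> x" for x] S.l_neg)
qed

lemma S_lmodule: "1 \<le> r \<Longrightarrow> lmodule (A r) (S r)"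
  by (rule self_lmodule[OF ring_A])

lemma P_lmodule: "1 \<le> r \<Longrightarrow> lmodule (A r) (P r n)"
  by (rule lmodule.res_lmodule[OF L_lmodule])

lemma P_abelian_group: "1 \<le> r \<Longrightarrow> abelian_group (P r n)"
  by (rule lmodule.axioms(2)[OF P_lmodule])

lemma D_linear: "1 \<le> r \<Longrightarrow> lin r (P r (Suc n)) (P r n) (D r n)"
  by (rule lmodule.res_diff_linear[OF L_lmodule])

lemma incl_closed: "1 \<le> r \<Longrightarrow> r \<le> s \<Longrightarrow> a \<in> carrier (A s) \<Longrightarrow> a \<in> carrier (A r)"
  using ring_hom_closed[OF incl_hom, of r s a] by simp

lemma incl_subset: "1 \<le> r \<Longrightarrow> r \<le> s \<Longrightarrow> carrier (A s) \<subseteq> carrier (A r)"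
  using incl_closed by blast

lemma incl_mult:
  "1 \<le> r \<Longrightarrow> r \<le> s \<Longrightarrow> a \<in> carrier (A s) \<Longrightarrow> b \<in> carrier (A s) \<Longrightarrow> a \<otimes>\<^bsub>A s\<^esub> b = a \<otimes>\<^bsub>A r\<^esub> b"
  using ring_hom_mult[OF incl_hom, of r s a b] by simp

lemma incl_add:
  "1 \<le> r \<Longrightarrow> r \<le> s \<Longrightarrow> a \<in> carrier (A s) \<Longrightarrow> b \<in> carrier (A s) \<Longrightarrow> a \<oplus>\<^bsub>A s\<^esub> b = a \<oplus>\<^bsub>A r\<^esub> b"
  using ring_hom_add[OF incl_hom, of r s a b] by simp

lemma incl_zero: "1 \<le> r \<Longrightarrow> r \<le> s \<Longrightarrow> \<zero>\<^bsub>A s\<^esub> = \<zero>\<^bsub>A r\<^esub>"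
  using id_ring_hom_zero[OF incl_hom ring_A ring_A, of r s] by simp

lemma trans_one: "1 \<le> r \<Longrightarrow> r \<le> s \<Longrightarrow> p r \<one>\<^bsub>Q s\<^esub> = \<one>\<^bsub>Q r\<^esub>"
  by (rule ring_hom_one[OF trans_hom])

lemma J_mono:
  assumes "1 \<le> r" "r \<le> s" shows "J s \<subseteq> J r"
proof
  fix a assume a: "a \<in> J s"
  interpret T: ring_hom_ring "Q s" "Q r" "p r"
    using assms by (intro ring_hom_ringI2 ring_Q trans_hom) auto
  show "a \<in> J r" using a trans_proj[OF assms, of a] incl_closed[OF assms, of a] T.hom_zero by (auto simp: J_iff)
qed

lemma J_ideal:
  assumes "1 \<le> r" shows "ideal (J r) (A r)"
proof -
  interpret ring_hom_ring "A r" "Q r" "\<pi> r" by (rule proj_ring_hom_ring[OF assms])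
  show ?thesis using kernel_is_ideal by (simp add: J_def)
qed

lemma J_subgroup: "1 \<le> r \<Longrightarrow> additive_subgroup (J r) (A r)"
  by (rule ideal.axioms(1)[OF J_ideal])

lemma JP_subset: "1 \<le> r \<Longrightarrow> JP r n \<subseteq> carrier (P r n)"
  by (auto simp: res_def free_module_eq[OF ring_A] coeff_module_carrier J_iff)

lemma J_lmodule:
  "1 \<le> r \<Longrightarrow> lmodule (A r) (action_module (A r) (J r) (monoid.mult (A r)))"
  by (rule ideal_lmodule[OF J_ideal])

lemma linear_maps_J:
  assumes "lin s (free_module (A s) Y) (free_module (A r) Z) g"
    and rs: "1 \<le> r" "r \<le> s"
    and "v \<in> carrier (coeff_module (A s) Y (J s) \<rho>)"
  shows "g v \<in> carrier (coeff_module (A r) Z (J r) \<rho>')"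
  using linear_maps_coeff[OF assms(1) _ _ J_subgroup J_ideal[OF rs(1)] J_mono[OF rs] assms(4)]
    ring_A rs by simp

lemma pair:
  assumes "1 \<le> r" "r \<le> s"
  shows "semilinear_pair (A s) (L s) (A r) (L r) (p r)"
proof -
  have s: "1 \<le> s" using assms by simp
  have "lin s (L s) (L r) (p r)"
  proof (rule linear_onI)
    fix a x assume a: "a \<in> carrier (A s)" and x: "x \<in> carrier (L s)"
    have "\<pi> s a \<in> carrier (Q s)" using ring_hom_closed[OF proj_hom[OF s] a] .
    then show "p r (a \<odot>\<^bsub>L s\<^esub> x) = a \<odot>\<^bsub>L r\<^esub> p r x"
      using x ring_hom_mult[OF trans_hom[OF assms], of "\<pi> s a" x] trans_proj[OF assms a]
      by (simp add: left_via_def)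
  qed (use ring_hom_closed[OF trans_hom[OF assms]] ring_hom_add[OF trans_hom[OF assms]] in
        \<open>auto simp: left_via_def\<close>)
  then show ?thesis
    using L_lmodule[OF s] L_lmodule[OF assms(1)] incl_hom[OF assms]
    by (intro semilinear_pair.intro semilinear_pair_axioms.intro)
qed

lemma \<tau>_linear:
  "1 \<le> r \<Longrightarrow> r \<le> s \<Longrightarrow> lin s (P s n) (P r n) (\<tau> s r n)"
  by (rule semilinear_pair.rmap_linear[OF pair])

lemma \<tau>_diff:
  "1 \<le> r \<Longrightarrow> r \<le> s \<Longrightarrow> v \<in> carrier (P s (Suc n)) \<Longrightarrow> D r n (\<tau> s r (Suc n) v) = \<tau> s r n (D s n v)"
  by (rule semilinear_pair.rmap_diff[OF pair])

lemma \<tau>_basis_Gen: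
  assumes "1 \<le> r" "r \<le> s" "q \<in> carrier (Q s)"
  shows "\<tau> s r 0 (bas s (Gen q)) = bas r (Gen (p r q))"
  using semilinear_pair.rmap_basis[OF pair[OF assms(1,2)], of "Gen q" 0] assms(3)
  by (simp add: left_via_def)

text \<open>A section of \<open>\<pi> r\<close>, normalized at \<open>1\<close> so that \<open>\<kappa>\<close> below is a left inverse of \<open>\<alpha>\<close>.\<close>

definition sec :: "nat \<Rightarrow> 'q \<Rightarrow> 'a" where
  "sec r q = (if q = \<one>\<^bsub>Q r\<^esub> then \<one>\<^bsub>A r\<^esub> else SOME a. a \<in> carrier (A r) \<and> \<pi> r a = q)"

lemma sec:
  assumes "1 \<le> r" "q \<in> carrier (Q r)"
  shows "sec r q \<in> carrier (A r)" "\<pi> r (sec r q) = q"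
proof -
  interpret ring "A r" by (rule ring_A[OF assms(1)])
  have "\<exists>a. a \<in> carrier (A r) \<and> \<pi> r a = q"
    using proj_surj[OF assms(1)] assms(2) imageE by metis
  from someI_ex[OF this] show "sec r q \<in> carrier (A r)" "\<pi> r (sec r q) = q"
    using ring_hom_one[OF proj_hom[OF assms(1)]] by (auto simp: sec_def)
qed

text \<open>A lift of the augmentation through \<open>\<pi> r\<close>, by choice of representatives.
  Together with \<alpha> it compares \<open>P_0\<close>, which is free on all elements of
  \<open>Q r\<close>, with the ring.\<close>

definition \<kappa> :: "nat \<Rightarrow> (('a, 'q) cell \<Rightarrow> 'a) \<Rightarrow> 'a" where
  "\<kappa> r = free_lift (A r) id (S r) (\<lambda>x. sec r (gen_elem x))"

text \<open>The differential as a map from \<open>P_1\<close> to \<open>J\<close>: the augmentation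
  kills boundaries, hence \<kappa> sends them into the kernel of \<pi>
  (\<open>e_in_J\<close>).\<close>

definition e :: "nat \<Rightarrow> (('a, 'q) cell \<Rightarrow> 'a) \<Rightarrow> 'a" where
  "e r v = \<kappa> r (D r 0 v)"

definition \<alpha> :: "nat \<Rightarrow> 'a \<Rightarrow> ('a, 'q) cell \<Rightarrow> 'a" where
  "\<alpha> r c = single (A r) c (Gen \<one>\<^bsub>Q r\<^esub>)"

context
  fixes r :: nat
  assumes r: "1 \<le> r"
begin

interpretation hom: ring_hom_ring "A r" "Q r" "\<pi> r" by (rule proj_ring_hom_ring[OF r])
interpretation L: lmodule "A r" "L r" by (rule L_lmodule[OF r])

lemma \<kappa>_linear: "lin r (P r 0) (S r) (\<kappa> r)"
  unfolding \<kappa>_def res_def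
  by (rule hom.R.free_lift_linear[OF S_lmodule[OF r]]) (auto simp: left_via_def sec[OF r])

lemma \<kappa>_basis:
  assumes "q \<in> carrier (Q r)"
  shows "\<kappa> r (bas r (Gen q)) = sec r q"
proof -
  have "\<kappa> r (bas r (Gen q)) = sec r (gen_elem (Gen q :: ('a, 'q) cell))"
    unfolding \<kappa>_def
    by (rule hom.R.free_lift_basis[OF S_lmodule[OF r], where X = "X r 0"])
      (use assms in \<open>auto simp: left_via_def sec[OF r]\<close>)
  then show ?thesis by simp
qed

lemma \<alpha>_closed: "c \<in> carrier (A r) \<Longrightarrow> \<alpha> r c \<in> carrier (P r 0)"
  unfolding \<alpha>_def res_def by (rule hom.R.single_closed) (auto simp: left_via_def)

lemma \<alpha>_smult:
  assumes "c \<in> carrier (A r)"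
  shows "\<alpha> r c = c \<odot>\<^bsub>P r 0\<^esub> bas r (Gen \<one>\<^bsub>Q r\<^esub>)"
  unfolding \<alpha>_def res_def by (rule hom.R.single_smult[OF assms])

lemma \<alpha>_linear: "lin r (S r) (P r 0) (\<alpha> r)"
  by (rule linear_onI) (auto simp: \<alpha>_closed, auto simp: \<alpha>_def single_def res_def)

lemma \<kappa>_\<alpha>:
  assumes "c \<in> carrier (A r)" shows "\<kappa> r (\<alpha> r c) = c"
proof -
  have "bas r (Gen \<one>\<^bsub>Q r\<^esub>) \<in> carrier (P r 0)"
    by (rule L.basis_in_res) (auto simp: left_via_def)
  then show ?thesis
    using linear_on_smult[OF \<kappa>_linear assms] \<kappa>_basis[of "\<one>\<^bsub>Q r\<^esub>"] assms
    by (simp add: \<alpha>_smult sec_def)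
qed

text \<open>Both sides send \<open>Gen q\<close> to \<open>q\<close>, the left one because
  \<open>sec r\<close> is a section of \<open>\<pi> r\<close>.\<close>

lemma proj_\<kappa>:
  assumes "v \<in> carrier (P r 0)"
  shows "\<pi> r (\<kappa> r v) = free_lift (A r) id (L r) gen_elem v"
proof (rule hom.R.free_linear_eqI[where f = "\<lambda>v. \<pi> r (\<kappa> r v)"])
  have "lin r (S r) (L r) (\<pi> r)"
    by (rule linear_onI) (auto simp: left_via_def)
  then show "lin r (free_module (A r) (X r 0)) (L r) (\<lambda>v. \<pi> r (\<kappa> r v))"
    using linear_on_compose[OF \<kappa>_linear] by (simp add: res_def)
  show "lin r (free_module (A r) (X r 0)) (L r) (free_lift (A r) id (L r) gen_elem)"
    using L.res_augmentation_linear by (simp add: res_def)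
  show "abelian_group (L r)" by (rule L.M.abelian_group_axioms)
  show "v \<in> carrier (free_module (A r) (X r 0))" using assms by (simp add: res_def)
  fix x assume "x \<in> X r 0"
  then obtain q where "x = Gen q" "q \<in> carrier (Q r)" by (auto simp: left_via_def)
  then show "\<pi> r (\<kappa> r (bas r x)) = free_lift (A r) id (L r) gen_elem (bas r x)"
    using L.res_augmentation_basis[of q] by (simp add: \<kappa>_basis sec[OF r] left_via_def)
qed

lemma cyc_0_iff: "v \<in> carrier (P r 0) \<Longrightarrow> cyc r 0 v \<longleftrightarrow> \<kappa> r v \<in> J r"
  using proj_\<kappa>[of v] linear_on_closed[OF \<kappa>_linear, of v] by (simp add: left_via_def J_iff)

lemma cyc_diff: "w \<in> carrier (P r (Suc n)) \<Longrightarrow> cyc r n (D r n w)"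
  by (rule L.res_cycle_diff)

lemma exact: "v \<in> carrier (P r n) \<Longrightarrow> cyc r n v \<Longrightarrow> \<exists>w\<in>carrier (P r (Suc n)). D r n w = v"
  by (rule L.res_exact)

lemma D_D: "w \<in> carrier (P r (Suc (Suc n))) \<Longrightarrow> D r n (D r (Suc n) w) = (\<lambda>_. \<zero>\<^bsub>A r\<^esub>)"
  using cyc_diff[of w "Suc n"] by simp

lemma cyc_\<alpha>: "j \<in> J r \<Longrightarrow> cyc r 0 (\<alpha> r j)"
  using \<alpha>_closed[of j] \<kappa>_\<alpha>[of j] cyc_0_iff[of "\<alpha> r j"] by (simp add: J_iff)

lemma e_in_J: "v \<in> carrier (P r (Suc 0)) \<Longrightarrow> e r v \<in> J r"
  unfolding e_def using cyc_diff[of v 0] linear_on_closed[OF D_linear[OF r], of v 0]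
  by (simp only: cyc_0_iff)

lemma e_linear:
  "lin r (P r (Suc 0)) (action_module (A r) (J r) (monoid.mult (A r))) (e r)"
proof -
  have "lin r (P r (Suc 0)) (S r) (e r)"
    using linear_on_compose[OF D_linear[OF r] \<kappa>_linear] by (simp add: e_def[abs_def])
  then show ?thesis using e_in_J by (auto simp: linear_on_def)
qed

lemma e_D: "w \<in> carrier (P r (Suc (Suc 0))) \<Longrightarrow> e r (D r (Suc 0) w) = \<zero>\<^bsub>A r\<^esub>"
  unfolding e_def
  using D_D[of w 0] linear_on_zero[OF \<kappa>_linear P_abelian_group[OF r] lmodule.axioms(2)[OF S_lmodule[OF r]]]
  by (simp add: res_def)

end

text \<open>Only the generator at 1 is involved, and \<open>p r\<close> preserves 1. Representatives
  are chosen separately at each level, so \<kappa> obeys no such rule;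
  \<open>homotopy_exists\<close> has to absorb the difference.\<close>

lemma \<tau>_\<alpha>:
  assumes rs: "1 \<le> r" "r \<le> s" and c: "c \<in> carrier (A s)"
  shows "\<tau> s r 0 (\<alpha> s c) = \<alpha> r c"
proof -
  have s: "1 \<le> s" using rs by simp
  interpret Qs: ring "Q s" by (rule ring_Q[OF s])
  have "bas s (Gen \<one>\<^bsub>Q s\<^esub>) \<in> carrier (P s 0)"
    by (rule lmodule.basis_in_res[OF L_lmodule[OF s]]) (simp add: left_via_def)
  then show ?thesis
    using linear_on_smult[OF \<tau>_linear[OF rs] c, of "bas s (Gen \<one>\<^bsub>Q s\<^esub>)" 0]
      \<tau>_basis_Gen[OF rs, of "\<one>\<^bsub>Q s\<^esub>"] trans_one[OF rs] \<alpha>_smult[OF s c]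
      \<alpha>_smult[OF rs(1) incl_closed[OF rs c]] by simp
qed

text \<open>As \<open>Q\<^sub>r \<otimes> P\<^sub>n = P\<^sub>n / J\<^sub>r P\<^sub>n\<close>, this says that the transition map from level \<open>s\<close> to level \<open>r\<close> is
  zero on \<open>Tor\<^bsub>n+1\<^esub>\<close>.\<close>

definition tor_null :: "nat \<Rightarrow> nat \<Rightarrow> nat \<Rightarrow> bool" where
  "tor_null s r n \<longleftrightarrow> (\<forall>v\<in>carrier (P s (Suc n)). D s n v \<in> JP s n \<longrightarrow>
    (\<exists>w\<in>JP r (Suc n). D r n w = D r n (\<tau> s r (Suc n) v)))"

text \<open>This is how vanishing of Tor is used: a cycle with coefficients in \<open>J s\<close>
  becomes at level \<open>r\<close> the boundary of a chain with coefficients in \<open>J r\<close>.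
  The \<open>v\<close> needed for \<open>tor_null\<close> comes from exactness of
  \<open>P\<close>.\<close>

lemma tor_null_lift:
  assumes "tor_null s r n" "1 \<le> r" "r \<le> s" "z \<in> JP s n" "cyc s n z"
  shows "\<exists>w\<in>JP r (Suc n). D r n w = \<tau> s r n z"
proof -
  have s: "1 \<le> s" using assms by simp
  have "z \<in> carrier (P s n)" using JP_subset[OF s] assms(4) by blast
  then obtain v where v: "v \<in> carrier (P s (Suc n))" "D s n v = z" using exact[OF s] assms(5) by blast
  then have "\<exists>w\<in>JP r (Suc n). D r n w = D r n (\<tau> s r (Suc n) v)"
    using assms(1,4) unfolding tor_null_def by blast
  then show ?thesis using \<tau>_diff[OF assms(2,3) v(1)] v(2) by simp
qed

end

section \<open>Transfer between towers with the same kernels\<close>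

text \<open>One direction of the transfer; an equivalence takes two instances. \<sigma> identifies
  the kernels by one function for all levels, and \<rho> is left multiplication by \<open>B\<close>
  carried over to \<open>A.J\<close>. The assumption \<open>\<rho>_mult\<close> is the law b(ja) =
  (bj)a across the two rings.\<close>

locale tower_transfer = A: tower A Q \<pi> p + B: tower B Q' \<pi>' p'
  for A :: "nat \<Rightarrow> ('a, 'y) ring_scheme" and Q :: "nat \<Rightarrow> ('q, 'z) ring_scheme" and \<pi> p
    and B :: "nat \<Rightarrow> ('b, 'y2) ring_scheme" and Q' :: "nat \<Rightarrow> ('q2, 'z2) ring_scheme" and \<pi>' p' +
  fixes \<sigma> :: "'a \<Rightarrow> 'b" and \<rho> :: "'b \<Rightarrow> 'a \<Rightarrow> 'a"
  assumes \<sigma>_bij: "1 \<le> r \<Longrightarrow> bij_betw \<sigma> (A.J r) (B.J r)"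
    and \<sigma>_add: "1 \<le> r \<Longrightarrow> i \<in> A.J r \<Longrightarrow> j \<in> A.J r \<Longrightarrow> \<sigma> (i \<oplus>\<^bsub>A r\<^esub> j) = \<sigma> i \<oplus>\<^bsub>B r\<^esub> \<sigma> j"
    and \<sigma>_mult: "1 \<le> r \<Longrightarrow> i \<in> A.J r \<Longrightarrow> j \<in> A.J r \<Longrightarrow> \<sigma> (i \<otimes>\<^bsub>A r\<^esub> j) = \<sigma> i \<otimes>\<^bsub>B r\<^esub> \<sigma> j"
    and \<rho>_closed: "1 \<le> r \<Longrightarrow> b \<in> carrier (B r) \<Longrightarrow> j \<in> A.J r \<Longrightarrow> \<rho> b j \<in> A.J r"
    and \<sigma>_\<rho>: "1 \<le> r \<Longrightarrow> b \<in> carrier (B r) \<Longrightarrow> j \<in> A.J r \<Longrightarrow> \<sigma> (\<rho> b j) = b \<otimes>\<^bsub>B r\<^esub> \<sigma> j"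
    and \<rho>_mult: "1 \<le> r \<Longrightarrow> b \<in> carrier (B r) \<Longrightarrow> j \<in> A.J r \<Longrightarrow> a \<in> carrier (A r) \<Longrightarrow>
      \<rho> b (j \<otimes>\<^bsub>A r\<^esub> a) = \<rho> b j \<otimes>\<^bsub>A r\<^esub> a"
begin

abbreviation "JC r Y \<equiv> coeff_module (A r) Y (A.J r) \<rho>"
abbreviation "JCB r Y \<equiv> coeff_module (B r) Y (B.J r) (monoid.mult (B r))"
abbreviation "JT r n \<equiv> JC r (A.X r n)"
abbreviation "JB r n \<equiv> JCB r (B.X r n)"
abbreviation "JM r \<equiv> action_module (A r) (A.J r) \<rho>"

lemma \<sigma>_closed: "1 \<le> r \<Longrightarrow> j \<in> A.J r \<Longrightarrow> \<sigma> j \<in> B.J r"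
  using \<sigma>_bij bij_betwE by blast

lemma \<sigma>_inj: "1 \<le> r \<Longrightarrow> i \<in> A.J r \<Longrightarrow> j \<in> A.J r \<Longrightarrow> \<sigma> i = \<sigma> j \<Longrightarrow> i = j"
  using \<sigma>_bij[of r] by (auto simp: bij_betw_def inj_on_def)

lemma B_J_carrier: "j \<in> B.J r \<Longrightarrow> j \<in> carrier (B r)"
  by (simp add: B.J_iff)

lemma A_J_carrier: "j \<in> A.J r \<Longrightarrow> j \<in> carrier (A r)"
  by (simp add: A.J_iff)

lemma \<sigma>_zero:
  assumes "1 \<le> r" shows "\<sigma> \<zero>\<^bsub>A r\<^esub> = \<zero>\<^bsub>B r\<^esub>"
proof -
  interpret KA: ideal "A.J r" "A r" by (rule A.J_ideal[OF assms])
  interpret KB: ideal "B.J r" "B r" by (rule B.J_ideal[OF assms])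
  have z: "\<zero>\<^bsub>A r\<^esub> \<in> A.J r" by (rule additive_subgroup.zero_closed[OF A.J_subgroup[OF assms]])
  have "\<sigma> \<zero>\<^bsub>A r\<^esub> \<oplus>\<^bsub>B r\<^esub> \<sigma> \<zero>\<^bsub>A r\<^esub> = \<sigma> \<zero>\<^bsub>A r\<^esub>"
    using \<sigma>_add[OF assms z z] by simp
  moreover have "\<sigma> \<zero>\<^bsub>A r\<^esub> \<in> carrier (B r)"
    using \<sigma>_closed[OF assms z] by simp
  ultimately show ?thesis using KB.add.l_cancel_one by blast
qed

text \<open>The laws that involve \<rho> are checked after applying the injection \<sigma>, where
  \<rho> becomes left multiplication in \<open>B r\<close>.\<close>

lemma JM_lmodule:
  assumes r: "1 \<le> r" shows "lmodule (B r) (JM r)"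
proof -
  interpret KA: ideal "A.J r" "A r" by (rule A.J_ideal[OF r])
  interpret KB: ideal "B.J r" "B r" by (rule B.J_ideal[OF r])
  note closed = \<sigma>_closed[OF r] \<rho>_closed[OF r]
  note \<sigma> = \<sigma>_add[OF r] \<sigma>_\<rho>[OF r]
  note inj = \<sigma>_inj[OF r]
  have \<sigma>C: "\<sigma> j \<in> carrier (B r)" if "j \<in> A.J r" for j using closed(1)[OF that] by simp
  show ?thesis
  proof (intro lmodule.intro lmodule_axioms.intro abelian_groupI, goal_cases)
    case 1
    show ?case by (rule KB.ring_axioms)
  next
    case (7 x)
    then show ?case by (intro bexI[of _ "\<ominus>\<^bsub>A r\<^esub> x"]) (auto simp: KA.l_neg)
  next
    case (9 a b x)
    then show ?case by (intro inj) (auto simp: closed \<sigma> \<sigma>C KB.l_distr)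
  next
    case (10 a x y)
    then show ?case by (intro inj) (auto simp: closed \<sigma> \<sigma>C KB.r_distr)
  next
    case (11 a b x)
    then show ?case by (intro inj) (auto simp: closed \<sigma> \<sigma>C KB.m_assoc)
  next
    case (12 x)
    then show ?case by (intro inj) (auto simp: closed \<sigma> \<sigma>C)
  qed (auto simp: KA.a_ac closed)
qed

lemma JM_lmodule_le: "1 \<le> r \<Longrightarrow> r \<le> s \<Longrightarrow> lmodule (B s) (JM r)"
  by (rule lmodule_restrict[OF JM_lmodule B.incl_hom B.ring_A]) auto

lemma coeff_T_lmodule: "1 \<le> r \<Longrightarrow> r \<le> s \<Longrightarrow> lmodule (B s) (JC r Y)"
  by (rule coeff_lmodule[OF A.ring_A A.J_subgroup JM_lmodule_le])

lemma coeff_T_abelian_group: "1 \<le> r \<Longrightarrow> abelian_group (JC r Y)"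
  by (rule lmodule.axioms(2)[OF coeff_T_lmodule[OF _ order.refl]])

lemma coeff_T_free: "1 \<le> r \<Longrightarrow> v \<in> carrier (JC r Y) \<Longrightarrow> v \<in> carrier (free_module (A r) Y)"
  by (auto simp: free_module_eq[OF A.ring_A] coeff_module_carrier A_J_carrier)

lemma JT_P: "1 \<le> r \<Longrightarrow> v \<in> carrier (JT r n) \<Longrightarrow> v \<in> carrier (A.P r n)"
  unfolding res_def by (rule coeff_T_free)

lemma linear_on_coeff_add:
  assumes "linear_on C (free_module (A s) Y) N g" "1 \<le> s"
    "v \<in> carrier (JC s Y)" "w \<in> carrier (JC s Y)"
  shows "g (v \<oplus>\<^bsub>JC s Y\<^esub> w) = g v \<oplus>\<^bsub>N\<^esub> g w"
proof -
  have "v \<oplus>\<^bsub>JC s Y\<^esub> w = v \<oplus>\<^bsub>free_module (A s) Y\<^esub> w"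
    by (simp add: free_module_def)
  then show ?thesis
    using linear_on_add[OF assms(1) coeff_T_free[OF assms(2,3)] coeff_T_free[OF assms(2,4)]] by simp
qed

text \<open>The action of \<open>B\<close> on coefficients from the left commutes with the matrix of
  \<open>g\<close> on the right, by \<open>\<rho>_mult\<close>. It is enough to see this on vectors
  \<open>j e_x\<close> with \<open>j\<close> in \<open>J\<close>, where \<open>g\<close> gives
  \<open>j\<close> times \<open>g e_x\<close>.\<close>

lemma transport_linear:
  assumes g: "A.lin s (free_module (A s) Y) (free_module (A r) Z) g"
    and rs: "1 \<le> r" "r \<le> s"
  shows "B.lin s (JC s Y) (JC r Z) g"
proof -
  let ?M = "JC s Y" and ?N = "JC r Z"
  have s: "1 \<le> s" using rs by simp
  interpret M: lmodule "B s" ?M by (rule coeff_T_lmodule[OF s order.refl])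
  interpret N: lmodule "B s" ?N by (rule coeff_T_lmodule[OF rs])
  interpret As: ring "A s" by (rule A.ring_A[OF s])
  interpret Ar: ring "A r" by (rule A.ring_A[OF rs(1)])
  have closed: "g v \<in> carrier ?N" if "v \<in> carrier ?M" for v
    by (rule A.linear_maps_J[OF g rs that])
  have add: "g (v \<oplus>\<^bsub>?M\<^esub> w) = g v \<oplus>\<^bsub>?N\<^esub> g w" if "v \<in> carrier ?M" "w \<in> carrier ?M" for v w
    using linear_on_coeff_add[OF g s that] by (simp add: free_module_def)
  show ?thesis
  proof (rule linear_onI)
    fix b v assume b: "b \<in> carrier (B s)" and v: "v \<in> carrier ?M"
    have br: "b \<in> carrier (B r)" by (rule B.incl_closed[OF rs b])
    show "g (b \<odot>\<^bsub>?M\<^esub> v) = b \<odot>\<^bsub>?N\<^esub> g v"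
    proof (rule coeff_eqI[OF As.ring_axioms A.J_subgroup[OF s], where f = "\<lambda>v. g (b \<odot>\<^bsub>?M\<^esub> v)"
          and g = "\<lambda>v. b \<odot>\<^bsub>?N\<^esub> g v"])
      show "linear_on {} ?M ?N (\<lambda>v. g (b \<odot>\<^bsub>?M\<^esub> v))"
        using b by (intro linear_onI) (simp_all add: closed add M.smult_r_distr del: coeff_module_ops)
      show "linear_on {} ?M ?N (\<lambda>v. b \<odot>\<^bsub>?N\<^esub> g v)"
        using b by (intro linear_onI) (simp_all add: closed add N.smult_r_distr del: coeff_module_ops)
      show "abelian_group ?M" "abelian_group ?N" by (rule M.M.abelian_group_axioms N.M.abelian_group_axioms)+
      show "v \<in> carrier ?M" by (rule v)
      fix j x assume j: "j \<in> A.J s" and x: "x \<in> Y"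
      have jr: "j \<in> A.J r" using j A.J_mono[OF rs] by blast
      let ?x = "A.bas s x"
      have xc: "?x \<in> carrier (free_module (A s) Y)" by (rule As.basis_closed[OF x])
      have gx: "g ?x y \<in> carrier (A r)" for y
        using linear_on_closed[OF g xc] by (auto simp: free_module_eq[OF Ar.ring_axioms] coeff_module_carrier)
      have *: "g (single (A s) a x) = (\<lambda>y. a \<otimes>\<^bsub>A r\<^esub> g ?x y)" if "a \<in> carrier (A s)" for a
        using linear_on_smult[OF g that xc] As.single_smult[OF that, of x Y] by simp
      have "\<rho> b \<zero>\<^bsub>A s\<^esub> = \<zero>\<^bsub>A s\<^esub>" using M.smult_r_null[OF b]
        using JM_lmodule[OF s] lmodule.smult_r_null[of "B s" "JM s" b] b by simp
      then have "b \<odot>\<^bsub>?M\<^esub> single (A s) j x = single (A s) (\<rho> b j) x"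
        by (auto simp: single_def)
      then show "g (b \<odot>\<^bsub>?M\<^esub> single (A s) j x) = b \<odot>\<^bsub>?N\<^esub> g (single (A s) j x)"
        using *[of "\<rho> b j"] *[of j] \<rho>_closed[OF s b j] j \<rho>_mult[OF rs(1) br jr gx] by (simp add: A.J_iff)
    qed
  qed (use closed add in auto)
qed

lemma D_T_linear: "1 \<le> r \<Longrightarrow> B.lin r (JT r (Suc n)) (JT r n) (A.D r n)"
  using transport_linear[OF A.D_linear[unfolded res_def] _ order.refl] by (simp add: res_def)

lemma \<tau>_T_linear:
  "1 \<le> r \<Longrightarrow> r \<le> s \<Longrightarrow> B.lin s (JT s n) (JT r n) (A.\<tau> s r n)"
  using transport_linear[OF A.\<tau>_linear[unfolded res_def]] by (simp add: res_def)

lemma \<alpha>_T_linear: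
  assumes r: "1 \<le> r" shows "B.lin r (JM r) (JT r 0) (A.\<alpha> r)"
proof -
  have mem: "Gen \<one>\<^bsub>Q r\<^esub> \<in> A.X r 0"
  proof -
    interpret ring "Q r" by (rule A.ring_Q[OF r])
    show ?thesis by (simp add: left_via_def)
  qed
  interpret ring "A r" by (rule A.ring_A[OF r])
  have "\<rho> b \<zero>\<^bsub>A r\<^esub> = \<zero>\<^bsub>A r\<^esub>" if "b \<in> carrier (B r)" for b
    using lmodule.smult_r_null[OF JM_lmodule[OF r] that] by simp
  then show ?thesis
    using coeff_single[OF ring_axioms A.J_subgroup[OF r] _ mem]
    by (intro linear_onI) (auto simp: A.\<alpha>_def, auto simp: single_def)
qed

section \<open>From the resolution over \<open>B\<close> to \<open>J P\<close> over
  \<open>A\<close>\<close>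

definition \<sigma>inv :: "'b \<Rightarrow> 'a" where "\<sigma>inv = inv_into (A.J 1) \<sigma>"

text \<open>The kernels shrink as the level grows while \<sigma> stays the same, so the inverse
  taken at level 1 serves every level.\<close>

lemma \<sigma>inv_\<sigma>:
  assumes "1 \<le> r" "j \<in> A.J r" shows "\<sigma>inv (\<sigma> j) = j"
proof -
  have "j \<in> A.J 1" using A.J_mono[of 1 r] assms by auto
  then show ?thesis using \<sigma>_bij[of 1] unfolding \<sigma>inv_def bij_betw_def by (simp add: inv_into_f_f)
qed

lemma \<sigma>inv:
  assumes "1 \<le> r" "j \<in> B.J r" shows "\<sigma>inv j \<in> A.J r" "\<sigma> (\<sigma>inv j) = j"
proof -
  obtain i where "i \<in> A.J r" "j = \<sigma> i" using \<sigma>_bij[OF assms(1)] assms(2) by (auto simp: bij_betw_def)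
  then show "\<sigma>inv j \<in> A.J r" "\<sigma> (\<sigma>inv j) = j" using \<sigma>inv_\<sigma>[OF assms(1)] by auto
qed

lemma \<sigma>inv_linear:
  assumes r: "1 \<le> r"
  shows "B.lin r (action_module (B r) (B.J r) (monoid.mult (B r))) (JM r) \<sigma>inv"
proof -
  interpret KA: ideal "A.J r" "A r" by (rule A.J_ideal[OF r])
  interpret KB: ideal "B.J r" "B r" by (rule B.J_ideal[OF r])
  show ?thesis
    by (rule linear_onI)
      (auto intro!: \<sigma>_inj[OF r] simp: \<sigma>inv[OF r] \<sigma>_add[OF r] \<sigma>_\<rho>[OF r] \<rho>_closed[OF r] KB.I_l_closed)
qed

lemma \<sigma>inv_e_linear:
  assumes rs: "1 \<le> r" "r \<le> s"
  shows "B.lin s (B.P s (Suc 0)) (JM r) (\<lambda>v. \<sigma>inv (B.e s v))"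
proof -
  have s: "1 \<le> s" using rs by simp
  have "B.lin s (B.P s (Suc 0)) (JM s) (\<lambda>v. \<sigma>inv (B.e s v))"
    using linear_on_compose[OF B.e_linear[OF s] \<sigma>inv_linear[OF s]] .
  then show ?thesis
    using A.J_mono[OF rs] A.incl_add[OF rs] \<sigma>inv(1)[OF s B.e_in_J[OF s]]
    by (auto simp: linear_on_def A_J_carrier)
qed

text \<open>A chain map in degrees 1 to N+1, with \<open>\<beta> n\<close> in degree n+1. Degree 0
  carries no map; its place is taken by the inclusion of \<open>J s\<close> in \<open>J r\<close>,
  entered from \<open>P_1\<close> over \<open>B\<close> by \<open>e\<close> and left towards
  \<open>P_0\<close> over \<open>A\<close> by \<alpha>.\<close>

definition lifts :: "nat \<Rightarrow> nat \<Rightarrow> nat \<Rightarrow> (nat \<Rightarrow> (('b, 'q2) cell \<Rightarrow> 'b) \<Rightarrow> ('a, 'q) cell \<Rightarrow> 'a) \<Rightarrow> bool" where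
  "lifts N s r \<beta> \<longleftrightarrow>
    (\<forall>n\<le>N. B.lin s (B.P s (Suc n)) (JT r (Suc n)) (\<beta> n)) \<and>
    (\<forall>v\<in>carrier (B.P s (Suc 0)). A.D r 0 (\<beta> 0 v) = A.\<alpha> r (\<sigma>inv (B.e s v))) \<and>
    (\<forall>n<N. \<forall>v\<in>carrier (B.P s (Suc (Suc n))). A.D r (Suc n) (\<beta> (Suc n) v) = \<beta> n (B.D s (Suc n) v))"

lemma
  assumes "lifts N s r \<beta>"
  shows lifts_linear: "n \<le> N \<Longrightarrow> B.lin s (B.P s (Suc n)) (JT r (Suc n)) (\<beta> n)"
    and lifts_0: "v \<in> carrier (B.P s (Suc 0)) \<Longrightarrow> A.D r 0 (\<beta> 0 v) = A.\<alpha> r (\<sigma>inv (B.e s v))"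
    and lifts_Suc: "n < N \<Longrightarrow> v \<in> carrier (B.P s (Suc (Suc n))) \<Longrightarrow>
      A.D r (Suc n) (\<beta> (Suc n) v) = \<beta> n (B.D s (Suc n) v)"
  using assms by (simp_all add: lifts_def)

text \<open>Each degree is a lifting problem out of a free \<open>B\<close>-module. The value to be
  lifted is a cycle with coefficients in \<open>J\<close>, and vanishing of Tor over
  \<open>A\<close> makes it a boundary in \<open>J P\<close> after one more transition map.\<close>

lemma lifts_exist:
  assumes "\<And>n r. n \<le> N \<Longrightarrow> 1 \<le> r \<Longrightarrow> \<exists>s\<ge>r. A.tor_null s r n" and "1 \<le> r"
  shows "\<exists>s\<ge>r. \<exists>\<beta>. lifts N s r \<beta>"
  using assms
proof (induction N arbitrary: r)
  case (0 r)
  then obtain s where rs: "1 \<le> r" "r \<le> s" and null: "A.tor_null s r 0" by blast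
  have s: "1 \<le> s" using rs by simp
  let ?f = "\<lambda>v. A.\<alpha> r (\<sigma>inv (B.e s v))"
  have f: "B.lin s (B.P s (Suc 0)) (JT r 0) ?f"
    using linear_on_compose[OF \<sigma>inv_e_linear[OF rs] linear_on_subset[OF \<alpha>_T_linear[OF rs(1)] B.incl_subset[OF rs]]] .
  have ex: "\<exists>w\<in>carrier (JT r (Suc 0)). A.D r 0 w = ?f (B.bas s x)" if x: "x \<in> B.X s (Suc 0)" for x
  proof -
    have xc: "B.bas s x \<in> carrier (B.P s (Suc 0))" by (rule lmodule.basis_in_res[OF B.L_lmodule[OF s] x])
    define j where "j = \<sigma>inv (B.e s (B.bas s x))"
    have j: "j \<in> A.J s" unfolding j_def by (rule \<sigma>inv(1)[OF s B.e_in_J[OF s xc]])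
    have "A.\<alpha> s j \<in> carrier (JT s 0)" using linear_on_closed[OF \<alpha>_T_linear[OF s]] j by simp
    then have "A.\<alpha> s j \<in> A.JP s 0" using coeff_module_carrier_eq by blast
    then obtain w where w: "w \<in> A.JP r (Suc 0)" "A.D r 0 w = A.\<tau> s r 0 (A.\<alpha> s j)"
      using A.tor_null_lift[OF null rs _ A.cyc_\<alpha>[OF s j]] by blast
    have "A.\<tau> s r 0 (A.\<alpha> s j) = A.\<alpha> r j" by (rule A.\<tau>_\<alpha>[OF rs A_J_carrier[OF j]])
    then show ?thesis using w coeff_module_carrier_eq unfolding j_def by metis
  qed
  obtain g where g: "B.lin s (B.P s (Suc 0)) (JT r (Suc 0)) g"
    and "\<And>v. v \<in> carrier (B.P s (Suc 0)) \<Longrightarrow> A.D r 0 (g v) = ?f v"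
    using lmodule.res_projective[OF B.L_lmodule[OF s] coeff_T_lmodule[OF rs] coeff_T_abelian_group[OF rs(1)]
      linear_on_subset[OF D_T_linear[OF rs(1)] B.incl_subset[OF rs]] f ex] by blast
  then have "lifts 0 s r (\<lambda>_. g)" using g by (simp add: lifts_def)
  then show ?case using rs by blast
next
  case (Suc N r)
  \<comment> \<open>The transition from \<open>t\<close> to \<open>r\<close> is reserved for the new
    degree; the maps in the old degrees are built with target level \<open>t\<close>.\<close>
  obtain t where rt: "1 \<le> r" "r \<le> t" and null: "A.tor_null t r (Suc N)" using Suc.prems by blast
  have t: "1 \<le> t" using rt by simp
  obtain s \<beta> where ts: "t \<le> s" and \<beta>: "lifts N s t \<beta>"
    using Suc.IH[OF _ t] Suc.prems(1) le_SucI by metis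
  have s: "1 \<le> s" "r \<le> s" using rt ts by auto
  note \<beta>_lin = lifts_linear[OF \<beta>] and \<beta>_0 = lifts_0[OF \<beta>] and \<beta>_Suc = lifts_Suc[OF \<beta>]
  have \<tau>_lin: "B.lin s (JT t n) (JT r n) (A.\<tau> t r n)" for n
    by (rule linear_on_subset[OF \<tau>_T_linear[OF rt] B.incl_subset[OF t ts]])
  let ?f = "\<lambda>v. A.\<tau> t r (Suc N) (\<beta> N (B.D s (Suc N) v))"
  have f: "B.lin s (B.P s (Suc (Suc N))) (JT r (Suc N)) ?f"
    using linear_on_compose[OF linear_on_compose[OF B.D_linear[OF s(1)] \<beta>_lin[OF order.refl]] \<tau>_lin] .
  \<comment> \<open>The chain map condition of the degree below, applied to a boundary. At the
    bottom, where there is no degree below, \<open>e_D\<close> replaces the vanishing of two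
    successive differentials.\<close>
  have cyc: "A.cyc t (Suc N) (\<beta> N (B.D s (Suc N) v))" if v: "v \<in> carrier (B.P s (Suc (Suc N)))" for v
  proof (cases N)
    case 0
    have "B.D s (Suc 0) v \<in> carrier (B.P s (Suc 0))" using linear_on_closed[OF B.D_linear[OF s(1)]] v 0 by simp
    then show ?thesis
      using \<beta>_0 B.e_D[OF s(1), of v] v 0
        linear_on_zero[OF \<alpha>_T_linear[OF t] lmodule.axioms(2)[OF JM_lmodule[OF t]] coeff_T_abelian_group[OF t]]
        \<sigma>inv_\<sigma>[OF t, of "\<zero>\<^bsub>A t\<^esub>"] \<sigma>_zero[OF t] additive_subgroup.zero_closed[OF A.J_subgroup[OF t]]
        B.incl_zero[OF t ts]
      by simp
  next
    case (Suc M)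
    have "B.D s (Suc N) v \<in> carrier (B.P s (Suc N))" using linear_on_closed[OF B.D_linear[OF s(1)] v] .
    then show ?thesis
      using \<beta>_Suc[of M] Suc B.D_D[OF s(1), of v N] v
        linear_on_zero[OF \<beta>_lin[of M] B.P_abelian_group[OF s(1)] coeff_T_abelian_group[OF t]]
      by (simp add: zero_res)
  qed
  have ex: "\<exists>w\<in>carrier (JT r (Suc (Suc N))). A.D r (Suc N) w = ?f (B.bas s x)"
    if x: "x \<in> B.X s (Suc (Suc N))" for x
  proof -
    have xc: "B.bas s x \<in> carrier (B.P s (Suc (Suc N)))"
      by (rule lmodule.basis_in_res[OF B.L_lmodule[OF s(1)] x])
    have "\<beta> N (B.D s (Suc N) (B.bas s x)) \<in> carrier (JT t (Suc N))"
      using linear_on_closed[OF \<beta>_lin[OF order.refl] linear_on_closed[OF B.D_linear[OF s(1)] xc]] .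
    then have "\<beta> N (B.D s (Suc N) (B.bas s x)) \<in> A.JP t (Suc N)" using coeff_module_carrier_eq by blast
    then obtain w where "w \<in> A.JP r (Suc (Suc N))" "A.D r (Suc N) w = ?f (B.bas s x)"
      using A.tor_null_lift[OF null rt _ cyc[OF xc]] by blast
    then show ?thesis using coeff_module_carrier_eq by blast
  qed
  obtain g where g: "B.lin s (B.P s (Suc (Suc N))) (JT r (Suc (Suc N))) g"
    and Dg: "\<And>v. v \<in> carrier (B.P s (Suc (Suc N))) \<Longrightarrow> A.D r (Suc N) (g v) = ?f v"
    using lmodule.res_projective[OF B.L_lmodule[OF s(1)] coeff_T_lmodule[OF rt(1) s(2)]
      coeff_T_abelian_group[OF rt(1)] linear_on_subset[OF D_T_linear[OF rt(1)] B.incl_subset[OF rt(1) s(2)]] f ex]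
    by blast
  \<comment> \<open>The old maps end at level \<open>t\<close> and are pushed down by transition
    maps, which commute with the differentials and with \<alpha>; the new map ends at level
    \<open>r\<close> already.\<close>
  let ?\<beta> = "\<lambda>n v. if n \<le> N then A.\<tau> t r (Suc n) (\<beta> n v) else g v"
  have "lifts (Suc N) s r ?\<beta>"
    unfolding lifts_def
  proof (intro conjI allI impI ballI)
    fix n assume n: "n \<le> Suc N"
    show "B.lin s (B.P s (Suc n)) (JT r (Suc n)) (?\<beta> n)"
    proof (cases "n \<le> N")
      case True
      then show ?thesis using linear_on_compose[OF \<beta>_lin[OF True] \<tau>_lin] by simp
    next
      case False
      then show ?thesis using n g by (simp add: le_Suc_eq)
    qed
  next
    fix v assume v: "v \<in> carrier (B.P s (Suc 0))"
    have "\<beta> 0 v \<in> carrier (A.P t (Suc 0))" by (rule JT_P[OF t linear_on_closed[OF \<beta>_lin v]]) simp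
    then have "A.D r 0 (A.\<tau> t r (Suc 0) (\<beta> 0 v)) = A.\<tau> t r 0 (A.\<alpha> t (\<sigma>inv (B.e s v)))"
      using A.\<tau>_diff[OF rt] \<beta>_0[OF v] by simp
    moreover have "\<sigma>inv (B.e s v) \<in> carrier (A t)"
      using \<sigma>inv(1)[OF s(1) B.e_in_J[OF s(1) v]] A.J_mono[OF t ts] A_J_carrier by blast
    ultimately show "A.D r 0 (?\<beta> 0 v) = A.\<alpha> r (\<sigma>inv (B.e s v))" using A.\<tau>_\<alpha>[OF rt] by simp
  next
    fix n v assume n: "n < Suc N" and v: "v \<in> carrier (B.P s (Suc (Suc n)))"
    show "A.D r (Suc n) (?\<beta> (Suc n) v) = ?\<beta> n (B.D s (Suc n) v)"
    proof (cases "n < N")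
      case True
      have "\<beta> (Suc n) v \<in> carrier (A.P t (Suc (Suc n)))"
        by (rule JT_P[OF t linear_on_closed[OF \<beta>_lin v]]) (use True in simp)
      then show ?thesis using True A.\<tau>_diff[OF rt] \<beta>_Suc[OF True v] by simp
    next
      case False
      then have "n = N" using n by simp
      then show ?thesis using Dg v by simp
    qed
  qed
  then show ?case using s(2) by blast
qed

end

section \<open>Contractions within one tower and vanishing of Tor\<close>

lemma (in abelian_group) minus_zero_right: "x \<in> carrier G \<Longrightarrow> x \<ominus> \<zero> = x"
  by (simp add: a_minus_def)

context tower
begin

lemma P_lmodule_le: "1 \<le> r \<Longrightarrow> r \<le> s \<Longrightarrow> lmodule (A s) (P r n)"
  by (rule lmodule_restrict[OF P_lmodule incl_hom ring_A]) auto

lemma linear_into_P: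
  assumes "linear_on C M (JPm r n) g" "1 \<le> r"
  shows "linear_on C M (P r n) g"
proof -
  have "g v \<in> carrier (P r n)" if "v \<in> carrier M" for v
    using linear_on_closed[OF assms(1) that] JP_subset[OF assms(2)] by blast
  then show ?thesis using assms(1) by (simp add: linear_on_def res_def free_module_def)
qed

text \<open>The case \<open>B = A\<close> of \<open>lifts\<close>, with the multiplication of
  \<open>A r\<close> itself as action. Again \<open>h n\<close> belongs to degree n+1, and
  \<open>\<alpha> r (e s v)\<close> stands for the inclusion of kernels.\<close>

definition contraction :: "nat \<Rightarrow> nat \<Rightarrow> nat \<Rightarrow> (nat \<Rightarrow> (('a, 'q) cell \<Rightarrow> 'a) \<Rightarrow> ('a, 'q) cell \<Rightarrow> 'a) \<Rightarrow> bool" where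
  "contraction N s r h \<longleftrightarrow>
    (\<forall>n\<le>N. lin s (P s (Suc n))
      (JPm r (Suc n)) (h n)) \<and>
    (\<forall>v\<in>carrier (P s (Suc 0)). D r 0 (h 0 v) = \<alpha> r (e s v)) \<and>
    (\<forall>n<N. \<forall>v\<in>carrier (P s (Suc (Suc n))). D r (Suc n) (h (Suc n) v) = h n (D s (Suc n) v))"

text \<open>The action in a transfer has to be one function for all levels. The multiplication of
  the largest ring, the one at level 1, qualifies because it agrees with that of \<open>A r\<close>
  on \<open>carrier (A r)\<close>.\<close>

lemma self_transfer: "tower_transfer A Q \<pi> p A Q \<pi> p id (monoid.mult (A (Suc 0)))"
proof (intro tower_transfer.intro tower_transfer_axioms.intro)
  show "tower A Q \<pi> p" "tower A Q \<pi> p" by (rule tower_axioms)+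
  fix r :: nat assume r: "1 \<le> r"
  interpret K: ideal "J r" "A r" by (rule J_ideal[OF r])
  have m: "b \<otimes>\<^bsub>A (Suc 0)\<^esub> c = b \<otimes>\<^bsub>A r\<^esub> c" if "b \<in> carrier (A r)" "c \<in> carrier (A r)" for b c
    using incl_mult[of "Suc 0" r] r that by simp
  note [simp] = K.I_l_closed K.I_r_closed
  show "bij_betw id (J r) (J r)" by simp
  fix i j assume ij: "i \<in> J r" "j \<in> J r"
  show "id (i \<oplus>\<^bsub>A r\<^esub> j) = id i \<oplus>\<^bsub>A r\<^esub> id j" "id (i \<otimes>\<^bsub>A r\<^esub> j) = id i \<otimes>\<^bsub>A r\<^esub> id j" by simp_all
next
  fix r :: nat and b j assume r: "1 \<le> r" and b: "b \<in> carrier (A r)" and j: "j \<in> J r"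
  interpret K: ideal "J r" "A r" by (rule J_ideal[OF r])
  have m: "b \<otimes>\<^bsub>A (Suc 0)\<^esub> c = b \<otimes>\<^bsub>A r\<^esub> c" if "c \<in> carrier (A r)" for c
    using incl_mult[of "Suc 0" r] r b that by simp
  show "b \<otimes>\<^bsub>A (Suc 0)\<^esub> j \<in> J r" "id (b \<otimes>\<^bsub>A (Suc 0)\<^esub> j) = b \<otimes>\<^bsub>A r\<^esub> id j"
    using j b K.I_l_closed by (simp_all add: m)
  fix a assume "a \<in> carrier (A r)"
  then show "b \<otimes>\<^bsub>A (Suc 0)\<^esub> (j \<otimes>\<^bsub>A r\<^esub> a) = b \<otimes>\<^bsub>A (Suc 0)\<^esub> j \<otimes>\<^bsub>A r\<^esub> a"
    using j b K.I_r_closed by (simp add: m K.m_assoc)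
qed

text \<open>Obtained from \<open>lifts_exist\<close> for the transfer of the tower to itself. It
  remains to drop \<open>\<sigma>inv\<close>, the identity on \<open>J\<close>, and to exchange
  multiplication at level 1 for multiplication at level \<open>r\<close>.\<close>

lemma contraction_exists:
  assumes null: "\<And>n r. n \<le> N \<Longrightarrow> 1 \<le> r \<Longrightarrow> \<exists>s\<ge>r. tor_null s r n" and r: "1 \<le> r"
  shows "\<exists>s\<ge>r. \<exists>h. contraction N s r h"
proof -
  interpret T: tower_transfer A Q \<pi> p A Q \<pi> p id "monoid.mult (A (Suc 0))" by (rule self_transfer)
  obtain s h where rs: "r \<le> s" and h: "T.lifts N s r h" using T.lifts_exist[OF null r] by blast
  have s: "1 \<le> s" using r rs by simp
  have e: "T.\<sigma>inv (e s v) = e s v" if "v \<in> carrier (P s (Suc 0))" for v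
    using T.\<sigma>inv_\<sigma>[OF s e_in_J[OF s that]] by simp
  have lin: "lin s (P s (Suc n)) (JPm r (Suc n)) (h n)"
    if "n \<le> N" for n
  proof -
    have l: "lin s (P s (Suc n)) (coeff_module (A r) (X r (Suc n)) (J r) (monoid.mult (A (Suc 0)))) (h n)"
      using h that by (simp add: T.lifts_def)
    show ?thesis
    proof (rule linear_onI)
      fix a v assume a: "a \<in> carrier (A s)" and v: "v \<in> carrier (P s (Suc n))"
      have "h n v x \<in> carrier (A r)" for x
        using linear_on_closed[OF l v] by (simp add: coeff_module_carrier J_iff)
      then show "h n (a \<odot>\<^bsub>P s (Suc n)\<^esub> v) =
          a \<odot>\<^bsub>JPm r (Suc n)\<^esub> h n v"
        using linear_on_smult[OF l a v] incl_mult[of "Suc 0" r a] r incl_closed[OF r rs a] by simp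
    qed (use linear_on_closed[OF l] linear_on_add[OF l] in \<open>auto simp: coeff_module_carrier\<close>)
  qed
  have "contraction N s r h" using h lin e by (simp add: contraction_def T.lifts_def)
  then show ?thesis using rs by blast
qed

text \<open>The relation D H + H D = \<tau> - h, where \<open>h\<close> is completed in degree 0 by
  \<alpha> \<circ> \<kappa>. Both chain maps lie over the same map \<open>p r\<close> of
  quotients.\<close>

definition homotopy where
  "homotopy N s r h H \<longleftrightarrow>
    (\<forall>n\<le>N. lin s (P s n) (P r (Suc n)) (H n)) \<and>
    (\<forall>v\<in>carrier (P s 0). D r 0 (H 0 v) = \<tau> s r 0 v \<ominus>\<^bsub>P r 0\<^esub> \<alpha> r (\<kappa> s v)) \<and>
    (\<forall>n<N. \<forall>v\<in>carrier (P s (Suc n)). D r (Suc n) (H (Suc n) v) =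
      (\<tau> s r (Suc n) v \<ominus>\<^bsub>P r (Suc n)\<^esub> h n v) \<ominus>\<^bsub>P r (Suc n)\<^esub> H n (D s n v))"

lemma contraction_J:
  assumes "contraction N s r h" "n \<le> N" "v \<in> carrier (P s (Suc n))"
  shows "h n v \<in> JP r (Suc n)"
  using assms(1)[unfolded contraction_def, THEN conjunct1, rule_format, OF assms(2)] assms(3)
  by (rule linear_on_closed)

text \<open>On a boundary the term H D D vanishes, and \<open>h (D v)\<close> equals
  \<open>D (h v)\<close>. In degree 0 the subtracted term is \<alpha> (\<kappa> (D v)) = \<alpha> (e
  v), which is again \<open>D (h 0 v)\<close>.\<close>

lemma homotopy_boundary:
  assumes rs: "1 \<le> r" "r \<le> s" and h: "contraction N s r h" and H: "homotopy N s r h H"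
    and v: "v \<in> carrier (P s (Suc N))"
  shows "D r N (H N (D s N v)) = \<tau> s r N (D s N v) \<ominus>\<^bsub>P r N\<^esub> D r N (h N v)"
proof (cases N)
  case 0
  have "D s 0 v \<in> carrier (P s 0)" using linear_on_closed[OF D_linear v] rs 0 by simp
  then show ?thesis using H h v 0 by (simp add: homotopy_def contraction_def e_def)
next
  case (Suc M)
  have s: "1 \<le> s" using rs by simp
  interpret G: abelian_group "P r N" by (rule P_abelian_group[OF rs(1)])
  have Dv: "D s N v \<in> carrier (P s N)" by (rule linear_on_closed[OF D_linear[OF s] v])
  have hD: "h M (D s N v) \<in> carrier (P r N)"
    using contraction_J[OF h, of M "D s N v"] JP_subset[OF rs(1)] Dv Suc by auto
  have "lin s (P s M) (P r (Suc M)) (H M)" using H Suc by (simp add: homotopy_def)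
  from linear_on_zero[OF this P_abelian_group[OF s] P_abelian_group[OF rs(1)]]
  have "H M (D s M (D s N v)) = \<zero>\<^bsub>P r N\<^esub>" using D_D[OF s, of v M] v Suc by (simp add: zero_res)
  moreover have "D r N (h N v) = h M (D s N v)" using h v Suc by (simp add: contraction_def)
  moreover have "D r N (H N (D s N v)) =
      (\<tau> s r N (D s N v) \<ominus>\<^bsub>P r N\<^esub> h M (D s N v)) \<ominus>\<^bsub>P r N\<^esub> H M (D s M (D s N v))"
    using H Dv Suc by (simp add: homotopy_def)
  ultimately show ?thesis
    using G.minus_zero_right[OF G.minus_closed[OF linear_on_closed[OF \<tau>_linear[OF rs] Dv] hD]] by simp
qed

text \<open>The comparison of two lifts of one map into an exact complex. No level is lost here,
  because \<open>P r\<close> is exact and not merely pro-exact.\<close>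

lemma homotopy_exists:
  assumes rs: "1 \<le> r" "r \<le> s" and h: "contraction N s r h"
  shows "\<exists>H. homotopy N s r h H"
  using h
proof (induction N)
  case 0
  have s: "1 \<le> s" using rs by simp
  let ?f = "\<lambda>v. \<tau> s r 0 v \<ominus>\<^bsub>P r 0\<^esub> \<alpha> r (\<kappa> s v)"
  have "lin s (S s) (P r 0) (\<alpha> r)"
    using \<alpha>_linear[OF rs(1)] incl_closed[OF rs] incl_add[OF rs] incl_mult[OF rs] by (simp add: linear_on_def Pi_iff)
  from linear_on_compose[OF \<kappa>_linear[OF s] this]
  have f: "lin s (P s 0) (P r 0) ?f"
    by (rule linear_on_minus_fun[OF \<tau>_linear[OF rs] _ P_lmodule_le[OF rs] order.refl P_abelian_group[OF s]])
  have "cyc r 0 (?f (bas s x))" if x0: "x \<in> X s 0" for x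
  proof -
    obtain q where x: "x = Gen q" and q: "q \<in> carrier (Q s)" using x0 by (auto simp: left_via_def)
    have xc: "bas s x \<in> carrier (P s 0)"
      by (rule lmodule.basis_in_res[OF L_lmodule[OF s] x0])
    have pq: "p r q \<in> carrier (Q r)" by (rule ring_hom_closed[OF trans_hom[OF rs] q])
    have sq: "sec s q \<in> carrier (A r)" by (rule incl_closed[OF rs sec(1)[OF s q]])
    have k: "\<kappa> s (bas s x) = sec s q" unfolding x by (rule \<kappa>_basis[OF s q])
    \<comment> \<open>Two representatives of the same element \<open>p r q\<close>, one chosen at
      each level. Their difference lies in \<open>J r\<close>, so that by \<open>cyc_0_iff\<close>
      the vector is a cycle.\<close>
    have "\<kappa> r (?f (bas s x)) = sec r (p r q) \<ominus>\<^bsub>A r\<^esub> sec s q"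
    proof -
      have pc: "bas r (Gen (p r q)) \<in> carrier (P r 0)"
        by (rule lmodule.basis_in_res[OF L_lmodule[OF rs(1)]]) (use pq in \<open>simp add: left_via_def\<close>)
      have "\<kappa> r (?f (bas s x)) =
          \<kappa> r (bas r (Gen (p r q))) \<ominus>\<^bsub>S r\<^esub> \<kappa> r (\<alpha> r (sec s q))"
        using linear_on_diff[OF \<kappa>_linear[OF rs(1)] P_abelian_group[OF rs(1)]
          lmodule.axioms(2)[OF S_lmodule[OF rs(1)]] pc \<alpha>_closed[OF rs(1) sq]] k \<tau>_basis_Gen[OF rs q] x
        by simp
      then show ?thesis
        using \<kappa>_basis[OF rs(1) pq] \<kappa>_\<alpha>[OF rs(1) sq] by (simp add: a_minus_def a_inv_def m_inv_def)
    qed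
    moreover have "sec r (p r q) \<ominus>\<^bsub>A r\<^esub> sec s q \<in> J r"
    proof -
      interpret hom: ring_hom_ring "A r" "Q r" "\<pi> r" by (rule proj_ring_hom_ring[OF rs(1)])
      have "\<pi> r (sec s q) = p r q"
        using trans_proj[OF rs sec(1)[OF s q]] sec(2)[OF s q] by simp
      then show ?thesis
        using sec[OF rs(1) pq] sq pq by (simp add: J_iff a_minus_def hom.S.r_neg)
    qed
    ultimately show ?thesis using cyc_0_iff[OF rs(1)] linear_on_closed[OF f xc] by simp
  qed
  then have ex: "\<exists>w\<in>carrier (P r (Suc 0)). D r 0 w = ?f (bas s x)" if "x \<in> X s 0" for x
    using exact[OF rs(1)] linear_on_closed[OF f] lmodule.basis_in_res[OF L_lmodule[OF s] that] that by blast
  obtain g where "lin s (P s 0) (P r (Suc 0)) g"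
    "\<And>v. v \<in> carrier (P s 0) \<Longrightarrow> D r 0 (g v) = ?f v"
    using lmodule.res_projective[OF L_lmodule[OF s] P_lmodule_le[OF rs] P_abelian_group[OF rs(1)]
      linear_on_subset[OF D_linear[OF rs(1)] incl_subset[OF rs]] f ex] by blast
  then have "homotopy 0 s r h (\<lambda>_. g)" by (simp add: homotopy_def)
  then show ?case by blast
next
  case (Suc N)
  have s: "1 \<le> s" using rs by simp
  interpret G: abelian_group "P r (Suc N)" by (rule P_abelian_group[OF rs(1)])
  interpret G': abelian_group "P r N" by (rule P_abelian_group[OF rs(1)])
  have h': "contraction N s r h" using Suc.prems by (simp add: contraction_def)
  obtain H where H: "homotopy N s r h H" using Suc.IH[OF h'] by blast
  have H_lin: "lin s (P s N) (P r (Suc N)) (H N)" using H by (simp add: homotopy_def)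
  have h_lin: "lin s (P s (Suc N)) (P r (Suc N)) (h N)"
    by (rule linear_into_P[OF h'[unfolded contraction_def, THEN conjunct1, rule_format, OF order.refl] rs(1)])
  let ?f = "\<lambda>v. (\<tau> s r (Suc N) v \<ominus>\<^bsub>P r (Suc N)\<^esub> h N v) \<ominus>\<^bsub>P r (Suc N)\<^esub> H N (D s N v)"
  note minus = linear_on_minus_fun[OF _ _ P_lmodule_le[OF rs] order.refl P_abelian_group[OF s]]
  have f: "lin s (P s (Suc N)) (P r (Suc N)) ?f"
    by (intro minus \<tau>_linear[OF rs] h_lin linear_on_compose[OF D_linear[OF s] H_lin])
  have cyc: "cyc r (Suc N) (?f v)" if v: "v \<in> carrier (P s (Suc N))" for v
  proof -
    have Dv: "D s N v \<in> carrier (P s N)" by (rule linear_on_closed[OF D_linear[OF s] v])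
    note c = linear_on_closed[OF \<tau>_linear[OF rs] v] linear_on_closed[OF h_lin v]
      linear_on_closed[OF H_lin Dv]
    note diff = linear_on_diff[OF D_linear[OF rs(1)] P_abelian_group[OF rs(1)] P_abelian_group[OF rs(1)]]
    have D_f: "D r N (?f v) = (\<tau> s r N (D s N v) \<ominus>\<^bsub>P r N\<^esub> D r N (h N v)) \<ominus>\<^bsub>P r N\<^esub> D r N (H N (D s N v))"
      using diff[OF G.minus_closed[OF c(1,2)] c(3)] diff[OF c(1,2)] \<tau>_diff[OF rs v] by simp
    note eq = homotopy_boundary[OF rs h' H v]
    have "\<tau> s r N (D s N v) \<ominus>\<^bsub>P r N\<^esub> D r N (h N v) \<in> carrier (P r N)"
      using linear_on_closed[OF \<tau>_linear[OF rs] Dv] linear_on_closed[OF D_linear[OF rs(1)] c(2)]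
      by (rule G'.minus_closed)
    then have "D r N (?f v) = \<zero>\<^bsub>P r N\<^esub>"
      unfolding D_f eq by (simp add: a_minus_def[of "P r N" "_ \<ominus>\<^bsub>P r N\<^esub> _"] G'.r_neg)
    then show ?thesis by (simp add: zero_res)
  qed
  then have ex: "\<exists>w\<in>carrier (P r (Suc (Suc N))). D r (Suc N) w = ?f (bas s x)" if "x \<in> X s (Suc N)" for x
    using exact[OF rs(1)] linear_on_closed[OF f] lmodule.basis_in_res[OF L_lmodule[OF s] that] by blast
  obtain g where g: "lin s (P s (Suc N)) (P r (Suc (Suc N))) g"
    and Dg: "\<And>v. v \<in> carrier (P s (Suc N)) \<Longrightarrow> D r (Suc N) (g v) = ?f v"
    using lmodule.res_projective[OF L_lmodule[OF s] P_lmodule_le[OF rs] P_abelian_group[OF rs(1)]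
      linear_on_subset[OF D_linear[OF rs(1)] incl_subset[OF rs]] f ex] by blast
  have "homotopy (Suc N) s r h (\<lambda>n. if n \<le> N then H n else g)"
    using H g Dg by (simp add: homotopy_def le_Suc_eq less_Suc_eq)
  then show ?case by blast
qed

text \<open>The witness is h v + H (D v). The first summand has coefficients in \<open>J r\<close>
  for every \<open>v\<close>, the second because \<open>D v\<close> has its coefficients in
  \<open>J s\<close>; by \<open>homotopy_boundary\<close> the sum has the same boundary as \<tau>
  v.\<close>

lemma contraction_tor_null:
  assumes rs: "1 \<le> r" "r \<le> s" and h: "contraction N s r h"
  shows "tor_null s r N"
  unfolding tor_null_def
proof (intro ballI impI)
  fix v assume v: "v \<in> carrier (P s (Suc N))" and Dv: "D s N v \<in> JP s N"
  have s: "1 \<le> s" using rs by simp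
  interpret G: abelian_group "P r N" by (rule P_abelian_group[OF rs(1)])
  obtain H where H: "homotopy N s r h H" using homotopy_exists[OF rs h] by blast
  have hJ: "h N v \<in> JP r (Suc N)" by (rule contraction_J[OF h order.refl v])
  have "lin s (P s N) (P r (Suc N)) (H N)" using H by (simp add: homotopy_def)
  then have HJ: "H N (D s N v) \<in> JP r (Suc N)" using linear_maps_J[OF _ rs Dv] by (simp add: res_def)
  have DvP: "D s N v \<in> carrier (P s N)" by (rule linear_on_closed[OF D_linear[OF s] v])
  let ?w = "h N v \<oplus>\<^bsub>P r (Suc N)\<^esub> H N (D s N v)"
  have wJ: "?w \<in> JP r (Suc N)"
    using coeff_add[OF ring_A[OF rs(1)] J_subgroup[OF rs(1)] hJ HJ] by (simp add: res_def free_module_def)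
  have hP: "h N v \<in> carrier (P r (Suc N))" and HP: "H N (D s N v) \<in> carrier (P r (Suc N))"
    using JP_subset[OF rs(1)] hJ HJ by blast+
  have "D r N ?w = D r N (h N v) \<oplus>\<^bsub>P r N\<^esub> (\<tau> s r N (D s N v) \<ominus>\<^bsub>P r N\<^esub> D r N (h N v))"
    using linear_on_add[OF D_linear[OF rs(1)] hP HP] homotopy_boundary[OF rs h H v] by simp
  also have "\<dots> = \<tau> s r N (D s N v)"
    using linear_on_closed[OF D_linear[OF rs(1)] hP] linear_on_closed[OF \<tau>_linear[OF rs] DvP]
    by (simp add: a_minus_def G.a_ac G.r_neg2 G.r_neg G.r_neg1)
  finally show "\<exists>w\<in>JP r (Suc N). D r N w = D r N (\<tau> s r (Suc N) v)"
    using wJ \<tau>_diff[OF rs v] by auto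
qed

end

section \<open>From \<open>J P\<close> over \<open>A\<close> to the resolution over
  \<open>B\<close>\<close>

context tower_transfer
begin

text \<open>A factor \<open>j\<close> from the kernel is thereby also a scalar from
  \<open>B\<close>, which \<open>B\<close>-linear maps let pass. This depends on \<sigma> being
  multiplicative.\<close>

lemma \<rho>_\<sigma>:
  assumes "1 \<le> r" "i \<in> A.J r" "j \<in> A.J r"
  shows "\<rho> (\<sigma> j) i = j \<otimes>\<^bsub>A r\<^esub> i"
proof -
  interpret K: ideal "A.J r" "A r" by (rule A.J_ideal[OF assms(1)])
  have \<sigma>j: "\<sigma> j \<in> carrier (B r)" by (rule B_J_carrier[OF \<sigma>_closed[OF assms(1,3)]])
  show ?thesis
    using \<sigma>_inj[OF assms(1) \<rho>_closed[OF assms(1) \<sigma>j assms(2)], of "j \<otimes>\<^bsub>A r\<^esub> i"]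
      \<sigma>_\<rho>[OF assms(1) \<sigma>j assms(2)] \<sigma>_mult[OF assms(1,3,2)] K.I_r_closed[OF assms(3)] assms(2)
    by simp
qed

text \<open>Realizes \<open>J P\<close> over \<open>A\<close> as a submodule of the free
  \<open>B\<close>-module on the same cells.\<close>

lemma \<sigma>_coeff_linear:
  assumes r: "1 \<le> r"
  shows "B.lin r (JC r Y)
    (JCB r Y) (\<lambda>v x. \<sigma> (v x))"
proof (rule linear_onI)
  fix v assume v: "v \<in> carrier (JC r Y)"
  then have "{x. \<sigma> (v x) \<noteq> \<zero>\<^bsub>B r\<^esub>} \<subseteq> {x. v x \<noteq> \<zero>\<^bsub>A r\<^esub>}" using \<sigma>_zero[OF r] by auto
  then show "(\<lambda>x. \<sigma> (v x)) \<in> carrier (JCB r Y)"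
    using v \<sigma>_zero[OF r] \<sigma>_closed[OF r] by (auto simp: coeff_module_carrier intro: finite_subset)
qed (auto simp: coeff_module_carrier \<sigma>_add[OF r] \<sigma>_\<rho>[OF r])

text \<open>A substitute for projectivity of \<open>J P\<close>. By \<sigma> it sits in the free
  \<open>B\<close>-module on \<open>Y\<close>; the map \<open>G\<close> of that module with
  \<open>e_x\<close> going to \<open>y\<close>, restricted to \<open>J P\<close>, lifts
  \<open>f\<close>. This works because in the last hypothesis \<open>y\<close> depends on
  \<open>x\<close> but not on \<open>j\<close>.\<close>

lemma twisted_projective:
  assumes tr: "1 \<le> t" "t \<le> r" and N: "abelian_group N" and d: "B.lin r (B.P t m) N d"
    and f: "linear_on {} (JC r Y) N f"
    and ex: "\<And>x. x \<in> Y \<Longrightarrow> \<exists>y\<in>carrier (B.P t m). \<forall>j\<in>A.J r. f (single (A r) j x) = \<sigma> j \<odot>\<^bsub>N\<^esub> d y"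
  shows "\<exists>g. B.lin r (JC r Y) (JB t m) g \<and>
    (\<forall>v\<in>carrier (JC r Y). d (g v) = f v)"
proof -
  have r: "1 \<le> r" using tr by simp
  interpret Br: ring "B r" by (rule B.ring_A[OF r])
  obtain G where G: "B.lin r (free_module (B r) Y) (B.P t m) G"
    and Gx: "\<And>x j. x \<in> Y \<Longrightarrow> j \<in> A.J r \<Longrightarrow>
      f (single (A r) j x) = \<sigma> j \<odot>\<^bsub>N\<^esub> d (G (B.bas r x))"
    using Br.free_extend[OF B.P_lmodule_le[OF tr],
        of Y m "\<lambda>x y. \<forall>j\<in>A.J r. f (single (A r) j x) = \<sigma> j \<odot>\<^bsub>N\<^esub> d y"] ex by blast
  define g where "g v = G (\<lambda>x. \<sigma> (v x))" for v
  have GJ: "B.lin r (JCB r Y) (JB t m) G"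
  proof (rule linear_onI)
    fix v assume "v \<in> carrier (JCB r Y)"
    then show "G v \<in> carrier (JB t m)" using B.linear_maps_J[OF _ tr] G by (simp add: res_def)
  next
    fix v w assume "v \<in> carrier (JCB r Y)"
      "w \<in> carrier (JCB r Y)"
    then show "G (v \<oplus>\<^bsub>JCB r Y\<^esub> w) = G v \<oplus>\<^bsub>JB t m\<^esub> G w"
      using linear_on_add[OF G, of v w]
      by (auto simp: res_def free_module_def coeff_module_carrier B_J_carrier)
  next
    fix b v assume "b \<in> carrier (B r)" "v \<in> carrier (JCB r Y)"
    then show "G (b \<odot>\<^bsub>JCB r Y\<^esub> v) = b \<odot>\<^bsub>JB t m\<^esub> G v"
      using linear_on_smult[OF G, of b v]
      by (auto simp: res_def free_module_def coeff_module_carrier B_J_carrier)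
  qed
  have g: "B.lin r (JC r Y) (JB t m) g"
    using linear_on_compose[OF \<sigma>_coeff_linear[OF r] GJ] by (simp add: g_def[abs_def])
  have "d (g v) = f v" if "v \<in> carrier (JC r Y)" for v
  proof (rule coeff_eqI[OF A.ring_A[OF r] A.J_subgroup[OF r] _ f coeff_T_abelian_group[OF r] N _ that])
    show "linear_on {} (JC r Y) N (\<lambda>v. d (g v))"
      using linear_on_subset[OF linear_on_compose[OF B.linear_into_P[OF g tr(1)] d]] by simp
    fix j x assume j: "j \<in> A.J r" and x: "x \<in> Y"
    have \<sigma>j: "\<sigma> j \<in> carrier (B r)" by (rule B_J_carrier[OF \<sigma>_closed[OF r j]])
    have b: "B.bas r x \<in> carrier (free_module (B r) Y)" by (rule Br.basis_closed[OF x])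
    have "(\<lambda>y. \<sigma> (single (A r) j x y)) = single (B r) (\<sigma> j) x"
      using \<sigma>_zero[OF r] by (auto simp: single_def)
    then have "g (single (A r) j x) = \<sigma> j \<odot>\<^bsub>B.P t m\<^esub> G (B.bas r x)"
      using linear_on_smult[OF G \<sigma>j b] Br.single_smult[OF \<sigma>j, of x Y] by (simp add: g_def)
    then show "d (g (single (A r) j x)) = f (single (A r) j x)"
      using linear_on_smult[OF d \<sigma>j linear_on_closed[OF G b]] Gx[OF x j] by simp
  qed
  then show ?thesis using g by blast
qed

text \<open>These maps are defined on elements of \<open>J P\<close> only. To extend such a family by one degree, it is
  first composed with a contraction \<open>h\<close>: on a basis vector \<open>x\<close>, the element \<open>h (d x)\<close> has coefficients
  in \<open>J\<close> although \<open>d x\<close> need not have.\<close>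

definition descents :: "nat \<Rightarrow> nat \<Rightarrow> nat \<Rightarrow> (nat \<Rightarrow> (('a, 'q) cell \<Rightarrow> 'a) \<Rightarrow> ('b, 'q2) cell \<Rightarrow> 'b) \<Rightarrow> bool" where
  "descents N r t \<delta> \<longleftrightarrow>
    (\<forall>n\<le>N. B.lin r (JT r (Suc n)) (JB t (Suc n)) (\<delta> n)) \<and>
    (\<forall>v\<in>carrier (JT r (Suc 0)). B.D t 0 (\<delta> 0 v) = B.\<alpha> t (\<sigma> (A.e r v))) \<and>
    (\<forall>n<N. \<forall>v\<in>carrier (JT r (Suc (Suc n))). B.D t (Suc n) (\<delta> (Suc n) v) = \<delta> n (A.D r (Suc n) v))"

lemma
  assumes "descents N r t \<delta>"
  shows descents_linear: "n \<le> N \<Longrightarrow> B.lin r (JT r (Suc n)) (JB t (Suc n)) (\<delta> n)"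
    and descents_0: "v \<in> carrier (JT r (Suc 0)) \<Longrightarrow> B.D t 0 (\<delta> 0 v) = B.\<alpha> t (\<sigma> (A.e r v))"
    and descents_Suc: "n < N \<Longrightarrow> v \<in> carrier (JT r (Suc (Suc n))) \<Longrightarrow>
      B.D t (Suc n) (\<delta> (Suc n) v) = \<delta> n (A.D r (Suc n) v)"
  using assms by (simp_all add: descents_def)

text \<open>The bottom degree can stay at level \<open>t\<close>, since \<open>e\<close> sends basis
  vectors into \<open>J\<close> already. In higher degrees the coefficients of the differential of a
  basis vector are arbitrary elements of the ring.\<close>

lemma descents_exist:
  assumes "\<And>n r. n \<le> N \<Longrightarrow> 1 \<le> r \<Longrightarrow> \<exists>s\<ge>r. A.tor_null s r n" and t: "1 \<le> t"
  shows "\<exists>r\<ge>t. \<exists>\<delta>. descents N r t \<delta>"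
  using assms(1)
proof (induction N)
  case 0
  interpret At: ring "A t" by (rule A.ring_A[OF t])
  let ?f = "\<lambda>v. B.\<alpha> t (\<sigma> (A.e t v))"
  have f: "linear_on {} (JT t (Suc 0)) (B.P t 0) ?f"
  proof (rule linear_onI)
    fix v assume v: "v \<in> carrier (JT t (Suc 0))"
    note ev = A.e_in_J[OF t JT_P[OF t v]]
    show "?f v \<in> carrier (B.P t 0)" by (rule B.\<alpha>_closed[OF t B_J_carrier[OF \<sigma>_closed[OF t ev]]])
    fix w assume w: "w \<in> carrier (JT t (Suc 0))"
    note ew = A.e_in_J[OF t JT_P[OF t w]]
    have "A.e t (v \<oplus>\<^bsub>JT t (Suc 0)\<^esub> w) = A.e t v \<oplus>\<^bsub>A t\<^esub> A.e t w"
      using linear_on_add[OF A.e_linear[OF t] JT_P[OF t v] JT_P[OF t w]]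
      by (simp add: res_def free_module_def)
    then show "?f (v \<oplus>\<^bsub>JT t (Suc 0)\<^esub> w) = ?f v \<oplus>\<^bsub>B.P t 0\<^esub> ?f w"
      using \<sigma>_add[OF t ev ew] linear_on_add[OF B.\<alpha>_linear[OF t], of "\<sigma> (A.e t v)" "\<sigma> (A.e t w)"]
        B_J_carrier[OF \<sigma>_closed[OF t ev]] B_J_carrier[OF \<sigma>_closed[OF t ew]] by simp
  qed simp
  have "\<exists>y\<in>carrier (B.P t (Suc 0)). \<forall>j\<in>A.J t. ?f (single (A t) j x) = \<sigma> j \<odot>\<^bsub>B.P t 0\<^esub> B.D t 0 y"
    if x: "x \<in> A.X t (Suc 0)" for x
  proof -
    let ?b = "A.bas t x"
    have b: "?b \<in> carrier (A.P t (Suc 0))" by (rule lmodule.basis_in_res[OF A.L_lmodule[OF t] x])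
    have eb: "A.e t ?b \<in> A.J t" by (rule A.e_in_J[OF t b])
    have \<sigma>e: "\<sigma> (A.e t ?b) \<in> B.J t" by (rule \<sigma>_closed[OF t eb])
    obtain y where y: "y \<in> carrier (B.P t (Suc 0))" "B.D t 0 y = ?f ?b"
      using B.exact[OF t B.\<alpha>_closed[OF t B_J_carrier[OF \<sigma>e]] B.cyc_\<alpha>[OF t \<sigma>e]] by blast
    have "?f (single (A t) j x) = \<sigma> j \<odot>\<^bsub>B.P t 0\<^esub> B.D t 0 y" if j: "j \<in> A.J t" for j
    proof -
      have "A.e t (single (A t) j x) = j \<otimes>\<^bsub>A t\<^esub> A.e t ?b"
        using linear_on_smult[OF A.e_linear[OF t] A_J_carrier[OF j] b]
          At.single_smult[OF A_J_carrier[OF j], of x "A.X t (Suc 0)"] by (simp add: res_def)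
      then have "?f (single (A t) j x) = B.\<alpha> t (\<sigma> j \<otimes>\<^bsub>B t\<^esub> \<sigma> (A.e t ?b))" using \<sigma>_mult[OF t j eb] by simp
      then show ?thesis
        using linear_on_smult[OF B.\<alpha>_linear[OF t] B_J_carrier[OF \<sigma>_closed[OF t j]], of "\<sigma> (A.e t ?b)"]
          B_J_carrier[OF \<sigma>e] y(2) by simp
    qed
    then show ?thesis using y(1) by blast
  qed
  from twisted_projective[OF t order.refl B.P_abelian_group[OF t] B.D_linear[OF t] f this]
  obtain g where g: "B.lin t (JT t (Suc 0)) (JB t (Suc 0)) g"
    and "\<And>v. v \<in> carrier (JT t (Suc 0)) \<Longrightarrow> B.D t 0 (g v) = ?f v" by blast
  then have "descents 0 t t (\<lambda>_. g)" using g by (simp add: descents_def)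
  then show ?case by blast
next
  case (Suc N)
  obtain r \<delta> where tr: "t \<le> r" and \<delta>: "descents N r t \<delta>" using Suc.IH Suc.prems le_SucI by metis
  have r: "1 \<le> r" using t tr by simp
  obtain s h where rs: "r \<le> s" and h: "A.contraction (Suc N) s r h"
    using A.contraction_exists[OF Suc.prems r] by blast
  have s: "1 \<le> s" and ts: "t \<le> s" using r rs tr by auto
  interpret As: ring "A s" by (rule A.ring_A[OF s])
  note \<delta>_lin = descents_linear[OF \<delta>] and \<delta>_0 = descents_0[OF \<delta>] and \<delta>_Suc = descents_Suc[OF \<delta>]
  note h_lin = h[unfolded A.contraction_def, THEN conjunct1, rule_format]
  note h_0 = h[unfolded A.contraction_def, THEN conjunct2, THEN conjunct1, rule_format]
  note h_Suc = h[unfolded A.contraction_def, THEN conjunct2, THEN conjunct2, rule_format]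
  have h_J: "h n v \<in> carrier (JT r (Suc n))" if "n \<le> Suc N" "v \<in> carrier (A.P s (Suc n))" for n v
    using linear_on_closed[OF h_lin[OF that(1)] that(2)] coeff_module_carrier_eq by blast
  have h_T: "B.lin s (JT s (Suc n)) (JT r (Suc n)) (h n)" if "n \<le> Suc N" for n
    using transport_linear[OF A.linear_into_P[OF h_lin[OF that] r, unfolded res_def] r rs] by (simp add: res_def)
  let ?z = "\<lambda>v. \<delta> N (h N (A.D s (Suc N) v))"
  have D_le: "B.lin s (B.P t (Suc n)) (B.P t n) (B.D t n)" for n
    by (rule linear_on_subset[OF B.D_linear[OF t] B.incl_subset[OF t ts]])
  have \<delta>_le: "B.lin s (JT r (Suc n)) (JB t (Suc n)) (\<delta> n)" if "n \<le> N" for n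
    by (rule linear_on_subset[OF \<delta>_lin[OF that] B.incl_subset[OF r rs]])
  have "B.lin s (JT s (Suc (Suc N))) (JB t (Suc N)) ?z"
    using linear_on_compose[OF linear_on_compose[OF D_T_linear[OF s] h_T] \<delta>_le[OF order.refl]] by simp
  then have z: "linear_on {} (JT s (Suc (Suc N))) (B.P t (Suc N)) ?z"
    using linear_on_subset[OF B.linear_into_P[OF _ t]] by blast
  have "\<exists>y\<in>carrier (B.P t (Suc (Suc N))). \<forall>j\<in>A.J s. ?z (single (A s) j x) = \<sigma> j \<odot>\<^bsub>B.P t (Suc N)\<^esub> B.D t (Suc N) y"
    if x: "x \<in> A.X s (Suc (Suc N))" for x
  proof -
    let ?b = "A.bas s x" and ?w = "h (Suc N) (A.bas s x)"
    have b: "?b \<in> carrier (A.P s (Suc (Suc N)))" by (rule lmodule.basis_in_res[OF A.L_lmodule[OF s] x])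
    have w: "?w \<in> carrier (JT r (Suc (Suc N)))" by (rule h_J[OF order.refl b])
    have wP: "?w \<in> carrier (A.P r (Suc (Suc N)))" by (rule JT_P[OF r w])
    \<comment> \<open>As \<open>h\<close> is a chain map, the value on the basis vector is \<delta>
      of a boundary in \<open>J P\<close>; this is why it is a cycle and can be lifted to
      \<open>y\<close>.\<close>
    have z: "?z ?b = \<delta> N (A.D r (Suc N) ?w)" using h_Suc[OF lessI b] by simp
    have DwJ: "A.D r (Suc N) ?w \<in> carrier (JT r (Suc N))" by (rule linear_on_closed[OF D_T_linear[OF r] w])
    have zJ: "?z ?b \<in> carrier (JB t (Suc N))" unfolding z by (rule linear_on_closed[OF \<delta>_lin[OF order.refl] DwJ])
    have "B.cyc t (Suc N) (?z ?b)"
    proof (cases N)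
      case 0
      have "B.\<alpha> t (\<sigma> \<zero>\<^bsub>A r\<^esub>) = \<zero>\<^bsub>B.P t 0\<^esub>"
        using linear_on_zero[OF B.\<alpha>_linear[OF t] lmodule.axioms(2)[OF B.S_lmodule[OF t]] B.P_abelian_group[OF t]]
          \<sigma>_zero[OF r] B.incl_zero[OF t tr] by simp
      then show ?thesis using \<delta>_0 DwJ A.e_D[OF r] wP 0 z by (simp add: zero_res)
    next
      case (Suc M)
      have "B.D t N (?z ?b) = \<delta> M (A.D r N (A.D r (Suc N) ?w))" using \<delta>_Suc[of M] DwJ Suc z by simp
      also have "\<dots> = \<delta> M \<zero>\<^bsub>JT r N\<^esub>" using A.D_D[OF r wP] Suc by simp
      also have "\<dots> = \<zero>\<^bsub>JB t N\<^esub>"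
        using linear_on_zero[OF \<delta>_lin[of M] coeff_T_abelian_group[OF r]
          lmodule.axioms(2)[OF coeff_lmodule[OF B.ring_A[OF t] B.J_subgroup[OF t] B.J_lmodule[OF t]]]] Suc by simp
      finally show ?thesis by simp
    qed
    then obtain y where y: "y \<in> carrier (B.P t (Suc (Suc N)))" "B.D t (Suc N) y = ?z ?b"
      using B.exact[OF t] B.JP_subset[OF t] zJ by blast
    have Db: "A.D s (Suc N) ?b \<in> carrier (A.P s (Suc N))" by (rule linear_on_closed[OF A.D_linear[OF s] b])
    have hD: "h N (A.D s (Suc N) ?b) \<in> carrier (JT r (Suc N))" by (rule h_J[OF _ Db]) simp
    have "?z (single (A s) j x) = \<sigma> j \<odot>\<^bsub>B.P t (Suc N)\<^esub> B.D t (Suc N) y" if j: "j \<in> A.J s" for j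
    proof -
      have jA: "j \<in> carrier (A s)" by (rule A_J_carrier[OF j])
      have jr: "j \<in> A.J r" using A.J_mono[OF r rs] j by blast
      have \<sigma>j: "\<sigma> j \<in> carrier (B r)" by (rule B_J_carrier[OF \<sigma>_closed[OF r jr]])
      have "A.D s (Suc N) (single (A s) j x) = j \<odot>\<^bsub>A.P s (Suc N)\<^esub> A.D s (Suc N) ?b"
        using linear_on_smult[OF A.D_linear[OF s] jA b] As.single_smult[OF jA, of x "A.X s (Suc (Suc N))"]
        by (simp add: res_def)
      then have "h N (A.D s (Suc N) (single (A s) j x)) = (\<lambda>y. j \<otimes>\<^bsub>A r\<^esub> h N (A.D s (Suc N) ?b) y)"
        using linear_on_smult[OF h_lin[of N] jA Db] by simp
      \<comment> \<open>Both factors are now in \<open>J\<close>, so \<open>j\<close> can act as the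
        scalar \<sigma> j of \<open>B\<close>, which the \<open>B\<close>-linear map \<delta> lets
        pass. On the coefficients of the differential itself, \<open>B\<close> does not act.\<close>
      also have "\<dots> = \<sigma> j \<odot>\<^bsub>JT r (Suc N)\<^esub> h N (A.D s (Suc N) ?b)"
        using hD jr by (simp add: coeff_module_carrier \<rho>_\<sigma>[OF r])
      finally show ?thesis
        using linear_on_smult[OF \<delta>_lin[OF order.refl] \<sigma>j hD] y(2) by (simp add: res_def free_module_def)
    qed
    then show ?thesis using y(1) by blast
  qed
  from twisted_projective[OF t ts B.P_abelian_group[OF t] D_le z this]
  obtain g where g: "B.lin s (JT s (Suc (Suc N))) (JB t (Suc (Suc N))) g"
    and Dg: "\<And>v. v \<in> carrier (JT s (Suc (Suc N))) \<Longrightarrow> B.D t (Suc N) (g v) = ?z v" by blast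
  \<comment> \<open>The old maps are composed with \<open>h\<close> as well: the differential of the
    new map is \<delta> (h (D v)), and the old degrees have to match it.\<close>
  let ?\<delta> = "\<lambda>n v. if n \<le> N then \<delta> n (h n v) else g v"
  have "descents (Suc N) s t ?\<delta>"
    unfolding descents_def
  proof (intro conjI allI impI ballI)
    fix n assume n: "n \<le> Suc N"
    show "B.lin s (JT s (Suc n)) (JB t (Suc n)) (?\<delta> n)"
    proof (cases "n \<le> N")
      case True
      then show ?thesis using linear_on_compose[OF h_T[OF n] \<delta>_le[OF True]] by simp
    next
      case False
      then show ?thesis using n g by (simp add: le_Suc_eq)
    qed
  next
    fix v assume v: "v \<in> carrier (JT s (Suc 0))"
    have vP: "v \<in> carrier (A.P s (Suc 0))" by (rule JT_P[OF s v])
    have "A.e s v \<in> carrier (A r)" by (rule A.incl_closed[OF r rs A_J_carrier[OF A.e_in_J[OF s vP]]])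
    \<comment> \<open>The bottom condition survives the composition: the differential of
      \<open>h 0 v\<close> is \<alpha> (e v), and \<kappa> \<circ> \<alpha> is the identity.\<close>
    then have "A.e r (h 0 v) = A.e s v"
      unfolding A.e_def[of r] using h_0[OF vP] A.\<kappa>_\<alpha>[OF r] by simp
    then show "B.D t 0 (?\<delta> 0 v) = B.\<alpha> t (\<sigma> (A.e s v))" using \<delta>_0[OF h_J[OF _ vP]] by simp
  next
    fix n v assume n: "n < Suc N" and v: "v \<in> carrier (JT s (Suc (Suc n)))"
    have vP: "v \<in> carrier (A.P s (Suc (Suc n)))" by (rule JT_P[OF s v])
    show "B.D t (Suc n) (?\<delta> (Suc n) v) = ?\<delta> n (A.D s (Suc n) v)"
    proof (cases "n < N")
      case True
      then show ?thesis using \<delta>_Suc[OF True h_J[OF _ vP]] h_Suc[OF n vP] by simp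
    next
      case False
      then have "n = N" using n by simp
      then show ?thesis using Dg v by simp
    qed
  qed
  then show ?case using ts by blast
qed

theorem tor_null_transfer:
  assumes null: "\<And>n r. 1 \<le> r \<Longrightarrow> \<exists>s\<ge>r. A.tor_null s r n" and t: "1 \<le> t"
  shows "\<exists>s\<ge>t. B.tor_null s t n"
proof -
  \<comment> \<open>The descents come first, as they determine the level \<open>r\<close> at which
    the lifts have to end.\<close>
  obtain r \<delta> where tr: "t \<le> r" and \<delta>: "descents n r t \<delta>" using descents_exist[OF null t] by blast
  have r: "1 \<le> r" using t tr by simp
  obtain s \<beta> where rs: "r \<le> s" and \<beta>: "lifts n s r \<beta>" using lifts_exist[OF null r] by blast
  have s: "1 \<le> s" and ts: "t \<le> s" using r rs tr by auto
  note \<delta>_lin = descents_linear[OF \<delta>] and \<delta>_0 = descents_0[OF \<delta>] and \<delta>_Suc = descents_Suc[OF \<delta>]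
  note \<beta>_lin = lifts_linear[OF \<beta>] and \<beta>_0 = lifts_0[OF \<beta>] and \<beta>_Suc = lifts_Suc[OF \<beta>]
  have "B.contraction n s t (\<lambda>k v. \<delta> k (\<beta> k v))"
    unfolding B.contraction_def
  proof (intro conjI allI impI ballI)
    fix k assume k: "k \<le> n"
    show "B.lin s (B.P s (Suc k)) (JB t (Suc k)) (\<lambda>v. \<delta> k (\<beta> k v))"
      using linear_on_compose[OF \<beta>_lin[OF k] linear_on_subset[OF \<delta>_lin[OF k] B.incl_subset[OF r rs]]] .
  next
    fix v assume v: "v \<in> carrier (B.P s (Suc 0))"
    note ev = \<sigma>inv[OF s B.e_in_J[OF s v]]
    \<comment> \<open>Here \<kappa> cancels \<alpha>, so that the element of the kernel passes
      unchanged from \<beta> to \<delta>, and \<sigma> undoes \<open>\<sigma>inv\<close>.\<close>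
    have "A.e r (\<beta> 0 v) = \<sigma>inv (B.e s v)"
      unfolding A.e_def using \<beta>_0[OF v] A.\<kappa>_\<alpha>[OF r A.incl_closed[OF r rs A_J_carrier[OF ev(1)]]] by simp
    then show "B.D t 0 (\<delta> 0 (\<beta> 0 v)) = B.\<alpha> t (B.e s v)"
      using \<delta>_0[OF linear_on_closed[OF \<beta>_lin v]] ev(2) by simp
  next
    fix k v assume k: "k < n" and v: "v \<in> carrier (B.P s (Suc (Suc k)))"
    show "B.D t (Suc k) (\<delta> (Suc k) (\<beta> (Suc k) v)) = \<delta> k (\<beta> k (B.D s (Suc k) v))"
      using \<delta>_Suc[OF k linear_on_closed[OF \<beta>_lin v]] \<beta>_Suc[OF k v] k by simp
  qed
  then show ?thesis using B.contraction_tor_null[OF t ts] ts by blast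
qed

end

section \<open>Tor in terms of the standard resolution\<close>

text \<open>Additivity of \<open>h\<close> is asked for only on sums of \<open>x\<close> with
  elements of \<open>H'\<close>: in the application to Tor, \<open>h\<close> is a
  \<open>tensor_map\<close>, which is known on cosets of elementary tensors. For the reverse
  inclusion any \<open>b\<close> in \<open>H'\<close> will do, corrected by the inverse of
  \<open>h b\<close>.\<close>

lemma induced_map_coset:
  assumes "group G" "subgroup H G" "H' \<noteq> {}" "h x \<in> carrier G"
    and "\<And>b. b \<in> H' \<Longrightarrow> h b \<in> H" and "\<And>b. b \<in> H' \<Longrightarrow> h (b \<otimes>\<^bsub>G'\<^esub> x) = h b \<otimes>\<^bsub>G\<^esub> h x"
  shows "induced_map G H h (H' #>\<^bsub>G'\<^esub> x) = H #>\<^bsub>G\<^esub> h x"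
proof -
  interpret group G by fact
  interpret subgroup H G by fact
  obtain b where b: "b \<in> H'" using assms(3) by blast
  show ?thesis
  proof (intro equalityI subsetI)
    fix y assume "y \<in> induced_map G H h (H' #>\<^bsub>G'\<^esub> x)"
    then obtain a c where "a \<in> H" "c \<in> H'" "y = a \<otimes>\<^bsub>G\<^esub> h (c \<otimes>\<^bsub>G'\<^esub> x)"
      by (auto simp: induced_map_def set_mult_def r_coset_def)
    then have "y = (a \<otimes>\<^bsub>G\<^esub> h c) \<otimes>\<^bsub>G\<^esub> h x" "a \<otimes>\<^bsub>G\<^esub> h c \<in> H"
      using assms(4-6) by (auto simp: m_assoc)
    then show "y \<in> H #>\<^bsub>G\<^esub> h x" by (auto simp: r_coset_def)
  next
    fix y assume "y \<in> H #>\<^bsub>G\<^esub> h x"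
    then obtain a where a: "a \<in> H" "y = a \<otimes>\<^bsub>G\<^esub> h x" by (auto simp: r_coset_def)
    have hb: "h b \<in> H" by (rule assms(5)[OF b])
    have "y = (a \<otimes>\<^bsub>G\<^esub> inv\<^bsub>G\<^esub> h b) \<otimes>\<^bsub>G\<^esub> h (b \<otimes>\<^bsub>G'\<^esub> x)"
    proof -
      have "inv\<^bsub>G\<^esub> h b \<otimes>\<^bsub>G\<^esub> (h b \<otimes>\<^bsub>G\<^esub> h x) = h x"
        using hb assms(4) by (simp add: m_assoc[symmetric])
      then show ?thesis using a hb assms(4) assms(6)[OF b] by (simp add: m_assoc)
    qed
    moreover have "a \<otimes>\<^bsub>G\<^esub> inv\<^bsub>G\<^esub> h b \<in> H" using a hb by simp
    ultimately show "y \<in> induced_map G H h (H' #>\<^bsub>G'\<^esub> x)"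
      using b by (auto simp: induced_map_def set_mult_def r_coset_def)
  qed
qed

definition tensor_gens ::
  "('r, 'y) ring_scheme \<Rightarrow> ('r, 'm) module \<Rightarrow> ('r, 'n) module \<Rightarrow> ('m \<times> 'n \<Rightarrow>\<^sub>0 int) set"
  where "tensor_gens R M N =
     {frag_of (m \<oplus>\<^bsub>M\<^esub> m', n) - frag_of (m, n) - frag_of (m', n) | m m' n.
         m \<in> carrier M \<and> m' \<in> carrier M \<and> n \<in> carrier N} \<union>
      {frag_of (m, n \<oplus>\<^bsub>N\<^esub> n') - frag_of (m, n) - frag_of (m, n') | m n n'.
         m \<in> carrier M \<and> n \<in> carrier N \<and> n' \<in> carrier N} \<union>
      {frag_of (r \<odot>\<^bsub>M\<^esub> m, n) - frag_of (m, r \<odot>\<^bsub>N\<^esub> n) | r m n.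
         r \<in> carrier R \<and> m \<in> carrier M \<and> n \<in> carrier N}"

lemma tensor_relations_eq:
  "tensor_relations R M N = generate (free_Abelian_group (carrier M \<times> carrier N)) (tensor_gens R M N)"
  by (simp add: tensor_relations_def tensor_gens_def)

abbreviation pairs :: "('r, 'm) module \<Rightarrow> ('r, 'n) module \<Rightarrow> ('m \<times> 'n \<Rightarrow>\<^sub>0 int) monoid"
  where "pairs M N \<equiv> free_Abelian_group (carrier M \<times> carrier N)"

lemma keys_diff_subset:
  "Poly_Mapping.keys a \<subseteq> S \<Longrightarrow> Poly_Mapping.keys b \<subseteq> S \<Longrightarrow> Poly_Mapping.keys (a - b :: 'x \<Rightarrow>\<^sub>0 int) \<subseteq> S"
  using keys_diff by fastforce

text \<open>Exactly the closure properties that place the generating relations in the free abelian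
  group.\<close>

locale tensor_data =
  fixes R :: "('r, 'y) ring_scheme" and M :: "('r, 'm) module" and N :: "('r, 'n) module"
  assumes M_add: "\<And>x y. x \<in> carrier M \<Longrightarrow> y \<in> carrier M \<Longrightarrow> x \<oplus>\<^bsub>M\<^esub> y \<in> carrier M"
    and N_add: "\<And>x y. x \<in> carrier N \<Longrightarrow> y \<in> carrier N \<Longrightarrow> x \<oplus>\<^bsub>N\<^esub> y \<in> carrier N"
    and M_smult: "\<And>a x. a \<in> carrier R \<Longrightarrow> x \<in> carrier M \<Longrightarrow> a \<odot>\<^bsub>M\<^esub> x \<in> carrier M"
    and N_smult: "\<And>a x. a \<in> carrier R \<Longrightarrow> x \<in> carrier N \<Longrightarrow> a \<odot>\<^bsub>N\<^esub> x \<in> carrier N"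
begin

abbreviation "rels \<equiv> tensor_relations R M N"

lemma gens_closed: "tensor_gens R M N \<subseteq> carrier (pairs M N)"
  unfolding tensor_gens_def
  by (intro subsetI, simp only: carrier_free_Abelian_group_iff, elim UnE CollectE exE conjE;
      hypsubst; intro keys_diff_subset; simp add: keys_frag_of M_add N_add M_smult N_smult)

lemma relations_subgroup: "subgroup (rels) (pairs M N)"
  unfolding tensor_relations_eq by (rule group.generate_is_subgroup[OF group_free_Abelian_group gens_closed])

lemma relations_normal: "rels \<lhd> pairs M N"
  by (rule comm_group.subgroup_imp_normal[OF abelian_free_Abelian_group relations_subgroup])

lemma tensor_group: "group (tensor R M N)"
  unfolding tensor_def by (rule normal.factorgroup_is_group[OF relations_normal])

lemma relations_keys: "x \<in> rels \<Longrightarrow> Poly_Mapping.keys x \<subseteq> carrier M \<times> carrier N"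
  using subgroup.mem_carrier[OF relations_subgroup] by simp

lemma relations_add: "x \<in> rels \<Longrightarrow> y \<in> rels \<Longrightarrow> x + y \<in> rels"
  using subgroup.m_closed[OF relations_subgroup] by simp

lemma relations_uminus: "x \<in> rels \<Longrightarrow> - x \<in> rels"
  using subgroup.m_inv_closed[OF relations_subgroup] relations_keys by fastforce

lemma relations_diff: "x \<in> rels \<Longrightarrow> y \<in> rels \<Longrightarrow> x - y \<in> rels"
  using relations_add[OF _ relations_uminus] by fastforce

lemma relations_zero: "0 \<in> rels"
  using subgroup.one_closed[OF relations_subgroup] by simp

lemma relations_coset:
  assumes "x \<in> carrier (pairs M N)" "y \<in> carrier (pairs M N)"
  shows "rels #>\<^bsub>pairs M N\<^esub> x = rels #>\<^bsub>pairs M N\<^esub> y \<longleftrightarrow>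
    x - y \<in> rels"
proof
  assume "rels #>\<^bsub>pairs M N\<^esub> x = rels #>\<^bsub>pairs M N\<^esub> y"
  moreover have "x \<in> rels #>\<^bsub>pairs M N\<^esub> x"
    using relations_zero by (force simp: r_coset_def)
  ultimately obtain h where "h \<in> rels" "x = h + y" by (auto simp: r_coset_def)
  then show "x - y \<in> rels" by simp
next
  assume d: "x - y \<in> rels"
  show "rels #>\<^bsub>pairs M N\<^esub> x = rels #>\<^bsub>pairs M N\<^esub> y"
  proof (intro equalityI subsetI)
    fix z assume "z \<in> rels #>\<^bsub>pairs M N\<^esub> x"
    then obtain h where "h \<in> rels" "z = h + x" by (auto simp: r_coset_def)
    then have "h + (x - y) \<in> rels" "z = (h + (x - y)) + y" using d relations_add by auto
    then show "z \<in> rels #>\<^bsub>pairs M N\<^esub> y"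
      unfolding r_coset_def by (intro UN_I[of "h + (x - y)"]) auto
  next
    fix z assume "z \<in> rels #>\<^bsub>pairs M N\<^esub> y"
    then obtain h where "h \<in> rels" "z = h + y" by (auto simp: r_coset_def)
    then have "h - (x - y) \<in> rels" "z = (h - (x - y)) + x" using d relations_diff by auto
    then show "z \<in> rels #>\<^bsub>pairs M N\<^esub> x"
      unfolding r_coset_def by (intro UN_I[of "h - (x - y)"]) auto
  qed
qed

lemma gens_relations: "x \<in> tensor_gens R M N \<Longrightarrow> x \<in> rels"
  unfolding tensor_relations_eq by (rule generate.incl)

lemma relations_add_left:
  "m \<in> carrier M \<Longrightarrow> m' \<in> carrier M \<Longrightarrow> n \<in> carrier N \<Longrightarrow>
    frag_of (m \<oplus>\<^bsub>M\<^esub> m', n) - frag_of (m, n) - frag_of (m', n) \<in> rels"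
  by (rule gens_relations) (unfold tensor_gens_def, rule UnI1, rule UnI1, blast)

lemma relations_add_right:
  "m \<in> carrier M \<Longrightarrow> n \<in> carrier N \<Longrightarrow> n' \<in> carrier N \<Longrightarrow>
    frag_of (m, n \<oplus>\<^bsub>N\<^esub> n') - frag_of (m, n) - frag_of (m, n') \<in> rels"
  by (rule gens_relations) (unfold tensor_gens_def, rule UnI1, rule UnI2, blast)

lemma relations_smult:
  "a \<in> carrier R \<Longrightarrow> m \<in> carrier M \<Longrightarrow> n \<in> carrier N \<Longrightarrow>
    frag_of (a \<odot>\<^bsub>M\<^esub> m, n) - frag_of (m, a \<odot>\<^bsub>N\<^esub> n) \<in> rels"
  by (rule gens_relations) (unfold tensor_gens_def, rule UnI2, blast)

end

text \<open>Elementary tensors suffice, since with a quotient ring as left factor all elements are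
  of this kind. Generators of the relations over \<open>R\<close> go to relations over
  \<open>S\<close>, the scalars of \<open>R\<close> being scalars of \<open>S\<close>.\<close>

lemma tensor_map_coset:
  assumes src: "tensor_data R M N" and tgt: "tensor_data S M' N'"
    and f: "linear_on (carrier R) M M' f" and g: "linear_on (carrier R) N N' g"
    and RS: "carrier R \<subseteq> carrier S" and m: "m \<in> carrier M" and n: "n \<in> carrier N"
  shows "tensor_map S M' N' f g (tensor_relations R M N #>\<^bsub>pairs M N\<^esub> frag_of (m, n)) =
    tensor_relations S M' N' #>\<^bsub>pairs M' N'\<^esub> frag_of (f m, g n)"
proof -
  interpret src: tensor_data R M N by fact
  interpret tgt: tensor_data S M' N' by fact
  let ?h = "frag_extend (\<lambda>(m, n). frag_of (f m, g n))"
  note f' = linear_on_closed[OF f] linear_on_add[OF f] linear_on_smult[OF f]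
  note g' = linear_on_closed[OF g] linear_on_add[OF g] linear_on_smult[OF g]
  have gens: "?h x \<in> tensor_relations S M' N'" if "x \<in> tensor_gens R M N" for x
    using that unfolding tensor_gens_def[of R]
  proof (elim UnE CollectE exE conjE)
    fix a b c assume x: "x = frag_of (a \<oplus>\<^bsub>M\<^esub> b, c) - frag_of (a, c) - frag_of (b, c)"
      and abc: "a \<in> carrier M" "b \<in> carrier M" "c \<in> carrier N"
    show ?thesis
      using tgt.relations_add_left[OF f'(1)[OF abc(1)] f'(1)[OF abc(2)] g'(1)[OF abc(3)]] f'(2)[OF abc(1,2)]
      by (simp add: x frag_extend_diff)
  next
    fix a b c assume x: "x = frag_of (a, b \<oplus>\<^bsub>N\<^esub> c) - frag_of (a, b) - frag_of (a, c)"
      and abc: "a \<in> carrier M" "b \<in> carrier N" "c \<in> carrier N"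
    show ?thesis
      using tgt.relations_add_right[OF f'(1)[OF abc(1)] g'(1)[OF abc(2)] g'(1)[OF abc(3)]] g'(2)[OF abc(2,3)]
      by (simp add: x frag_extend_diff)
  next
    fix a b c assume x: "x = frag_of (a \<odot>\<^bsub>M\<^esub> b, c) - frag_of (b, a \<odot>\<^bsub>N\<^esub> c)"
      and abc: "a \<in> carrier R" "b \<in> carrier M" "c \<in> carrier N"
    have "a \<in> carrier S" using abc(1) RS by blast
    from tgt.relations_smult[OF this f'(1)[OF abc(2)] g'(1)[OF abc(3)]] show ?thesis
      using f'(3)[OF abc(1,2)] g'(3)[OF abc(1,3)] by (simp add: x frag_extend_diff)
  qed
  have rel: "?h x \<in> tensor_relations S M' N'" if "x \<in> tensor_relations R M N" for x
    using that unfolding tensor_relations_eq[of R]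
  proof (induction rule: generate.induct)
    case one
    then show ?case using tgt.relations_zero by simp
  next
    case (incl h)
    then show ?case by (rule gens)
  next
    case (inv h)
    moreover have "Poly_Mapping.keys h \<subseteq> carrier M \<times> carrier N"
      using subsetD[OF src.gens_closed inv] by simp
    ultimately show ?case using tgt.relations_uminus[OF gens[of h]] by (simp add: frag_extend_minus)
  next
    case (eng a b)
    then show ?case using tgt.relations_add by (simp add: frag_extend_add)
  qed
  have "tensor_relations R M N \<noteq> {}" using src.relations_zero by blast
  then have "induced_map (pairs M' N') (tensor_relations S M' N') ?h (tensor_relations R M N #>\<^bsub>pairs M N\<^esub> frag_of (m, n)) =
    tensor_relations S M' N' #>\<^bsub>pairs M' N'\<^esub> ?h (frag_of (m, n))"
    using m n by (intro induced_map_coset tgt.relations_subgroup) (auto simp: f' g' rel frag_extend_add)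
  then show ?thesis by (simp add: tensor_map_def)
qed

section \<open>Tensor products of a quotient ring with a free module\<close>

locale surj_ring_hom = ring_hom_ring R Q \<pi>
  for R :: "('r, 'y) ring_scheme" and Q :: "('q, 'z) ring_scheme" and \<pi> +
  assumes surj: "\<pi> ` carrier R = carrier Q"
begin

abbreviation "M \<equiv> right_via Q \<pi> :: ('r, 'q) module"
abbreviation "F X \<equiv> free_module R X"
abbreviation "rel X \<equiv> tensor_relations R M (F X)"
abbreviation "G X \<equiv> free_module Q X"
abbreviation "\<iota> v \<equiv> frag_of (\<one>\<^bsub>Q\<^esub>, v)"

text \<open>The element 1 \<otimes> v. As \<pi> is onto, q \<otimes> v = 1 \<otimes> av for any a
  with \<pi> a = q, so every element of the tensor product has this form.\<close>

definition pure :: "'x set \<Rightarrow> ('x \<Rightarrow> 'r) \<Rightarrow> ('q \<times> ('x \<Rightarrow> 'r) \<Rightarrow>\<^sub>0 int) set" where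
  "pure X v = rel X #>\<^bsub>pairs M (F X)\<^esub> \<iota> v"

lemma M_simps [simp]:
  "carrier M = carrier Q" "x \<oplus>\<^bsub>M\<^esub> y = x \<oplus>\<^bsub>Q\<^esub> y" "a \<odot>\<^bsub>M\<^esub> x = x \<otimes>\<^bsub>Q\<^esub> \<pi> a"
  by (simp_all add: right_via_def)

lemma tensor_data: "tensor_data R M (F X)"
proof -
  interpret F: lmodule R "F X" by (rule R.free_lmodule)
  show ?thesis by unfold_locales (auto simp del: R.free_ops)
qed

lemma pure_add_rel:
  assumes "q \<in> carrier Q" "v \<in> carrier (F X)" "w \<in> carrier (F X)"
  shows "frag_of (q, v \<oplus>\<^bsub>F X\<^esub> w) - frag_of (q, v) - frag_of (q, w) \<in> rel X"
  using tensor_data.relations_add_right[OF tensor_data] assms by simp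

lemma pure_smult_rel:
  assumes "a \<in> carrier R" "v \<in> carrier (F X)"
  shows "frag_of (\<pi> a, v) - \<iota> (a \<odot>\<^bsub>F X\<^esub> v) \<in> rel X"
proof -
  have "frag_of (a \<odot>\<^bsub>M\<^esub> \<one>\<^bsub>Q\<^esub>, v) - \<iota> (a \<odot>\<^bsub>F X\<^esub> v) \<in> rel X"
    by (rule tensor_data.relations_smult[OF tensor_data]) (use assms in simp_all)
  then show ?thesis using assms by simp
qed

lemma zero_left_rel:
  assumes "v \<in> carrier (F X)" shows "frag_of (\<zero>\<^bsub>Q\<^esub>, v) \<in> rel X"
proof -
  have "frag_of (\<zero>\<^bsub>Q\<^esub> \<oplus>\<^bsub>M\<^esub> \<zero>\<^bsub>Q\<^esub>, v) - frag_of (\<zero>\<^bsub>Q\<^esub>, v) - frag_of (\<zero>\<^bsub>Q\<^esub>, v) \<in> rel X"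
    by (rule tensor_data.relations_add_left[OF tensor_data]) (use assms in simp_all)
  then have "- frag_of (\<zero>\<^bsub>Q\<^esub>, v) \<in> rel X" by simp
  then show ?thesis using tensor_data.relations_uminus[OF tensor_data] by fastforce
qed

lemma pure_diff_rel:
  assumes "v \<in> carrier (F X)" "w \<in> carrier (F X)"
  shows "\<iota> v - \<iota> w - \<iota> (v \<ominus>\<^bsub>F X\<^esub> w) \<in> rel X"
proof -
  interpret F: abelian_group "F X" by (rule R.free_abelian_group)
  have "(v \<ominus>\<^bsub>F X\<^esub> w) \<oplus>\<^bsub>F X\<^esub> w = v"
    using assms by (simp add: a_minus_def F.a_assoc F.l_neg del: R.free_ops)
  then show ?thesis
    using pure_add_rel[of "\<one>\<^bsub>Q\<^esub>" "v \<ominus>\<^bsub>F X\<^esub> w" X w] assms F.minus_closed by (simp add: algebra_simps)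
qed

lemma frag_pure:
  assumes "c \<in> carrier (pairs M (F X))"
  shows "\<exists>v\<in>carrier (F X). c - \<iota> v \<in> rel X"
proof -
  interpret F: lmodule R "F X" by (rule R.free_lmodule)
  interpret T: tensor_data R M "F X" by (rule tensor_data)
  have "Poly_Mapping.keys c \<subseteq> carrier Q \<times> carrier (F X)" using assms by simp
  then show ?thesis
  proof (induction c rule: frag_induction)
    case zero
    have "\<iota> (\<zero>\<^bsub>F X\<^esub> \<oplus>\<^bsub>F X\<^esub> \<zero>\<^bsub>F X\<^esub>) - \<iota> (\<zero>\<^bsub>F X\<^esub>) - \<iota> (\<zero>\<^bsub>F X\<^esub>) \<in> rel X"
      by (rule pure_add_rel) (auto simp del: R.free_ops)
    then show ?case
      by (intro bexI[of _ "\<zero>\<^bsub>F X\<^esub>"]) (auto simp del: R.free_ops)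
  next
    case (one x)
    then obtain q v where x: "x = (q, v)" "q \<in> carrier Q" "v \<in> carrier (F X)" by auto
    then obtain a where "a \<in> carrier R" "q = \<pi> a" using surj by (metis imageE)
    then show ?case using pure_smult_rel[of a v X] x F.smult_closed[of a v] by blast
  next
    case (diff a b)
    then obtain v w where vw: "v \<in> carrier (F X)" "w \<in> carrier (F X)"
      "a - \<iota> v \<in> rel X" "b - \<iota> w \<in> rel X" by blast
    have "(a - b) - \<iota> (v \<ominus>\<^bsub>F X\<^esub> w) =
      ((a - \<iota> v) - (b - \<iota> w)) +
      (\<iota> v - \<iota> w - \<iota> (v \<ominus>\<^bsub>F X\<^esub> w))"
      by simp
    then have "(a - b) - \<iota> (v \<ominus>\<^bsub>F X\<^esub> w) \<in> rel X"
      using T.relations_add[OF T.relations_diff[OF vw(3,4)] pure_diff_rel[OF vw(1,2)]] by metis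
    then show ?case using F.M.minus_closed[OF vw(1,2)] by blast
  qed
qed

text \<open>To see that nothing outside \<open>J P\<close> dies, the tensor product is mapped to the
  free \<open>Q\<close>-module by q \<otimes> v \<mapsto> q \<pi>(v), coordinate by coordinate.
  Conversely, 1 \<otimes> j e_x = \<pi> j \<otimes> e_x = 0 for \<open>j\<close> in the
  kernel.\<close>

lemma pure_rel_iff:
  assumes v: "v \<in> carrier (F X)"
  shows "\<iota> v \<in> rel X \<longleftrightarrow> (\<forall>x. v x \<in> a_kernel R Q \<pi>)"
proof
  assume rel: "\<iota> v \<in> rel X"
  interpret FQ: lmodule Q "G X" by (rule S.free_lmodule)
  let ?f = "\<lambda>(q, v). \<lambda>x. q \<otimes>\<^bsub>Q\<^esub> \<pi> (v x)"
  have val: "v x \<in> carrier R" if "v \<in> carrier (F X)" for v x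
    using that unfolding free_module_eq[OF R.ring_axioms] coeff_module_carrier by blast
  have fc: "?f (q, v) \<in> carrier (G X)" if "q \<in> carrier Q" "v \<in> carrier (F X)" for q v
  proof -
    have "{x. q \<otimes>\<^bsub>Q\<^esub> \<pi> (v x) \<noteq> \<zero>\<^bsub>Q\<^esub>} \<subseteq> {x. v x \<noteq> \<zero>\<^bsub>R\<^esub>}" using that by auto
    then show ?thesis
      using that val[OF that(2)] by (simp add: free_module_def finite_subset[of _ "{x. v x \<noteq> \<zero>\<^bsub>R\<^esub>}"])
  qed
  have f_img: "?f ` (carrier M \<times> carrier (F X)) \<subseteq> carrier (add_monoid (G X))" using fc by auto
  \<comment> \<open>The universal property gives \<open>h\<close> on the free abelian group only;
    that it descends to the tensor product is checked on the three kinds of generating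
    relations.\<close>
  obtain h where h: "h \<in> hom (pairs M (F X)) (add_monoid (G X))"
    and h_of: "\<And>x. x \<in> carrier M \<times> carrier (F X) \<Longrightarrow> h (frag_of x) = ?f x"
    by (rule comm_group.free_Abelian_group_universal[OF FQ.M.a_comm_group f_img]) blast
  interpret h: group_hom "pairs M (F X)" "add_monoid (G X)" h
    by (intro group_hom.intro group_hom_axioms.intro group_free_Abelian_group h FQ.M.a_group)
  interpret T: tensor_data R M "F X" by (rule tensor_data)
  interpret FR: lmodule R "F X" by (rule R.free_lmodule)
  have h_diff: "h (a - b) = h a \<ominus>\<^bsub>G X\<^esub> h b"
    if "a \<in> carrier (pairs M (F X))" "b \<in> carrier (pairs M (F X))" for a b
    using that h.hom_mult[of a "- b"] h.hom_inv[of b] by (simp add: a_minus_def a_inv_def)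
  have fadd: "?f (q, v \<oplus>\<^bsub>F X\<^esub> w) = ?f (q, v) \<oplus>\<^bsub>G X\<^esub> ?f (q, w)"
    if "q \<in> carrier Q" "v \<in> carrier (F X)" "w \<in> carrier (F X)" for q v w
    using that val by (auto simp: S.r_distr)
  have fadd': "?f (q \<oplus>\<^bsub>Q\<^esub> q', v) = ?f (q, v) \<oplus>\<^bsub>G X\<^esub> ?f (q', v)"
    if "q \<in> carrier Q" "q' \<in> carrier Q" "v \<in> carrier (F X)" for q q' v
    using that val by (auto simp: S.l_distr)
  have fmult: "?f (a \<odot>\<^bsub>M\<^esub> q, v) = ?f (q, a \<odot>\<^bsub>F X\<^esub> v)"
    if "a \<in> carrier R" "q \<in> carrier Q" "v \<in> carrier (F X)" for a q v
    using that val by (auto simp: S.m_assoc)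
  have canc: "((a \<oplus>\<^bsub>G X\<^esub> b) \<ominus>\<^bsub>G X\<^esub> a) \<ominus>\<^bsub>G X\<^esub> b = \<zero>\<^bsub>G X\<^esub>"
    if "a \<in> carrier (G X)" "b \<in> carrier (G X)" for a b
  proof -
    have "(a \<oplus>\<^bsub>G X\<^esub> b) \<ominus>\<^bsub>G X\<^esub> a = b"
      using that by (simp add: a_minus_def FQ.M.a_comm[of a b] FQ.M.a_assoc FQ.M.r_neg del: S.free_ops)
    then show ?thesis using that by (simp add: a_minus_def FQ.M.r_neg del: S.free_ops)
  qed
  have h_diff1: "h (frag_of x - frag_of y) = ?f x \<ominus>\<^bsub>G X\<^esub> ?f y"
    if "x \<in> carrier M \<times> carrier (F X)" "y \<in> carrier M \<times> carrier (F X)" for x y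
    using h_diff[of "frag_of x" "frag_of y"] h_of[OF that(1)] h_of[OF that(2)] that by (simp only: frag_of_in_free_Abelian_group)
  have h_diff2: "h (frag_of x - frag_of y - frag_of z) =
      (?f x \<ominus>\<^bsub>G X\<^esub> ?f y) \<ominus>\<^bsub>G X\<^esub> ?f z"
    if "x \<in> carrier M \<times> carrier (F X)" "y \<in> carrier M \<times> carrier (F X)"
      "z \<in> carrier M \<times> carrier (F X)" for x y z
  proof -
    have "frag_of x - frag_of y \<in> carrier (pairs M (F X))"
      using that keys_diff_subset[of "frag_of x" "carrier M \<times> carrier (F X)" "frag_of y"]
      by (simp only: carrier_free_Abelian_group_iff keys_frag_of) blast
    then show ?thesis
      using h_diff[of "frag_of x - frag_of y" "frag_of z"] h_diff1[OF that(1,2)] h_of[OF that(3)] that(3)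
      by (simp only: frag_of_in_free_Abelian_group)
  qed
  have gens: "h x = \<zero>\<^bsub>G X\<^esub>" if "x \<in> tensor_gens R M (F X)" for x
    using that unfolding tensor_gens_def
  proof (elim UnE CollectE exE conjE)
    fix a b c assume x: "x = frag_of (a \<oplus>\<^bsub>M\<^esub> b, c) - frag_of (a, c) - frag_of (b, c)"
      and abc: "a \<in> carrier M" "b \<in> carrier M" "c \<in> carrier (F X)"
    have "h x = (?f (a \<oplus>\<^bsub>Q\<^esub> b, c) \<ominus>\<^bsub>G X\<^esub> ?f (a, c)) \<ominus>\<^bsub>G X\<^esub> ?f (b, c)"
      unfolding x using h_diff2[of "(a \<oplus>\<^bsub>Q\<^esub> b, c)" "(a, c)" "(b, c)"] abc by simp
    then show ?thesis using canc[OF fc fc, of a c b c] fadd'[of a b c] abc by (simp only: M_simps)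
  next
    fix a b c assume x: "x = frag_of (a, b \<oplus>\<^bsub>F X\<^esub> c) - frag_of (a, b) - frag_of (a, c)"
      and abc: "a \<in> carrier M" "b \<in> carrier (F X)" "c \<in> carrier (F X)"
    have bc: "b \<oplus>\<^bsub>F X\<^esub> c \<in> carrier (F X)" by (rule FR.M.a_closed[OF abc(2,3)])
    have "h x = (?f (a, b \<oplus>\<^bsub>F X\<^esub> c) \<ominus>\<^bsub>G X\<^esub> ?f (a, b)) \<ominus>\<^bsub>G X\<^esub> ?f (a, c)"
      unfolding x by (rule h_diff2) (use abc bc in \<open>simp_all del: R.free_ops\<close>)
    then show ?thesis using canc[OF fc fc, of a b a c] fadd[of a b c] abc by (simp only: M_simps)
  next
    fix a b c assume x: "x = frag_of (a \<odot>\<^bsub>M\<^esub> b, c) - frag_of (b, a \<odot>\<^bsub>F X\<^esub> c)"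
      and abc: "a \<in> carrier R" "b \<in> carrier M" "c \<in> carrier (F X)"
    have ac: "a \<odot>\<^bsub>F X\<^esub> c \<in> carrier (F X)" by (rule FR.smult_closed[OF abc(1,3)])
    have "h x = ?f (a \<odot>\<^bsub>M\<^esub> b, c) \<ominus>\<^bsub>G X\<^esub> ?f (b, a \<odot>\<^bsub>F X\<^esub> c)"
      unfolding x by (rule h_diff1) (use abc ac in \<open>simp_all del: R.free_ops\<close>)
    moreover have "?f (b, a \<odot>\<^bsub>F X\<^esub> c) \<in> carrier (G X)"
      by (rule fc) (use abc ac in simp_all)
    moreover have "?f (a \<odot>\<^bsub>M\<^esub> b, c) = ?f (b, a \<odot>\<^bsub>F X\<^esub> c)"
      by (rule fmult) (use abc in simp_all)
    ultimately show ?thesis by (simp only: a_minus_def FQ.M.r_neg)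
  qed
  have "h x = \<zero>\<^bsub>G X\<^esub>" if "x \<in> rel X" for x
    using that unfolding tensor_relations_eq
  proof (induction rule: generate.induct)
    case one
    then show ?case using h.hom_one by simp
  next
    case (incl h)
    then show ?case by (rule gens)
  next
    case (inv y)
    have "y \<in> carrier (pairs M (F X))" using inv T.gens_closed by blast
    then have "h (inv\<^bsub>pairs M (F X)\<^esub> y) = inv\<^bsub>add_monoid (G X)\<^esub> h y" by (rule h.hom_inv)
    moreover have "h y = \<one>\<^bsub>add_monoid (G X)\<^esub>" using gens[OF inv] by simp
    ultimately have "h (inv\<^bsub>pairs M (F X)\<^esub> y) = \<one>\<^bsub>add_monoid (G X)\<^esub>"
      using monoid.inv_one[OF group.is_monoid[OF FQ.M.a_group]] by (simp only:)
    then show ?case by simp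
  next
    case (eng a b)
    have "a \<in> carrier (pairs M (F X))" "b \<in> carrier (pairs M (F X))"
      using eng(1,2) subgroup.mem_carrier[OF T.relations_subgroup] unfolding tensor_relations_eq by blast+
    then show ?case using h.hom_mult[of a b] eng by simp
  qed
  from this[OF rel] have "?f (\<one>\<^bsub>Q\<^esub>, v) = (\<lambda>_. \<zero>\<^bsub>Q\<^esub>)" using h_of[of "(\<one>\<^bsub>Q\<^esub>, v)"] v by simp
  then have z: "\<one>\<^bsub>Q\<^esub> \<otimes>\<^bsub>Q\<^esub> \<pi> (v x) = \<zero>\<^bsub>Q\<^esub>" for x by (simp add: fun_eq_iff)
  show "\<forall>x. v x \<in> a_kernel R Q \<pi>"
  proof
    fix x
    have "v x \<in> carrier R" by (rule val[OF v])
    moreover from this have "\<pi> (v x) = \<zero>\<^bsub>Q\<^esub>" using z[of x] by simp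
    ultimately show "v x \<in> a_kernel R Q \<pi>" unfolding a_kernel_def' by blast
  qed
next
  assume J: "\<forall>x. v x \<in> a_kernel R Q \<pi>"
  interpret K: ideal "a_kernel R Q \<pi>" R by (rule kernel_is_ideal)
  interpret T: tensor_data R M "F X" by (rule tensor_data)
  interpret FR: lmodule R "F X" by (rule R.free_lmodule)
  have FJ: "w \<in> carrier (F X)" if "w \<in> carrier (coeff_module R X (a_kernel R Q \<pi>) \<rho>)" for w \<rho>
    using that by (simp add: free_module_eq[OF R.ring_axioms] coeff_module_carrier)
  have "v \<in> carrier (coeff_module R X (a_kernel R Q \<pi>) (\<lambda>_ x. x))"
    using v J by (simp add: coeff_module_carrier free_module_def)
  then show "\<iota> v \<in> rel X"
  proof (rule coeff_induct[OF R.ring_axioms K.additive_subgroup_axioms, where P = "\<lambda>v. \<iota> v \<in> rel X"])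
    have "\<iota> (\<zero>\<^bsub>F X\<^esub> \<oplus>\<^bsub>F X\<^esub> \<zero>\<^bsub>F X\<^esub>) - \<iota> (\<zero>\<^bsub>F X\<^esub>) - \<iota> (\<zero>\<^bsub>F X\<^esub>) \<in> rel X"
      by (rule pure_add_rel) (auto simp del: R.free_ops)
    then have "- \<iota> (\<zero>\<^bsub>F X\<^esub>) \<in> rel X" by simp
    then show "\<iota> (\<lambda>_. \<zero>\<^bsub>R\<^esub>) \<in> rel X" using T.relations_uminus by fastforce
    fix a x w
    assume a: "a \<in> a_kernel R Q \<pi>" and x: "x \<in> X"
      and w: "w \<in> carrier (coeff_module R X (a_kernel R Q \<pi>) (\<lambda>_ x. x))" "\<iota> w \<in> rel X"
    have aR: "a \<in> carrier R" and \<pi>a: "\<pi> a = \<zero>\<^bsub>Q\<^esub>" using a unfolding a_kernel_def' by blast+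
    have b: "basis_vector R x \<in> carrier (F X)" by (rule R.basis_closed[OF x])
    have sc: "single R a x \<in> carrier (F X)" by (rule R.single_closed[OF aR x])
    have "frag_of (\<zero>\<^bsub>Q\<^esub>, basis_vector R x) - \<iota> (single R a x) \<in> rel X"
      using pure_smult_rel[OF aR b] \<pi>a R.single_smult[OF aR, of x X] by simp
    from T.relations_diff[OF zero_left_rel[OF b] this] have s: "\<iota> (single R a x) \<in> rel X" by simp
    have "\<iota> (single R a x \<oplus>\<^bsub>F X\<^esub> w) - \<iota> (single R a x) - \<iota> w \<in> rel X"
      by (rule pure_add_rel[OF _ sc FJ[OF w(1)]]) simp
    from T.relations_add[OF T.relations_add[OF this w(2)] s]
    show "\<iota> (\<lambda>y. single R a x y \<oplus>\<^bsub>R\<^esub> w y) \<in> rel X" by simp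
  qed
qed

lemma pure_eq_iff:
  assumes v: "v \<in> carrier (F X)" and w: "w \<in> carrier (F X)"
  shows "pure X v = pure X w \<longleftrightarrow> (\<forall>x. (v \<ominus>\<^bsub>F X\<^esub> w) x \<in> a_kernel R Q \<pi>)"
proof -
  interpret T: tensor_data R M "F X" by (rule tensor_data)
  interpret F: abelian_group "F X" by (rule R.free_abelian_group)
  have "pure X v = pure X w \<longleftrightarrow> \<iota> v - \<iota> w \<in> rel X"
    unfolding pure_def using v w by (intro T.relations_coset) auto
  also have "\<dots> \<longleftrightarrow> \<iota> (v \<ominus>\<^bsub>F X\<^esub> w) \<in> rel X"
    using T.relations_diff[OF _ pure_diff_rel[OF v w]] T.relations_add[OF pure_diff_rel[OF v w]] by fastforce
  also have "\<dots> \<longleftrightarrow> (\<forall>x. (v \<ominus>\<^bsub>F X\<^esub> w) x \<in> a_kernel R Q \<pi>)"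
    by (rule pure_rel_iff[OF F.minus_closed[OF v w]])
  finally show ?thesis .
qed

lemma tensor_carrier: "carrier (tensor R M (F X)) = pure X ` carrier (F X)"
proof -
  interpret T: tensor_data R M "F X" by (rule tensor_data)
  have "\<exists>v\<in>carrier (F X). rel X #>\<^bsub>pairs M (F X)\<^esub> c = pure X v" if c: "c \<in> carrier (pairs M (F X))" for c
  proof -
    obtain v where v: "v \<in> carrier (F X)" "c - \<iota> v \<in> rel X" using frag_pure[OF c] by blast
    have "\<iota> v \<in> carrier (pairs M (F X))" using v by simp
    then show ?thesis using v T.relations_coset[OF c] unfolding pure_def by blast
  qed
  moreover have "\<iota> v \<in> carrier (pairs M (F X))" if "v \<in> carrier (F X)" for v
    using that by simp
  ultimately show ?thesis
    unfolding tensor_def carrier_FactGroup pure_def by (auto simp del: carrier_free_Abelian_group_iff)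
qed

lemma tensor_mult:
  assumes v: "v \<in> carrier (F X)" and w: "w \<in> carrier (F X)"
  shows "pure X v \<otimes>\<^bsub>tensor R M (F X)\<^esub> pure X w = pure X (v \<oplus>\<^bsub>F X\<^esub> w)"
proof -
  interpret T: tensor_data R M "F X" by (rule tensor_data)
  interpret F: abelian_group "F X" by (rule R.free_abelian_group)
  have c: "\<iota> v \<in> carrier (pairs M (F X))" "\<iota> w \<in> carrier (pairs M (F X))"
    using v w by simp_all
  have vw: "v \<oplus>\<^bsub>F X\<^esub> w \<in> carrier (F X)" by (rule F.a_closed[OF v w])
  have "pure X v \<otimes>\<^bsub>tensor R M (F X)\<^esub> pure X w =
    rel X #>\<^bsub>pairs M (F X)\<^esub> (\<iota> v + \<iota> w)"
    unfolding pure_def tensor_def using normal.rcos_sum[OF T.relations_normal c] by simp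
  also have "\<dots> = pure X (v \<oplus>\<^bsub>F X\<^esub> w)"
    unfolding pure_def
    using T.relations_uminus[OF pure_add_rel[OF _ v w, of "\<one>\<^bsub>Q\<^esub>"]] v w vw keys_add
    by (subst T.relations_coset) (auto simp: algebra_simps keys_frag_of simp del: R.free_ops dest!: keys_add[THEN subsetD])
  finally show ?thesis .
qed

lemma tensor_one: "\<one>\<^bsub>tensor R M (F X)\<^esub> = rel X"
  by (simp add: tensor_def)

lemma pure_eq_one_iff:
  assumes v: "v \<in> carrier (F X)"
  shows "pure X v = \<one>\<^bsub>tensor R M (F X)\<^esub> \<longleftrightarrow> (\<forall>x. v x \<in> a_kernel R Q \<pi>)"
proof -
  interpret T: tensor_data R M "F X" by (rule tensor_data)
  have c: "\<iota> v \<in> carrier (pairs M (F X))" using v by simp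
  have "pure X v = rel X \<longleftrightarrow> \<iota> v \<in> rel X"
    unfolding pure_def
    using group.coset_join1[OF group_free_Abelian_group _ c T.relations_subgroup]
      group.coset_join2[OF group_free_Abelian_group c T.relations_subgroup] by blast
  then show ?thesis using pure_rel_iff[OF v] tensor_one[of X] by simp
qed

end

section \<open>Tor of the quotients in a tower\<close>

context tower
begin

abbreviation "RM r \<equiv> right_via (Q r) (\<pi> r)"

text \<open>The map \<open>pure\<close> for the basis \<open>X r n\<close>, stated outside the
  context of a fixed level so that two levels can occur in one formula.\<close>

definition pure_at :: "nat \<Rightarrow> nat \<Rightarrow> (('a, 'q) cell \<Rightarrow> 'a) \<Rightarrow> ('q \<times> (('a, 'q) cell \<Rightarrow> 'a) \<Rightarrow>\<^sub>0 int) set" where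
  "pure_at r n v = tensor_relations (A r) (RM r) (P r n) #>\<^bsub>pairs (RM r) (P r n)\<^esub> frag_of (\<one>\<^bsub>Q r\<^esub>, v)"

abbreviation "T r n \<equiv> tensor (A r) (RM r) (P r n)"
abbreviation "bnd r n \<equiv> tor_boundaries (A r) (RM r) (L r) n"

context
  fixes r :: nat
  assumes r: "1 \<le> r"
begin

interpretation hom: surj_ring_hom "A r" "Q r" "\<pi> r"
  by (intro surj_ring_hom.intro surj_ring_hom_axioms.intro proj_ring_hom_ring[OF r] proj_surj[OF r])

lemma pure_at_eq: "pure_at r n v = hom.pure (X r n) v"
  by (simp add: pure_at_def hom.pure_def res_def)

lemma T_data: "tensor_data (A r) (RM r) (P r n)"
  unfolding res_def by (rule hom.tensor_data)

lemma T_group: "group (T r n)"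
  by (rule tensor_data.tensor_group[OF T_data])

lemma T_carrier: "carrier (T r n) = pure_at r n ` carrier (P r n)"
  using hom.tensor_carrier[of "X r n"] by (simp add: pure_at_eq[abs_def] res_def)

lemma T_mult:
  "v \<in> carrier (P r n) \<Longrightarrow> w \<in> carrier (P r n) \<Longrightarrow>
    pure_at r n v \<otimes>\<^bsub>T r n\<^esub> pure_at r n w = pure_at r n (v \<oplus>\<^bsub>P r n\<^esub> w)"
  unfolding pure_at_eq res_def by (rule hom.tensor_mult)

lemma JP_iff: "v \<in> carrier (P r n) \<Longrightarrow> v \<in> JP r n \<longleftrightarrow> (\<forall>x. v x \<in> J r)"
  by (auto simp: coeff_module_carrier res_def free_module_def)

lemma pure_at_eq_iff:
  assumes "v \<in> carrier (P r n)" "w \<in> carrier (P r n)"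
  shows "pure_at r n v = pure_at r n w \<longleftrightarrow> v \<ominus>\<^bsub>P r n\<^esub> w \<in> JP r n"
proof -
  interpret G: abelian_group "P r n" by (rule P_abelian_group[OF r])
  have "hom.pure (X r n) v = hom.pure (X r n) w \<longleftrightarrow> (\<forall>x. (v \<ominus>\<^bsub>P r n\<^esub> w) x \<in> J r)"
    unfolding J_def using hom.pure_eq_iff[of v "X r n" w] assms by (simp add: res_def)
  then show ?thesis using JP_iff[OF G.minus_closed[OF assms]] by (simp only: pure_at_eq)
qed

lemma pure_at_eq_one_iff:
  assumes "v \<in> carrier (P r n)"
  shows "pure_at r n v = \<one>\<^bsub>T r n\<^esub> \<longleftrightarrow> v \<in> JP r n"
proof -
  have "hom.pure (X r n) v = \<one>\<^bsub>T r n\<^esub> \<longleftrightarrow> (\<forall>x. v x \<in> J r)"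
    unfolding J_def using hom.pure_eq_one_iff[of v "X r n"] assms by (simp add: res_def)
  then show ?thesis using JP_iff[OF assms] by (simp only: pure_at_eq)
qed

lemma RM_id_linear: "linear_on C (RM r) (RM r) id"
  by (rule linear_onI) simp_all

lemma tor_diff_pure:
  assumes "v \<in> carrier (P r (Suc n))"
  shows "tor_diff (A r) (RM r) (L r) n (pure_at r (Suc n) v) = pure_at r n (D r n v)"
  using tensor_map_coset[OF T_data T_data RM_id_linear D_linear[OF r] order.refl _ assms, of "\<one>\<^bsub>Q r\<^esub>"]
  by (simp add: tor_diff_def pure_at_def)

lemma tor_boundaries_eq: "bnd r n = (\<lambda>w. pure_at r n (D r n w)) ` carrier (P r (Suc n))"
  unfolding tor_boundaries_def T_carrier image_image using tor_diff_pure by simp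

lemma tor_cycles_eq:
  "tor_cycles (A r) (RM r) (L r) (Suc n) = pure_at r (Suc n) ` {v \<in> carrier (P r (Suc n)). D r n v \<in> JP r n}"
proof -
  have "tor_diff (A r) (RM r) (L r) n (pure_at r (Suc n) v) = \<one>\<^bsub>T r n\<^esub> \<longleftrightarrow> D r n v \<in> JP r n"
    if "v \<in> carrier (P r (Suc n))" for v
    using tor_diff_pure[OF that] pure_at_eq_one_iff[OF linear_on_closed[OF D_linear[OF r] that]] by simp
  then show ?thesis by (auto simp: kernel_def T_carrier)
qed

lemma tor_boundaries_subgroup: "subgroup (bnd r n) (T r n)"
proof -
  interpret G': abelian_group "P r (Suc n)" by (rule P_abelian_group[OF r])
  interpret T: group "T r n" by (rule T_group)
  note Dc = linear_on_closed[OF D_linear[OF r]]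
  have mult: "pure_at r n (D r n v) \<otimes>\<^bsub>T r n\<^esub> pure_at r n (D r n w) = pure_at r n (D r n (v \<oplus>\<^bsub>P r (Suc n)\<^esub> w))"
    if "v \<in> carrier (P r (Suc n))" "w \<in> carrier (P r (Suc n))" for v w
    using T_mult[OF Dc[OF that(1)] Dc[OF that(2)]] linear_on_add[OF D_linear[OF r] that] by simp
  have zero: "pure_at r n (D r n \<zero>\<^bsub>P r (Suc n)\<^esub>) = \<one>\<^bsub>T r n\<^esub>"
    using mult[OF G'.zero_closed G'.zero_closed] T.l_cancel_one[of "pure_at r n (D r n \<zero>\<^bsub>P r (Suc n)\<^esub>)"]
      Dc[OF G'.zero_closed] by (simp add: T_carrier)
  show ?thesis
  proof (rule T.subgroupI)
    show "bnd r n \<subseteq> carrier (T r n)" using Dc by (auto simp: tor_boundaries_eq T_carrier)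
    show "bnd r n \<noteq> {}" using G'.zero_closed unfolding tor_boundaries_eq by blast
    fix x assume "x \<in> bnd r n"
    then obtain v where v: "v \<in> carrier (P r (Suc n))" "x = pure_at r n (D r n v)" by (auto simp: tor_boundaries_eq)
    have "pure_at r n (D r n (\<ominus>\<^bsub>P r (Suc n)\<^esub> v)) \<otimes>\<^bsub>T r n\<^esub> x = \<one>\<^bsub>T r n\<^esub>"
      using mult[OF G'.a_inv_closed[OF v(1)] v(1)] v zero by (simp add: G'.l_neg)
    then have "inv\<^bsub>T r n\<^esub> x = pure_at r n (D r n (\<ominus>\<^bsub>P r (Suc n)\<^esub> v))"
      using Dc[OF v(1)] Dc[OF G'.a_inv_closed[OF v(1)]] v(2) by (intro T.inv_equality) (auto simp: T_carrier)
    then show "inv\<^bsub>T r n\<^esub> x \<in> bnd r n" using G'.a_inv_closed[OF v(1)] by (auto simp: tor_boundaries_eq)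
    fix y assume "y \<in> bnd r n"
    then obtain w where "w \<in> carrier (P r (Suc n))" "y = pure_at r n (D r n w)" by (auto simp: tor_boundaries_eq)
    then show "x \<otimes>\<^bsub>T r n\<^esub> y \<in> bnd r n" using mult v G'.a_closed[OF v(1)] by (auto simp: tor_boundaries_eq)
  qed
qed

text \<open>By exactness of \<open>P\<close>, changing \<open>v\<close> by a boundary means changing
  it without affecting \<open>D v\<close>. Accordingly Tor in degree n+1 is the intersection of D
  P_(n+1) and J P_n, modulo D (J P_(n+1)).\<close>

lemma pure_at_boundary_iff:
  assumes v: "v \<in> carrier (P r (Suc n))"
  shows "pure_at r (Suc n) v \<in> bnd r (Suc n) \<longleftrightarrow> (\<exists>w\<in>JP r (Suc n). D r n w = D r n v)"
proof -
  interpret G: abelian_group "P r (Suc n)" by (rule P_abelian_group[OF r])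
  interpret G': abelian_group "P r n" by (rule P_abelian_group[OF r])
  note Dc = linear_on_closed[OF D_linear[OF r]]
  note diff = linear_on_diff[OF D_linear[OF r] P_abelian_group[OF r] P_abelian_group[OF r]]
  have zero: "(\<lambda>_. \<zero>\<^bsub>A r\<^esub>) = \<zero>\<^bsub>P r n\<^esub>" by (simp add: zero_res)
  have mm: "v \<ominus>\<^bsub>P r (Suc n)\<^esub> (v \<ominus>\<^bsub>P r (Suc n)\<^esub> w) = w" if "w \<in> carrier (P r (Suc n))" for w
    using v that by (simp add: a_minus_def G.minus_add G.r_neg2 G.minus_minus)
  show ?thesis
  proof
    assume "pure_at r (Suc n) v \<in> bnd r (Suc n)"
    then obtain w where w: "w \<in> carrier (P r (Suc (Suc n)))" "pure_at r (Suc n) v = pure_at r (Suc n) (D r (Suc n) w)"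
      by (auto simp: tor_boundaries_eq)
    have "v \<ominus>\<^bsub>P r (Suc n)\<^esub> D r (Suc n) w \<in> JP r (Suc n)" using pure_at_eq_iff[OF v Dc[OF w(1)]] w(2) by simp
    moreover have "D r n (v \<ominus>\<^bsub>P r (Suc n)\<^esub> D r (Suc n) w) = D r n v"
      using diff[OF v Dc[OF w(1)]] D_D[OF r w(1)] G'.minus_zero_right[OF Dc[OF v]] zero by simp
    ultimately show "\<exists>w\<in>JP r (Suc n). D r n w = D r n v" by blast
  next
    assume "\<exists>w\<in>JP r (Suc n). D r n w = D r n v"
    then obtain w where w: "w \<in> JP r (Suc n)" "D r n w = D r n v" by blast
    have wP: "w \<in> carrier (P r (Suc n))" using w(1) JP_subset[OF r] by blast
    have "D r n (v \<ominus>\<^bsub>P r (Suc n)\<^esub> w) = \<zero>\<^bsub>P r n\<^esub>"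
      using diff[OF v wP] w(2) Dc[OF v] by (simp add: a_minus_def G'.r_neg)
    then have "cyc r (Suc n) (v \<ominus>\<^bsub>P r (Suc n)\<^esub> w)" using zero by simp
    then obtain u where u: "u \<in> carrier (P r (Suc (Suc n)))" "D r (Suc n) u = v \<ominus>\<^bsub>P r (Suc n)\<^esub> w"
      using exact[OF r G.minus_closed[OF v wP]] by blast
    then have "pure_at r (Suc n) v = pure_at r (Suc n) (D r (Suc n) u)"
      using pure_at_eq_iff[OF v Dc[OF u(1)]] mm[OF wP] w(1) by simp
    then show "pure_at r (Suc n) v \<in> bnd r (Suc n)" using u(1) by (auto simp: tor_boundaries_eq)
  qed
qed

lemma tor_carrier:
  "carrier (tor (A r) (RM r) (L r) (Suc n)) =
    (\<lambda>v. bnd r (Suc n) #>\<^bsub>T r (Suc n)\<^esub> pure_at r (Suc n) v) ` {v \<in> carrier (P r (Suc n)). D r n v \<in> JP r n}"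
  unfolding tor_def carrier_FactGroup
  by (simp only: partial_object.simps(1) partial_object.select_convs partial_object.update_convs tor_cycles_eq image_image r_coset_def)
    (simp add: image_image r_coset_def)

end

lemma tor_map_pure:
  assumes rs: "1 \<le> r" "r \<le> s" and v: "v \<in> carrier (P s (Suc n))"
  shows "tor_map (A s) (A r) (RM r) (L r) id (p r) (p r) (Suc n) (bnd s (Suc n) #>\<^bsub>T s (Suc n)\<^esub> pure_at s (Suc n) v) =
    bnd r (Suc n) #>\<^bsub>T r (Suc n)\<^esub> pure_at r (Suc n) (\<tau> s r (Suc n) v)"
proof -
  have s: "1 \<le> s" using rs by simp
  interpret Tr: group "T r (Suc n)" by (rule T_group[OF rs(1)])
  let ?h = "tensor_map (A r) (RM r) (P r (Suc n)) (p r) (\<tau> s r (Suc n))"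
  have p_lin: "lin s (RM s) (RM r) (p r)"
  proof (rule linear_onI)
    fix a x assume a: "a \<in> carrier (A s)" and x: "x \<in> carrier (RM s)"
    have "\<pi> s a \<in> carrier (Q s)" by (rule ring_hom_closed[OF proj_hom[OF s] a])
    then show "p r (a \<odot>\<^bsub>RM s\<^esub> x) = a \<odot>\<^bsub>RM r\<^esub> p r x"
      using ring_hom_mult[OF trans_hom[OF rs], of x "\<pi> s a"] x trans_proj[OF rs a] by (simp add: right_via_def)
  qed (use ring_hom_closed[OF trans_hom[OF rs]] ring_hom_add[OF trans_hom[OF rs]] in
        \<open>auto simp: right_via_def\<close>)
  interpret Qs: ring "Q s" by (rule ring_Q[OF s])
  have one: "\<one>\<^bsub>Q s\<^esub> \<in> carrier (RM s)" by (simp add: right_via_def)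
  have h: "?h (pure_at s (Suc n) w) = pure_at r (Suc n) (\<tau> s r (Suc n) w)" if "w \<in> carrier (P s (Suc n))" for w
    unfolding pure_at_def trans_one[OF rs, symmetric]
    by (rule tensor_map_coset[OF T_data[OF s] T_data[OF rs(1)] p_lin \<tau>_linear[OF rs] incl_subset[OF rs] one that])
  note \<tau>c = linear_on_closed[OF \<tau>_linear[OF rs]] and Dc = linear_on_closed[OF D_linear[OF s]]
  have "induced_map (T r (Suc n)) (bnd r (Suc n)) ?h (bnd s (Suc n) #>\<^bsub>T s (Suc n)\<^esub> pure_at s (Suc n) v) =
    bnd r (Suc n) #>\<^bsub>T r (Suc n)\<^esub> ?h (pure_at s (Suc n) v)"
  proof (rule induced_map_coset)
    show "group (T r (Suc n))" by (rule Tr.group_axioms)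
    show "subgroup (bnd r (Suc n)) (T r (Suc n))" by (rule tor_boundaries_subgroup[OF rs(1)])
    show "bnd s (Suc n) \<noteq> {}" using subgroup.one_closed[OF tor_boundaries_subgroup[OF s]] by blast
    show "?h (pure_at s (Suc n) v) \<in> carrier (T r (Suc n))"
      using h[OF v] \<tau>c[OF v] by (simp add: T_carrier[OF rs(1)])
    fix b assume "b \<in> bnd s (Suc n)"
    then obtain w where w: "w \<in> carrier (P s (Suc (Suc n)))" "b = pure_at s (Suc n) (D s (Suc n) w)"
      by (auto simp: tor_boundaries_eq[OF s])
    have hb: "?h b = pure_at r (Suc n) (\<tau> s r (Suc n) (D s (Suc n) w))" using h[OF Dc[OF w(1)]] w(2) by simp
    show "?h b \<in> bnd r (Suc n)"
      unfolding hb tor_boundaries_eq[OF rs(1)] \<tau>_diff[OF rs w(1), symmetric] using \<tau>c[OF w(1)] by blast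
    interpret Gs: abelian_group "P s (Suc n)" by (rule P_abelian_group[OF s])
    show "?h (b \<otimes>\<^bsub>T s (Suc n)\<^esub> pure_at s (Suc n) v) = ?h b \<otimes>\<^bsub>T r (Suc n)\<^esub> ?h (pure_at s (Suc n) v)"
      using hb h[OF v] h[OF Gs.a_closed[OF Dc[OF w(1)] v]] T_mult[OF s Dc[OF w(1)] v] w(2)
        T_mult[OF rs(1) \<tau>c[OF Dc[OF w(1)]] \<tau>c[OF v]] linear_on_add[OF \<tau>_linear[OF rs] Dc[OF w(1)] v] by simp
  qed
  then show ?thesis using h[OF v] by (simp add: tor_map_def)
qed

text \<open>A class of the source is given by a \<open>v\<close> with \<open>D v\<close> in
  \<open>J P\<close>, which is the premise in \<open>tor_null\<close>; by
  \<open>pure_at_boundary_iff\<close> the conclusion there says that the image of the class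
  vanishes. Index \<open>n\<close> belongs to Tor in degree n+1.\<close>

lemma tor_map_zero_iff:
  assumes rs: "1 \<le> r" "r \<le> s"
  shows "(\<forall>x\<in>carrier (tor (A s) (RM s) (L s) (Suc n)).
      tor_map (A s) (A r) (RM r) (L r) id (p r) (p r) (Suc n) x = \<one>\<^bsub>tor (A r) (RM r) (L r) (Suc n)\<^esub>) \<longleftrightarrow>
    tor_null s r n"
proof -
  have s: "1 \<le> s" using rs by simp
  have "tor_map (A s) (A r) (RM r) (L r) id (p r) (p r) (Suc n) (bnd s (Suc n) #>\<^bsub>T s (Suc n)\<^esub> pure_at s (Suc n) v) =
      \<one>\<^bsub>tor (A r) (RM r) (L r) (Suc n)\<^esub> \<longleftrightarrow> (\<exists>w\<in>JP r (Suc n). D r n w = D r n (\<tau> s r (Suc n) v))"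
    if v: "v \<in> carrier (P s (Suc n))" for v
  proof -
    have \<tau>v: "\<tau> s r (Suc n) v \<in> carrier (P r (Suc n))" by (rule linear_on_closed[OF \<tau>_linear[OF rs] v])
    have c: "pure_at r (Suc n) (\<tau> s r (Suc n) v) \<in> carrier (T r (Suc n))" using \<tau>v by (simp add: T_carrier[OF rs(1)])
    have "bnd r (Suc n) #>\<^bsub>T r (Suc n)\<^esub> pure_at r (Suc n) (\<tau> s r (Suc n) v) = bnd r (Suc n) \<longleftrightarrow>
        pure_at r (Suc n) (\<tau> s r (Suc n) v) \<in> bnd r (Suc n)"
      using group.coset_join1[OF T_group[OF rs(1)] _ c tor_boundaries_subgroup[OF rs(1)]]
        group.coset_join2[OF T_group[OF rs(1)] c tor_boundaries_subgroup[OF rs(1)]] by blast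
    then show ?thesis
      unfolding tor_map_pure[OF rs v] using pure_at_boundary_iff[OF rs(1) \<tau>v] by (simp add: tor_def)
  qed
  then show ?thesis unfolding tor_carrier[OF s] tor_null_def by auto
qed

theorem pro_zero_tor_iff:
  "pro_zero (\<lambda>r. tor (A r) (RM r) (L r) (Suc n))
      (\<lambda>s r. tor_map (A s) (A r) (RM r) (L r) id (p r) (p r) (Suc n)) \<longleftrightarrow>
    (\<forall>r\<ge>1. \<exists>s\<ge>r. tor_null s r n)"
  unfolding pro_zero_def using tor_map_zero_iff by (metis (no_types, lifting))

end

section \<open>Powers of an ideal\<close>

lemma ideal_power_ideal:
  assumes "ideal I A" shows "ideal (ideal_power A I r) A"
proof -
  interpret ideal I A by fact
  show ?thesis by (induction r) (auto intro: oneideal ideal_prod_is_ideal assms)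
qed

lemma ideal_power_mono:
  assumes "ideal I A" "r \<le> s" shows "ideal_power A I s \<subseteq> ideal_power A I r"
proof -
  interpret ideal I A by fact
  have "ideal_power A I (Suc n) \<subseteq> ideal_power A I n" for n
    using ideal_prod_inter[OF ideal_power_ideal[OF assms(1)] assms(1)] by auto
  then show ?thesis using lift_Suc_antimono_le assms(2) by blast
qed

lemma ideal_power_subset: "ideal I A \<Longrightarrow> ideal_power A I r \<subseteq> carrier A"
  using ideal_power_mono[of I A 0 r] by simp

lemma ideal_power_le_ideal:
  assumes "ideal I A" "1 \<le> r" shows "ideal_power A I r \<subseteq> I"
proof -
  interpret ideal I A by fact
  have "ideal_power A I 1 \<subseteq> I" using ideal_prod_inter[OF oneideal assms(1)] by auto
  then show ?thesis using ideal_power_mono[OF assms] by blast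
qed

lemma ideal_prod_image:
  assumes "f \<in> ring_hom A B" "ideal I A" "ideal J A"
  shows "f ` (I \<cdot>\<^bsub>A\<^esub> J) = f ` I \<cdot>\<^bsub>B\<^esub> f ` J"
proof -
  interpret I: ideal I A by fact
  interpret J: ideal J A by fact
  have sub: "I \<cdot>\<^bsub>A\<^esub> J \<subseteq> carrier A" by (rule I.ideal_prod_in_carrier[OF assms(2,3)])
  show ?thesis
  proof (intro equalityI subsetI)
    fix y assume "y \<in> f ` (I \<cdot>\<^bsub>A\<^esub> J)"
    then obtain x where x: "x \<in> I \<cdot>\<^bsub>A\<^esub> J" "y = f x" by blast
    from x(1) have "f x \<in> f ` I \<cdot>\<^bsub>B\<^esub> f ` J"
    proof induction
      case (prod i j)
      then show ?case
        using ring_hom_mult[OF assms(1), of i j] by (auto intro: ideal_prod.prod)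
    next
      case (sum a b)
      moreover have "f (a \<oplus>\<^bsub>A\<^esub> b) = f a \<oplus>\<^bsub>B\<^esub> f b"
        using sum(1,2) sub by (intro ring_hom_add[OF assms(1)]) auto
      ultimately show ?case by (auto intro: ideal_prod.sum)
    qed
    then show "y \<in> f ` I \<cdot>\<^bsub>B\<^esub> f ` J" using x(2) by simp
  next
    fix y assume "y \<in> f ` I \<cdot>\<^bsub>B\<^esub> f ` J"
    then show "y \<in> f ` (I \<cdot>\<^bsub>A\<^esub> J)"
    proof induction
      case (prod i j)
      then obtain a b where ab: "a \<in> I" "b \<in> J" "i = f a" "j = f b" by blast
      then have "i \<otimes>\<^bsub>B\<^esub> j = f (a \<otimes>\<^bsub>A\<^esub> b)" using ring_hom_mult[OF assms(1), of a b] by simp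
      then show ?case using ideal_prod.prod[OF ab(1,2)] by blast
    next
      case (sum x y)
      then obtain a b where ab: "a \<in> I \<cdot>\<^bsub>A\<^esub> J" "b \<in> I \<cdot>\<^bsub>A\<^esub> J" "x = f a" "y = f b" by blast
      then have "x \<oplus>\<^bsub>B\<^esub> y = f (a \<oplus>\<^bsub>A\<^esub> b)" using ring_hom_add[OF assms(1), of a b] sub by (simp add: subset_iff)
      then show ?case using ideal_prod.sum[OF ab(1,2)] by blast
    qed
  qed
qed

text \<open>Since \<open>ideal_power\<close> starts from the whole ring, its first power is a
  product of the ring with \<open>I\<close>; this identifies it with \<open>I\<close>.\<close>

lemma ideal_prod_one_left:
  assumes "ideal I A" shows "carrier A \<cdot>\<^bsub>A\<^esub> I = I"
proof -
  interpret ideal I A by fact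
  show ?thesis
  proof
    show "carrier A \<cdot>\<^bsub>A\<^esub> I \<subseteq> I" using ideal_prod_inter[OF oneideal assms] by blast
    show "I \<subseteq> carrier A \<cdot>\<^bsub>A\<^esub> I"
    proof
      fix i assume i: "i \<in> I"
      then show "i \<in> carrier A \<cdot>\<^bsub>A\<^esub> I" using ideal_prod.prod[OF one_closed i, of A] by simp
    qed
  qed
qed

text \<open>The exponents start at 1: zeroth powers are the whole rings, which \<open>f\<close> need
  not map onto each other.\<close>

lemma ideal_power_image:
  assumes "f \<in> ring_hom A B" "ideal I A" "ideal (f ` I) B"
  shows "f ` ideal_power A I (Suc r) = ideal_power B (f ` I) (Suc r)"
proof (induction r)
  case 0
  then show ?case using ideal_prod_one_left[OF assms(2)] ideal_prod_one_left[OF assms(3)] by simp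
next
  case (Suc r)
  have "f ` ideal_power A I (Suc (Suc r)) = f ` ideal_power A I (Suc r) \<cdot>\<^bsub>B\<^esub> f ` I"
    unfolding ideal_power.simps(2)[of A I "Suc r"]
    by (rule ideal_prod_image[OF assms(1) ideal_power_ideal[OF assms(2)] assms(2)])
  also have "\<dots> = ideal_power B (f ` I) (Suc (Suc r))" unfolding Suc.IH by simp
  finally show ?case .
qed

text \<open>By this the sum of sets that defines the transition maps is the projection between the
  quotients.\<close>

lemma coset_trans:
  assumes "ideal H A" "ideal K A" "H \<subseteq> K" "a \<in> carrier A"
  shows "K <+>\<^bsub>A\<^esub> (H +>\<^bsub>A\<^esub> a) = K +>\<^bsub>A\<^esub> a"
proof -
  interpret H: ideal H A by fact
  interpret K: ideal K A by fact
  have HA: "y \<in> carrier A" if "y \<in> H" for y using that by simp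
  have KA: "x \<in> carrier A" if "x \<in> K" for x using that by simp
  show ?thesis
    unfolding set_add_def' a_r_coset_def'
  proof (intro equalityI subsetI)
    fix z assume "z \<in> (\<Union>h\<in>K. \<Union>k\<in>\<Union>h\<in>H. {h \<oplus>\<^bsub>A\<^esub> a}. {h \<oplus>\<^bsub>A\<^esub> k})"
    then obtain x y where xy: "x \<in> K" "y \<in> H" "z = x \<oplus>\<^bsub>A\<^esub> (y \<oplus>\<^bsub>A\<^esub> a)" by auto
    then have "z = (x \<oplus>\<^bsub>A\<^esub> y) \<oplus>\<^bsub>A\<^esub> a" using HA KA assms(4) by (simp add: H.a_assoc)
    moreover have "x \<oplus>\<^bsub>A\<^esub> y \<in> K" using K.a_closed xy assms(3) by blast
    ultimately show "z \<in> (\<Union>h\<in>K. {h \<oplus>\<^bsub>A\<^esub> a})" by blast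
  next
    fix z assume "z \<in> (\<Union>h\<in>K. {h \<oplus>\<^bsub>A\<^esub> a})"
    then obtain x where x: "x \<in> K" "z = x \<oplus>\<^bsub>A\<^esub> (\<zero>\<^bsub>A\<^esub> \<oplus>\<^bsub>A\<^esub> a)" using assms(4) by auto
    then show "z \<in> (\<Union>h\<in>K. \<Union>k\<in>\<Union>h\<in>H. {h \<oplus>\<^bsub>A\<^esub> a}. {h \<oplus>\<^bsub>A\<^esub> k})"
      using additive_subgroup.zero_closed[OF H.additive_subgroup_axioms] by blast
  qed
qed

section \<open>The tower of quotients by powers of an ideal\<close>

locale ideal_tower =
  fixes A :: "('a, 'z) ring_scheme" and I :: "'a set"
  assumes ideal_I: "ideal I A"
begin

abbreviation "Ip \<equiv> ideal_power A I"
abbreviation "quot_ring \<equiv> \<lambda>r. A Quot Ip r"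
abbreviation "quot_proj \<equiv> \<lambda>r. (+>\<^bsub>A\<^esub>) (Ip r)"
abbreviation "quot_trans \<equiv> \<lambda>r. (<+>\<^bsub>A\<^esub>) (Ip r)"

lemma quot_tower: "tower (\<lambda>_. A) quot_ring quot_proj quot_trans"
proof (rule tower.intro)
  fix r s :: nat
  interpret Ir: ideal "Ip r" A by (rule ideal_power_ideal[OF ideal_I])
  interpret Is: ideal "Ip s" A by (rule ideal_power_ideal[OF ideal_I])
  show "ring A" by (rule Ir.ring_axioms)
  show "ring (A Quot Ip r)" by (rule Ir.quotient_is_ring)
  show "(+>\<^bsub>A\<^esub>) (Ip r) \<in> ring_hom A (A Quot Ip r)" by (rule Ir.rcos_ring_hom)
  have surj: "(+>\<^bsub>A\<^esub>) (Ip n) ` carrier A = carrier (A Quot Ip n)" for n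
    by (auto simp: FactRing_def A_RCOSETS_def')
  then show "(+>\<^bsub>A\<^esub>) (Ip r) ` carrier A = carrier (A Quot Ip r)" .
  show "id \<in> ring_hom A A" by (auto intro: ring_hom_memI)
  assume rs: "r \<le> s"
  show trans: "Ip r <+>\<^bsub>A\<^esub> (Ip s +>\<^bsub>A\<^esub> a) = Ip r +>\<^bsub>A\<^esub> a" if "a \<in> carrier A" for a
    by (rule coset_trans[OF Is.ideal_axioms Ir.ideal_axioms ideal_power_mono[OF ideal_I rs] that])
  show "(<+>\<^bsub>A\<^esub>) (Ip r) \<in> ring_hom (A Quot Ip s) (A Quot Ip r)"
  proof (rule ring_hom_memI)
    fix x assume x: "x \<in> carrier (A Quot Ip s)"
    then obtain a where a: "a \<in> carrier A" "x = Ip s +>\<^bsub>A\<^esub> a" unfolding surj[of s, symmetric] by blast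
    then show "Ip r <+>\<^bsub>A\<^esub> x \<in> carrier (A Quot Ip r)" using trans[OF a(1)] surj[of r] by auto
    fix y assume "y \<in> carrier (A Quot Ip s)"
    then obtain b where b: "b \<in> carrier A" "y = Ip s +>\<^bsub>A\<^esub> b" unfolding surj[of s, symmetric] by blast
    note hs = ring_hom_mult[OF Is.rcos_ring_hom a(1) b(1)] ring_hom_add[OF Is.rcos_ring_hom a(1) b(1)]
    note hr = ring_hom_mult[OF Ir.rcos_ring_hom a(1) b(1)] ring_hom_add[OF Ir.rcos_ring_hom a(1) b(1)]
    show "Ip r <+>\<^bsub>A\<^esub> (x \<otimes>\<^bsub>A Quot Ip s\<^esub> y) = (Ip r <+>\<^bsub>A\<^esub> x) \<otimes>\<^bsub>A Quot Ip r\<^esub> (Ip r <+>\<^bsub>A\<^esub> y)"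
      unfolding a(2) b(2) hs[symmetric] using trans a(1) b(1) hr by simp
    show "Ip r <+>\<^bsub>A\<^esub> (x \<oplus>\<^bsub>A Quot Ip s\<^esub> y) = (Ip r <+>\<^bsub>A\<^esub> x) \<oplus>\<^bsub>A Quot Ip r\<^esub> (Ip r <+>\<^bsub>A\<^esub> y)"
      unfolding a(2) b(2) hs[symmetric] using trans a(1) b(1) hr by simp
  next
    show "Ip r <+>\<^bsub>A\<^esub> \<one>\<^bsub>A Quot Ip s\<^esub> = \<one>\<^bsub>A Quot Ip r\<^esub>" using trans[of "\<one>\<^bsub>A\<^esub>"] by (simp add: FactRing_def)
  qed
qed

lemma quot_J: "tower.J (\<lambda>_. A) quot_ring quot_proj r = Ip r"
proof -
  interpret Ir: ideal "Ip r" A by (rule ideal_power_ideal[OF ideal_I])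
  have "Ip r +>\<^bsub>A\<^esub> a = Ip r \<longleftrightarrow> a \<in> Ip r" if "a \<in> carrier A" for a
    using that Ir.a_coset_join1[of "Ip r" a] Ir.a_coset_join2[of a "Ip r"] Ir.a_subgroup by blast
  then show ?thesis
    using tower.J_def[OF quot_tower] ideal_power_subset[OF ideal_I, of r]
    by (auto simp: a_kernel_def' FactRing_def)
qed

lemma quot_iff:
  "(\<forall>n>0. pro_tor_quot_zero A I n) \<longleftrightarrow>
    (\<forall>n. \<forall>r\<ge>1. \<exists>s\<ge>r. tower.tor_null (\<lambda>_. A) quot_ring quot_proj quot_trans s r n)"
proof -
  have "pro_tor_quot_zero A I (Suc n) \<longleftrightarrow>
    (\<forall>r\<ge>1. \<exists>s\<ge>r. tower.tor_null (\<lambda>_. A) quot_ring quot_proj quot_trans s r n)" for n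
    unfolding tower.pro_zero_tor_iff[OF quot_tower, symmetric] by (simp add: pro_tor_quot_zero_def Let_def)
  then show ?thesis by (metis gr0_conv_Suc)
qed

end

text \<open>Two transfers, along \<open>f\<close> and along its inverse on the ideal. An element b
  of \<open>B\<close> acts on I^r by taking j to the preimage of b f(j), which exists because the
  image of I^r is an ideal of \<open>B\<close>; an element a of \<open>A\<close> acts on that image
  through f(a).\<close>

lemma pro_tor_quot_zero_image:
  fixes A :: "('a, 'y) ring_scheme" and B :: "('b, 'z) ring_scheme"
  assumes f: "f \<in> ring_hom A B" and I: "ideal I A" and inj: "inj_on f I" and fI: "ideal (f ` I) B"
  shows "(\<forall>n>0. pro_tor_quot_zero A I n) \<longleftrightarrow> (\<forall>n>0. pro_tor_quot_zero B (f ` I) n)"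
proof -
  interpret A: ideal_tower A I by (rule ideal_tower.intro[OF I])
  interpret B: ideal_tower B "f ` I" by (rule ideal_tower.intro[OF fI])
  interpret iA: ideal I A by fact
  interpret iB: ideal "f ` I" B by fact
  let ?g = "inv_into I f"
  have image: "f ` A.Ip r = B.Ip r" if "1 \<le> r" for r
    using ideal_power_image[OF f I fI, of "r - 1"] that by simp
  have sub: "A.Ip r \<subseteq> I" if "1 \<le> r" for r by (rule ideal_power_le_ideal[OF I that])
  have gf: "?g (f i) = i" if "i \<in> I" for i using that inj by (rule inv_into_f_f[rotated])
  have fg: "f (?g j) = j" if "j \<in> f ` I" for j by (rule f_inv_into_f[OF that])
  have gI: "?g j \<in> A.Ip r" if j: "j \<in> B.Ip r" and r: "1 \<le> r" for j r
  proof -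
    obtain i where i: "i \<in> A.Ip r" "j = f i" using j unfolding image[OF r, symmetric] by blast
    then show ?thesis using gf[of i] sub[OF r] by auto
  qed
  have subB: "B.Ip r \<subseteq> f ` I" if "1 \<le> r" for r by (rule ideal_power_le_ideal[OF fI that])
  have IA: "i \<in> carrier A" if "i \<in> I" for i using that by simp
  note hom = ring_hom_closed[OF f] ring_hom_add[OF f] ring_hom_mult[OF f]
  have AB: "tower_transfer (\<lambda>_. A) A.quot_ring A.quot_proj A.quot_trans
    (\<lambda>_. B) B.quot_ring B.quot_proj B.quot_trans f (\<lambda>b j. ?g (b \<otimes>\<^bsub>B\<^esub> f j))"
  proof (intro tower_transfer.intro A.quot_tower B.quot_tower tower_transfer_axioms.intro, unfold A.quot_J B.quot_J)
    fix r :: nat assume r: "1 \<le> r"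
    interpret Ar: ideal "A.Ip r" A by (rule ideal_power_ideal[OF I])
    interpret Br: ideal "B.Ip r" B by (rule ideal_power_ideal[OF fI])
    show "bij_betw f (A.Ip r) (B.Ip r)"
      using inj_on_subset[OF inj sub[OF r]] image[OF r] by (simp add: bij_betw_def)
    fix j assume j: "j \<in> A.Ip r"
    have jI: "j \<in> I" using sub[OF r] j by blast
    have fj: "f j \<in> B.Ip r" using image[OF r] j by blast
    {
      fix i assume i: "i \<in> A.Ip r"
      show "f (i \<oplus>\<^bsub>A\<^esub> j) = f i \<oplus>\<^bsub>B\<^esub> f j" "f (i \<otimes>\<^bsub>A\<^esub> j) = f i \<otimes>\<^bsub>B\<^esub> f j"
        using hom i j by simp_all
    }
    fix b assume b: "b \<in> carrier B"
    have bj: "b \<otimes>\<^bsub>B\<^esub> f j \<in> B.Ip r" by (rule Br.I_l_closed[OF fj b])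
    show g: "?g (b \<otimes>\<^bsub>B\<^esub> f j) \<in> A.Ip r" by (rule gI[OF bj r])
    show fg': "f (?g (b \<otimes>\<^bsub>B\<^esub> f j)) = b \<otimes>\<^bsub>B\<^esub> f j" using fg bj subB[OF r] by blast
    fix a assume a: "a \<in> carrier A"
    \<comment> \<open>Associativity is verified in \<open>B\<close> and brought back to
      \<open>A\<close>, as \<open>?g\<close> inverts \<open>f\<close> on \<open>I\<close>.\<close>
    have "f (?g (b \<otimes>\<^bsub>B\<^esub> f j) \<otimes>\<^bsub>A\<^esub> a) = b \<otimes>\<^bsub>B\<^esub> f (j \<otimes>\<^bsub>A\<^esub> a)"
      using hom(1)[OF a] hom(3)[OF _ a] fg' g j jI b hom(1)[OF IA[OF jI]] by (simp add: iB.m_assoc)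
    moreover have "?g (b \<otimes>\<^bsub>B\<^esub> f j) \<otimes>\<^bsub>A\<^esub> a \<in> I" using Ar.I_r_closed[OF g a] sub[OF r] by blast
    ultimately show "?g (b \<otimes>\<^bsub>B\<^esub> f (j \<otimes>\<^bsub>A\<^esub> a)) = ?g (b \<otimes>\<^bsub>B\<^esub> f j) \<otimes>\<^bsub>A\<^esub> a"
      using gf by metis
  qed
  have BA: "tower_transfer (\<lambda>_. B) B.quot_ring B.quot_proj B.quot_trans
    (\<lambda>_. A) A.quot_ring A.quot_proj A.quot_trans ?g (\<lambda>a j. f a \<otimes>\<^bsub>B\<^esub> j)"
  proof (intro tower_transfer.intro A.quot_tower B.quot_tower tower_transfer_axioms.intro, unfold A.quot_J B.quot_J)
    fix r :: nat assume r: "1 \<le> r"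
    interpret Ar: ideal "A.Ip r" A by (rule ideal_power_ideal[OF I])
    interpret Br: ideal "B.Ip r" B by (rule ideal_power_ideal[OF fI])
    show "bij_betw ?g (B.Ip r) (A.Ip r)"
    proof (rule bij_betw_byWitness[where f' = f])
      show "\<forall>j\<in>B.Ip r. f (?g j) = j" using fg subB[OF r] by blast
      show "\<forall>i\<in>A.Ip r. ?g (f i) = i" using gf sub[OF r] by blast
      show "?g ` B.Ip r \<subseteq> A.Ip r" using gI[OF _ r] by blast
      show "f ` A.Ip r \<subseteq> B.Ip r" using image[OF r] by blast
    qed
    fix j assume j: "j \<in> B.Ip r"
    have gj: "?g j \<in> A.Ip r" by (rule gI[OF j r])
    have fgj: "f (?g j) = j" using fg j subB[OF r] by blast
    {
      fix i assume i: "i \<in> B.Ip r"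
      have gi: "?g i \<in> A.Ip r" by (rule gI[OF i r])
      have fgi: "f (?g i) = i" using fg i subB[OF r] by blast
      have "f (?g i \<oplus>\<^bsub>A\<^esub> ?g j) = i \<oplus>\<^bsub>B\<^esub> j" "f (?g i \<otimes>\<^bsub>A\<^esub> ?g j) = i \<otimes>\<^bsub>B\<^esub> j"
        using hom gi gj fgi fgj by simp_all
      moreover have "?g i \<oplus>\<^bsub>A\<^esub> ?g j \<in> I" "?g i \<otimes>\<^bsub>A\<^esub> ?g j \<in> I"
        using Ar.a_closed[OF gi gj] Ar.I_r_closed[OF gi, of "?g j"] gj sub[OF r] by auto
      ultimately show "?g (i \<oplus>\<^bsub>B\<^esub> j) = ?g i \<oplus>\<^bsub>A\<^esub> ?g j" "?g (i \<otimes>\<^bsub>B\<^esub> j) = ?g i \<otimes>\<^bsub>A\<^esub> ?g j"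
        using gf by metis+
    }
    fix a assume a: "a \<in> carrier A"
    show "f a \<otimes>\<^bsub>B\<^esub> j \<in> B.Ip r" by (rule Br.I_l_closed[OF j hom(1)[OF a]])
    have "f (a \<otimes>\<^bsub>A\<^esub> ?g j) = f a \<otimes>\<^bsub>B\<^esub> j" using hom(3)[OF a] gj fgj by simp
    moreover have "a \<otimes>\<^bsub>A\<^esub> ?g j \<in> I" using Ar.I_l_closed[OF gj a] sub[OF r] by blast
    ultimately show "?g (f a \<otimes>\<^bsub>B\<^esub> j) = a \<otimes>\<^bsub>A\<^esub> ?g j" using gf by metis
    fix b assume "b \<in> carrier B"
    then show "f a \<otimes>\<^bsub>B\<^esub> (j \<otimes>\<^bsub>B\<^esub> b) = f a \<otimes>\<^bsub>B\<^esub> j \<otimes>\<^bsub>B\<^esub> b"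
      using hom(1)[OF a] j by (simp add: iB.m_assoc)
  qed
  show ?thesis
    unfolding A.quot_iff B.quot_iff
    using tower_transfer.tor_null_transfer[OF AB] tower_transfer.tor_null_transfer[OF BA] by blast
qed

section \<open>The tower of semidirect products\<close>

locale algebra_ideal = nc_algebra k A + ideal I A
  for k :: "'k ring" and A :: "('k, 'a) module" and I
begin

sublocale ideal_tower A I
  by (rule ideal_tower.intro[OF ideal_axioms])

abbreviation "E r \<equiv> semidirect k (A\<lparr>carrier := Ip r\<rparr>)"

lemma Ip_carrier: "x \<in> Ip r \<Longrightarrow> x \<in> carrier A"
  using ideal_power_subset[OF ideal_I] by blast

text \<open>Ideals of a unital algebra are stable under scalars, c x being the product of c 1 with
  x.\<close>

lemma Ip_smult: "c \<in> carrier k \<Longrightarrow> x \<in> Ip r \<Longrightarrow> c \<odot>\<^bsub>A\<^esub> x \<in> Ip r"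
proof -
  assume c: "c \<in> carrier k" and x: "x \<in> Ip r"
  interpret Ir: ideal "Ip r" A by (rule ideal_power_ideal[OF ideal_I])
  have "c \<odot>\<^bsub>A\<^esub> x = (c \<odot>\<^bsub>A\<^esub> \<one>\<^bsub>A\<^esub>) \<otimes>\<^bsub>A\<^esub> x" using c Ip_carrier[OF x] smult_mult_left[of c "\<one>\<^bsub>A\<^esub>" x] by simp
  then show ?thesis using Ir.I_l_closed[OF x, of "c \<odot>\<^bsub>A\<^esub> \<one>\<^bsub>A\<^esub>"] c by simp
qed

lemma smult_zero_left: "x \<in> carrier A \<Longrightarrow> \<zero>\<^bsub>k\<^esub> \<odot>\<^bsub>A\<^esub> x = \<zero>\<^bsub>A\<^esub>"
  by (metis M.add.l_cancel_one R.add.l_cancel_one R.zero_closed smult_closed smult_l_distr)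

lemma smult_zero_right: "c \<in> carrier k \<Longrightarrow> c \<odot>\<^bsub>A\<^esub> \<zero>\<^bsub>A\<^esub> = \<zero>\<^bsub>A\<^esub>"
  by (metis M.add.l_cancel_one M.zero_closed smult_closed smult_r_distr)

lemma E_simps:
  "carrier (E r) = carrier k \<times> Ip r"
  "(a, x) \<otimes>\<^bsub>E r\<^esub> (b, y) = (a \<otimes>\<^bsub>k\<^esub> b, (a \<odot>\<^bsub>A\<^esub> y \<oplus>\<^bsub>A\<^esub> b \<odot>\<^bsub>A\<^esub> x) \<oplus>\<^bsub>A\<^esub> x \<otimes>\<^bsub>A\<^esub> y)"
  "(a, x) \<oplus>\<^bsub>E r\<^esub> (b, y) = (a \<oplus>\<^bsub>k\<^esub> b, x \<oplus>\<^bsub>A\<^esub> y)"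
  "\<one>\<^bsub>E r\<^esub> = (\<one>\<^bsub>k\<^esub>, \<zero>\<^bsub>A\<^esub>)" "\<zero>\<^bsub>E r\<^esub> = (\<zero>\<^bsub>k\<^esub>, \<zero>\<^bsub>A\<^esub>)"
  by (simp_all add: semidirect_def)

lemma E_ring: "ring (E r)"
proof -
  interpret Ir: ideal "Ip r" A by (rule ideal_power_ideal[OF ideal_I])
  note [simp] = Ip_smult Ir.I_l_closed Ir.I_r_closed smult_zero_left smult_zero_right
  show ?thesis
  proof (rule ringI)
    show "abelian_group (E r)"
    proof (rule abelian_groupI, goal_cases)
      case (6 u)
      then obtain a x where "u = (a, x)" "a \<in> carrier k" "x \<in> Ip r" by (auto simp: E_simps)
      then show ?case
        by (intro bexI[of _ "(\<ominus>\<^bsub>k\<^esub> a, \<ominus>\<^bsub>A\<^esub> x)"]) (auto simp: E_simps R.l_neg M.l_neg)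
    qed (auto simp: E_simps R.a_ac M.a_ac)
    show "monoid (E r)"
    proof (rule monoidI)
      fix u v w assume "u \<in> carrier (E r)" "v \<in> carrier (E r)" "w \<in> carrier (E r)"
      then obtain a x b y c z where u: "u = (a, x)" "a \<in> carrier k" "x \<in> carrier A"
        and v: "v = (b, y)" "b \<in> carrier k" "y \<in> carrier A"
        and w: "w = (c, z)" "c \<in> carrier k" "z \<in> carrier A" by (auto simp: E_simps)
      have "c \<odot>\<^bsub>A\<^esub> (a \<odot>\<^bsub>A\<^esub> y) = a \<odot>\<^bsub>A\<^esub> (c \<odot>\<^bsub>A\<^esub> y)" "c \<odot>\<^bsub>A\<^esub> (b \<odot>\<^bsub>A\<^esub> x) = b \<odot>\<^bsub>A\<^esub> (c \<odot>\<^bsub>A\<^esub> x)"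
        using u v w R.m_comm by (simp_all add: smult_assoc1[symmetric])
      then show "(u \<otimes>\<^bsub>E r\<^esub> v) \<otimes>\<^bsub>E r\<^esub> w = u \<otimes>\<^bsub>E r\<^esub> (v \<otimes>\<^bsub>E r\<^esub> w)"
        using u v w
        by (simp add: E_simps smult_r_distr smult_assoc1 smult_mult_left smult_mult_right l_distr r_distr
            R.m_assoc m_assoc M.a_ac)
    qed (auto simp: E_simps)
    fix u v w assume "u \<in> carrier (E r)" "v \<in> carrier (E r)" "w \<in> carrier (E r)"
    then obtain a x b y c z where u: "u = (a, x)" "a \<in> carrier k" "x \<in> carrier A"
        and v: "v = (b, y)" "b \<in> carrier k" "y \<in> carrier A"
        and w: "w = (c, z)" "c \<in> carrier k" "z \<in> carrier A" by (auto simp: E_simps)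
    then show "(u \<oplus>\<^bsub>E r\<^esub> v) \<otimes>\<^bsub>E r\<^esub> w = u \<otimes>\<^bsub>E r\<^esub> w \<oplus>\<^bsub>E r\<^esub> v \<otimes>\<^bsub>E r\<^esub> w"
      "w \<otimes>\<^bsub>E r\<^esub> (u \<oplus>\<^bsub>E r\<^esub> v) = w \<otimes>\<^bsub>E r\<^esub> u \<oplus>\<^bsub>E r\<^esub> w \<otimes>\<^bsub>E r\<^esub> v"
      by (simp_all add: E_simps smult_l_distr smult_r_distr l_distr r_distr R.l_distr R.r_distr M.a_ac)
  qed
qed

lemma semidirect_tower: "tower E (\<lambda>_. k) (\<lambda>_. fst) (\<lambda>_. id)"
proof (rule tower.intro)
  fix r s :: nat
  interpret Ir: ideal "Ip r" A by (rule ideal_power_ideal[OF ideal_I])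
  show "ring (E r)" by (rule E_ring)
  show "ring k" by (rule R.ring_axioms)
  show "fst \<in> ring_hom (E r) k" by (rule ring_hom_memI) (auto simp: E_simps)
  have "Ip r \<noteq> {}" using additive_subgroup.zero_closed[OF Ir.additive_subgroup_axioms] by blast
  then show "fst ` carrier (E r) = carrier k" by (simp add: E_simps)
  show "id \<in> ring_hom k k" by (auto intro: ring_hom_memI)
  show "id (fst a) = fst a" for a :: "'k \<times> 'a" by simp
  assume "r \<le> s"
  then have "Ip s \<subseteq> Ip r" by (rule ideal_power_mono[OF ideal_I])
  then show "id \<in> ring_hom (E s) (E r)" by (intro ring_hom_memI) (auto simp: E_simps)
qed

lemma semidirect_J: "tower.J E (\<lambda>_. k) (\<lambda>_. fst) r = {\<zero>\<^bsub>k\<^esub>} \<times> Ip r"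
  using tower.J_def[OF semidirect_tower] by (auto simp: a_kernel_def' E_simps)

lemma semidirect_iff:
  "(\<forall>n>0. pro_tor_semidirect_zero k A I n) \<longleftrightarrow>
    (\<forall>n. \<forall>r\<ge>1. \<exists>s\<ge>r. tower.tor_null E (\<lambda>_. k) (\<lambda>_. fst) (\<lambda>_. id) s r n)"
proof -
  have "pro_tor_semidirect_zero k A I (Suc n) \<longleftrightarrow>
    (\<forall>r\<ge>1. \<exists>s\<ge>r. tower.tor_null E (\<lambda>_. k) (\<lambda>_. fst) (\<lambda>_. id) s r n)" for n
    unfolding tower.pro_zero_tor_iff[OF semidirect_tower, symmetric]
    by (simp add: pro_tor_semidirect_zero_def Let_def)
  then show ?thesis by (metis gr0_conv_Suc)
qed

text \<open>I^r is an ideal of \<open>k \<ltimes> I^r\<close> as well, in the form of the pairs (0,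
  j). The formula for \<rho> is the second coordinate of (c, x)(0, j).\<close>

lemma quot_semidirect:
  "tower_transfer (\<lambda>_. A) quot_ring quot_proj quot_trans
    E (\<lambda>_. k) (\<lambda>_. fst) (\<lambda>_. id) (Pair \<zero>\<^bsub>k\<^esub>) (\<lambda>(c, x) j. c \<odot>\<^bsub>A\<^esub> j \<oplus>\<^bsub>A\<^esub> x \<otimes>\<^bsub>A\<^esub> j)"
proof (intro tower_transfer.intro quot_tower semidirect_tower tower_transfer_axioms.intro, unfold quot_J semidirect_J)
  fix r :: nat assume r: "1 \<le> r"
  interpret Ir: ideal "Ip r" A by (rule ideal_power_ideal[OF ideal_I])
  note [simp] = Ip_smult Ir.I_l_closed Ir.I_r_closed smult_zero_left smult_zero_right
  show "bij_betw (Pair \<zero>\<^bsub>k\<^esub>) (Ip r) ({\<zero>\<^bsub>k\<^esub>} \<times> Ip r)" by (auto simp: bij_betw_def inj_on_def)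
  fix j assume j: "j \<in> Ip r"
  {
    fix i assume i: "i \<in> Ip r"
    show "(\<zero>\<^bsub>k\<^esub>, i \<oplus>\<^bsub>A\<^esub> j) = (\<zero>\<^bsub>k\<^esub>, i) \<oplus>\<^bsub>E r\<^esub> (\<zero>\<^bsub>k\<^esub>, j)"
      "(\<zero>\<^bsub>k\<^esub>, i \<otimes>\<^bsub>A\<^esub> j) = (\<zero>\<^bsub>k\<^esub>, i) \<otimes>\<^bsub>E r\<^esub> (\<zero>\<^bsub>k\<^esub>, j)"
      using i j by (simp_all add: E_simps)
  }
  fix b assume "b \<in> carrier (E r)"
  then obtain c x where b: "b = (c, x)" "c \<in> carrier k" "x \<in> Ip r" by (auto simp: E_simps)
  show "(case b of (c, x) \<Rightarrow> \<lambda>j. c \<odot>\<^bsub>A\<^esub> j \<oplus>\<^bsub>A\<^esub> x \<otimes>\<^bsub>A\<^esub> j) j \<in> Ip r" using b j by simp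
  show "(\<zero>\<^bsub>k\<^esub>, (case b of (c, x) \<Rightarrow> \<lambda>j. c \<odot>\<^bsub>A\<^esub> j \<oplus>\<^bsub>A\<^esub> x \<otimes>\<^bsub>A\<^esub> j) j) = b \<otimes>\<^bsub>E r\<^esub> (\<zero>\<^bsub>k\<^esub>, j)"
    using b j by (simp add: E_simps)
  fix a assume "a \<in> carrier A"
  then show "(case b of (c, x) \<Rightarrow> \<lambda>j. c \<odot>\<^bsub>A\<^esub> j \<oplus>\<^bsub>A\<^esub> x \<otimes>\<^bsub>A\<^esub> j) (j \<otimes>\<^bsub>A\<^esub> a) =
      (case b of (c, x) \<Rightarrow> \<lambda>j. c \<odot>\<^bsub>A\<^esub> j \<oplus>\<^bsub>A\<^esub> x \<otimes>\<^bsub>A\<^esub> j) j \<otimes>\<^bsub>A\<^esub> a"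
    using b j by (simp add: l_distr m_assoc smult_mult_left)
qed

text \<open>On the kernel the first coordinate is 0, and \<open>a\<close> multiplies the second one.
  This commutes with right multiplication by (c, x) because scalars from \<open>k\<close> can be
  moved out of products in \<open>A\<close>.\<close>

lemma semidirect_quot:
  "tower_transfer E (\<lambda>_. k) (\<lambda>_. fst) (\<lambda>_. id)
    (\<lambda>_. A) quot_ring quot_proj quot_trans snd (\<lambda>a (c, j). (c, a \<otimes>\<^bsub>A\<^esub> j))"
proof (intro tower_transfer.intro quot_tower semidirect_tower tower_transfer_axioms.intro, unfold quot_J semidirect_J)
  fix r :: nat assume r: "1 \<le> r"
  interpret Ir: ideal "Ip r" A by (rule ideal_power_ideal[OF ideal_I])
  note [simp] = Ip_smult Ir.I_l_closed Ir.I_r_closed smult_zero_left smult_zero_right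
  show "bij_betw snd ({\<zero>\<^bsub>k\<^esub>} \<times> Ip r) (Ip r)" by (auto simp: bij_betw_def inj_on_def image_iff)
  fix v assume "v \<in> {\<zero>\<^bsub>k\<^esub>} \<times> Ip r"
  then obtain j where v: "v = (\<zero>\<^bsub>k\<^esub>, j)" "j \<in> Ip r" by blast
  {
    fix u assume "u \<in> {\<zero>\<^bsub>k\<^esub>} \<times> Ip r"
    then obtain i where u: "u = (\<zero>\<^bsub>k\<^esub>, i)" "i \<in> Ip r" by blast
    show "snd (u \<oplus>\<^bsub>E r\<^esub> v) = snd u \<oplus>\<^bsub>A\<^esub> snd v" "snd (u \<otimes>\<^bsub>E r\<^esub> v) = snd u \<otimes>\<^bsub>A\<^esub> snd v"
      using u v by (simp_all add: E_simps)
  }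
  fix a assume a: "a \<in> carrier A"
  show "(case v of (c, j) \<Rightarrow> (c, a \<otimes>\<^bsub>A\<^esub> j)) \<in> {\<zero>\<^bsub>k\<^esub>} \<times> Ip r" using a v by simp
  show "snd (case v of (c, j) \<Rightarrow> (c, a \<otimes>\<^bsub>A\<^esub> j)) = a \<otimes>\<^bsub>A\<^esub> snd v" using v by simp
  fix w assume "w \<in> carrier (E r)"
  then obtain c x where "w = (c, x)" "c \<in> carrier k" "x \<in> Ip r" by (auto simp: E_simps)
  then show "(case v \<otimes>\<^bsub>E r\<^esub> w of (c, j) \<Rightarrow> (c, a \<otimes>\<^bsub>A\<^esub> j)) = (case v of (c, j) \<Rightarrow> (c, a \<otimes>\<^bsub>A\<^esub> j)) \<otimes>\<^bsub>E r\<^esub> w"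
    using a v by (simp add: E_simps r_distr m_assoc smult_mult_right)
qed

theorem pro_tor_quot_iff_semidirect:
  "(\<forall>n>0. pro_tor_quot_zero A I n) \<longleftrightarrow> (\<forall>n>0. pro_tor_semidirect_zero k A I n)"
  unfolding quot_iff semidirect_iff
  using tower_transfer.tor_null_transfer[OF quot_semidirect] tower_transfer.tor_null_transfer[OF semidirect_quot]
  by blast

end

section \<open>The integers as base ring\<close>

lemma as_int_algebra_nc_algebra:
  assumes "ring A" shows "nc_algebra \<Z> (as_int_algebra A)"
proof -
  interpret ring A by fact
  let ?Z = "as_int_algebra A"
  have "ring ?Z"
  proof (rule ringI)
    show "abelian_group ?Z"
    proof (rule abelian_groupI, goal_cases)
      case (6 x)
      then show ?case by (intro bexI[of _ "\<ominus>\<^bsub>A\<^esub> x"]) (auto simp: as_int_algebra_def l_neg)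
    qed (auto simp: as_int_algebra_def a_ac)
    show "monoid ?Z" by (rule monoidI) (auto simp: as_int_algebra_def m_assoc)
  qed (auto simp: as_int_algebra_def l_distr r_distr)
  then interpret Z: ring ?Z .
  have comp: "add_pow A (a * b) x = add_pow A a (add_pow A b x)" if "x \<in> carrier A" for a b :: int and x
    using add.int_pow_pow[OF that, of a b] by (simp only: mult.commute)
  show ?thesis
  proof (intro nc_algebra.intro nc_algebra_axioms.intro moduleI int_is_cring Z.ring_axioms Z.abelian_group_axioms)
  qed (auto simp: as_int_algebra_def add.int_pow_mult add.int_pow_distrib comp add_pow_ldistr_int add_pow_rdistr_int)
qed

lemma as_int_algebra_ideal:
  assumes "ideal I A" shows "ideal I (as_int_algebra A)"
proof -
  interpret ideal I A by fact
  interpret Z: nc_algebra \<Z> "as_int_algebra A" by (rule as_int_algebra_nc_algebra[OF ring_axioms])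
  have sub: "subgroup I (add_monoid (as_int_algebra A))"
  proof (rule Z.add.subgroupI)
    show "I \<subseteq> carrier (as_int_algebra A)" using a_subset by (simp add: as_int_algebra_def)
    show "I \<noteq> {}" using additive_subgroup.zero_closed[OF additive_subgroup_axioms] by blast
    fix x assume x: "x \<in> I"
    have "\<ominus>\<^bsub>as_int_algebra A\<^esub> x = \<ominus>\<^bsub>A\<^esub> x" by (simp add: a_inv_def m_inv_def as_int_algebra_def)
    then show "\<ominus>\<^bsub>as_int_algebra A\<^esub> x \<in> I" using x by simp
    fix y assume "y \<in> I"
    then show "x \<oplus>\<^bsub>as_int_algebra A\<^esub> y \<in> I" using x by (simp add: as_int_algebra_def)
  qed
  show ?thesis
    by (rule idealI[OF Z.ring_axioms sub]) (use I_l_closed I_r_closed in \<open>auto simp: as_int_algebra_def\<close>)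
qed

theorem theorem0p2:
  fixes k :: "'k ring" and A :: "('k, 'a) module" and B :: "('k, 'b) module"
    and f :: "'a \<Rightarrow> 'b" and I :: "'a set"
  assumes "cring k"
    and "nc_algebra k A"
    and "nc_algebra k B"
    and "f \<in> nc_algebra_hom k A B"
    and "ideal I A"
    and "inj_on f I"
    and "ideal (f ` I) B"
  shows "((\<forall>n>0. pro_tor_quot_zero A I n) \<longleftrightarrow> (\<forall>n>0. pro_tor_quot_zero B (f ` I) n)) \<and>
    ((\<forall>n>0. pro_tor_quot_zero B (f ` I) n) \<longleftrightarrow> (\<forall>n>0. pro_tor_semidirect_zero k A I n)) \<and>
    ((\<forall>n>0. pro_tor_semidirect_zero k A I n) \<longleftrightarrow> pro_tor_unital A I)"
proof -
  interpret A: algebra_ideal k A I by (intro algebra_ideal.intro assms)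
  have Z_alg: "nc_algebra \<Z> (as_int_algebra A)" by (rule as_int_algebra_nc_algebra[OF A.ring_axioms])
  have Z_ideal: "ideal I (as_int_algebra A)" by (rule as_int_algebra_ideal[OF assms(5)])
  have Z: "algebra_ideal \<Z> (as_int_algebra A) I" by (intro algebra_ideal.intro Z_alg Z_ideal)
  \<comment> \<open>The same ring in another record, with integer scalars. Condition (i) does not
    mention scalars, so the comparison along the identity carries it over, and the result on
    semidirect products then applies over the integers instead of \<open>k\<close>.\<close>
  have "id \<in> ring_hom A (as_int_algebra A)" by (intro ring_hom_memI) (auto simp: as_int_algebra_def)
  from pro_tor_quot_zero_image[OF this assms(5)] Z_ideal
  have "(\<forall>n>0. pro_tor_quot_zero A I n) \<longleftrightarrow> (\<forall>n>0. pro_tor_quot_zero (as_int_algebra A) I n)" by simp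
  also have "\<dots> \<longleftrightarrow> pro_tor_unital A I"
    unfolding pro_tor_unital_def by (rule algebra_ideal.pro_tor_quot_iff_semidirect[OF Z])
  finally have unital: "(\<forall>n>0. pro_tor_quot_zero A I n) \<longleftrightarrow> pro_tor_unital A I" .
  have "f \<in> ring_hom A B" using assms(4) by (simp add: nc_algebra_hom_def)
  from pro_tor_quot_zero_image[OF this assms(5-7)] unital A.pro_tor_quot_iff_semidirect
  show ?thesis by blast
qed

end
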